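(* Consider the random-design linear regression setting of the context. Assume: (1) $\mathbf E(\mathbf x_{1t}\mathbf x_{1t}')$ is a positive definite matrix; (2) $\lim_{n\to\infty}M_n\ge \max_{i\in t} i$; (3) there is $\kappa>0$ such that for every $n\in\mathbf N$ the minimal eigenvalue $\kappa_n$ of $\mathbf E[\mathbf x_1^{(n)}\mathbf x_1^{(n)\prime}]$ satisfies $\kappa_n>\kappa$; (4) for some $\eta>0$, $n^{-1}M_n^{1+\eta}\to 0$ and $$\sup_n\ \sup_{\|\mathbf d\|=1}\mathbf E\,|\mathbf d'\mathbf z^{(n)}|^{4\lceil 2/\eta\rceil}<\infty,\qquad \mathbf z^{(n)}=\big(\mathbf E[\mathbf x_1^{(n)}\mathbf x_1^{(n)\prime}]\big)^{-1/2}\mathbf x_1^{(n)},$$ where $\lceil 2/\eta\rceil$ is the smallest integer greater than or equal to $2/\eta$; (5) $a_n/n\to 0$ as $n\to\infty$. (a) If moreover $M_n/(a_n+\log n)\to 0$, then the greedy version of the mPVC procedure is consistent: the probability that the set it selects equals $t$ tends to $1$ as $n\to\infty$. (b) If moreover $a_n\to\infty$ and $M_n/a_n\to 0$, then the greedy version of the MPVC procedure is consistent: the probability that the set it selects equals $t$ tends to $1$ as $n\to\infty$.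
   Context: Setting. For each $n$ one observes $\mathbf Y=\mathbf X\boldsymbol\beta+\boldsymbol\varepsilon$, where $\mathbf Y$ is $n\times 1$, $\mathbf X$ is an $n\times M_n$ random matrix and $\boldsymbol\varepsilon\sim N(0,\sigma^2\mathbf I)$ is independent of $\mathbf X$, $\sigma^2>0$. The integer sequence $(M_n)$ is nondecreasing (possibly bounded). The rows $\mathbf x_l^{(n)\prime}$, $\mathbf x_l^{(n)}=(x^{(n)}_{l,1},\ldots,x^{(n)}_{l,M_n})'$, $l=1,\ldots,n$, of $\mathbf X$ are i.i.d. with finite second moments of all coordinates, and the law of the first $M_n$ coordinates of $\mathbf x_1^{(n+1)}$ coincides with the law of $\mathbf x_1^{(n)}$. The parameter is $\boldsymbol\beta=(\beta_1,\ldots,\beta_{M_n})'$, where the $\beta_i$ do not depend on $n$ and only finitely many are nonzero. The minimal true model is $t=\{i:\beta_i\ne 0\}$, a fixed finite set that does not change with $n$; $p_t=|t|$. $\mathbf x_{lt}$ denotes the subvector of $\mathbf x_l^{(n)}$ with indices in $t$. $(a_n)$ is a sequence of nonnegative numbers. A model is a set $j\subseteq f=\{1,\ldots,M_n\}$, $p_j=|j|$; $f$ is the full model ($p_f=M_n$), $0$ denotes the empty model ($\mathbf Y=\boldsymbol\varepsilon$). $RSS(j)$ is the sum of squared residuals of the least squares fit of $\mathbf Y$ on the columns of $\mathbf X$ with indices in $j$ (no intercept; $RSS(0)=\|\mathbf Y\|^2$). For $j\subseteq k$, $$R^n_{jk}=\frac{RSS(j)-RSS(k)}{RSS(j)}.$$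 For $j\subsetneq k$, $p(R^n_{jk}|p_k,p_j)=1-F(R^n_{jk})$, where $F$ is the cumulative distribution function of the Beta distribution with shape parameters $\frac{p_k-p_j}{2}$ and $\frac{n-p_k}{2}$ (defined for $n>p_k$); by convention $p(R^n_{00}|0,0)=e^{a_n}/\sqrt n$ in the mPVC criterion and $p(R^n_{ff}|M_n,M_n)=1$ in the MPVC criterion. Criteria. Over a family $\mathcal M$ of models, the minimal $p$-value criterion mPVC selects $\operatorname{argmin}_{j\in\mathcal M}e^{p_ja_n}p(R^n_{0j}|p_j,0)$ (when a minimizer is not unique, the set with the smallest number of elements is chosen; in the case of ties, an arbitrary minimizer is selected), and the maximal $p$-value criterion MPVC selects $\operatorname{argmax}_{j\in\mathcal M}e^{-p_ja_n}p(R^n_{jf}|M_n,p_j)$. Greedy procedures. Let $PV_i=p(R^n_{(f-\{i\})f}|M_n,M_n-1)$, $i=1,\ldots,M_n$. Step 1: order these $p$-values nondecreasingly, $PV_{i_1}\le PV_{i_2}\le\cdots\le PV_{i_{M_n}}$. Step 2: consider the nested family $\mathcal M=\{\{i_1,\ldots,i_k\}:k=1,\ldots,M_n\}$ and optimize the criterion over this family. The greedy version of mPVC (respectively MPVC) uses the mPVC (respectively MPVC) criterion in Step 2. *)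

theory Defs
  imports "HOL-Probability.Probability" "Jordan_Normal_Form.Spectral_Radius"
begin

text \<open>
  Observations and variables are indexed from 1, as in \<open>l \<in> {1..n}\<close>, \<open>i \<in> {1..m}\<close>.
  For one realisation of the data, \<open>X l i\<close> is the entry of the design matrix in row \<open>l\<close> and
  column \<open>i\<close> and \<open>Y l\<close> is the response; \<open>m\<close> is the number of available variables.
\<close>

definition sq_resid ::
  "nat \<Rightarrow> (nat \<Rightarrow> nat \<Rightarrow> real) \<Rightarrow> (nat \<Rightarrow> real) \<Rightarrow> nat set \<Rightarrow> (nat \<Rightarrow> real) \<Rightarrow> real" where
  "sq_resid n X Y j b = (\<Sum>l = 1..n. (Y l - (\<Sum>i\<in>j. X l i * b i))\<^sup>2)"

text \<open>
  The coefficient vector of the fit need not be unique (collinear columns, or \<open>card j > n\<close>),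
  but the residual sum of squares does not depend on the choice.
\<close>

definition ls_fit ::
  "nat \<Rightarrow> (nat \<Rightarrow> nat \<Rightarrow> real) \<Rightarrow> (nat \<Rightarrow> real) \<Rightarrow> nat set \<Rightarrow> (nat \<Rightarrow> real)" where
  "ls_fit n X Y j = arg_min (sq_resid n X Y j) (\<lambda>b. True)"

definition RSS ::
  "nat \<Rightarrow> (nat \<Rightarrow> nat \<Rightarrow> real) \<Rightarrow> (nat \<Rightarrow> real) \<Rightarrow> nat set \<Rightarrow> real" where
  "RSS n X Y j = sq_resid n X Y j (ls_fit n X Y j)"

definition R_stat ::
  "nat \<Rightarrow> (nat \<Rightarrow> nat \<Rightarrow> real) \<Rightarrow> (nat \<Rightarrow> real) \<Rightarrow> nat set \<Rightarrow> nat set \<Rightarrow> real" where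
  "R_stat n X Y j k = (RSS n X Y j - RSS n X Y k) / RSS n X Y j"

definition beta_density :: "real \<Rightarrow> real \<Rightarrow> real \<Rightarrow> real" where
  "beta_density a b x =
     (if 0 < x \<and> x < 1 then x powr (a - 1) * (1 - x) powr (b - 1) / Beta a b else 0)"

definition beta_distribution :: "real \<Rightarrow> real \<Rightarrow> real measure" where
  "beta_distribution a b = density lborel (\<lambda>x. ennreal (beta_density a b x))"

text \<open>Meaningful for \<open>pj < pk < n\<close>, when both shape parameters are positive.\<close>

definition p_value :: "nat \<Rightarrow> real \<Rightarrow> nat \<Rightarrow> nat \<Rightarrow> real" where
  "p_value n r pk pj =
     1 - cdf (beta_distribution ((real pk - real pj) / 2) ((real n - real pk) / 2)) r"

text \<open>
  The values on the empty model, respectively on the full model, are conventions: the p-value is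
  not defined there.
\<close>

definition mPVC_crit ::
  "nat \<Rightarrow> real \<Rightarrow> (nat \<Rightarrow> nat \<Rightarrow> real) \<Rightarrow> (nat \<Rightarrow> real) \<Rightarrow> nat set \<Rightarrow> real" where
  "mPVC_crit n a X Y j =
     exp (real (card j) * a) *
     (if j = {} then exp a / sqrt (real n) else p_value n (R_stat n X Y {} j) (card j) 0)"

definition MPVC_crit ::
  "nat \<Rightarrow> nat \<Rightarrow> real \<Rightarrow> (nat \<Rightarrow> nat \<Rightarrow> real) \<Rightarrow> (nat \<Rightarrow> real) \<Rightarrow> nat set \<Rightarrow> real" where
  "MPVC_crit n m a X Y j =
     exp (- (real (card j) * a)) *
     (if j = {1..m} then 1 else p_value n (R_stat n X Y j {1..m}) m (card j))"

text \<open>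
  The selected model is determined only up to ties (for \<open>mPVC\<close>, ties among the minimizers
  with the smallest number of elements), so a criterion is represented by the set of
  all models that it may select from the family \<open>F\<close>.
\<close>

definition mPVC_select ::
  "nat \<Rightarrow> real \<Rightarrow> (nat \<Rightarrow> nat \<Rightarrow> real) \<Rightarrow> (nat \<Rightarrow> real) \<Rightarrow> nat set set \<Rightarrow> nat set set" where
  "mPVC_select n a X Y F =
     {j. is_arg_min card (is_arg_min (mPVC_crit n a X Y) (\<lambda>k. k \<in> F)) j}"

definition MPVC_select ::
  "nat \<Rightarrow> nat \<Rightarrow> real \<Rightarrow> (nat \<Rightarrow> nat \<Rightarrow> real) \<Rightarrow> (nat \<Rightarrow> real) \<Rightarrow> nat set set \<Rightarrow> nat set set" where
  "MPVC_select n m a X Y F = {j. is_arg_max (MPVC_crit n m a X Y) (\<lambda>k. k \<in> F) j}"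

definition PV ::
  "nat \<Rightarrow> nat \<Rightarrow> (nat \<Rightarrow> nat \<Rightarrow> real) \<Rightarrow> (nat \<Rightarrow> real) \<Rightarrow> nat \<Rightarrow> real" where
  "PV n m X Y i = p_value n (R_stat n X Y ({1..m} - {i}) {1..m}) m (m - 1)"

definition PV_ordering ::
  "nat \<Rightarrow> nat \<Rightarrow> (nat \<Rightarrow> nat \<Rightarrow> real) \<Rightarrow> (nat \<Rightarrow> real) \<Rightarrow> nat list \<Rightarrow> bool" where
  "PV_ordering n m X Y is \<longleftrightarrow>
     distinct is \<and> set is = {1..m} \<and> sorted (map (PV n m X Y) is)"

definition nested_family :: "nat list \<Rightarrow> nat set set" where
  "nested_family is = {set (take k is) | k. k \<in> {1..length is}}"

text \<open>
  All models that may be selected, over all ways of breaking ties in the ordering of the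
  p-values and in the optimisation.
\<close>

definition greedy_mPVC ::
  "nat \<Rightarrow> nat \<Rightarrow> real \<Rightarrow> (nat \<Rightarrow> nat \<Rightarrow> real) \<Rightarrow> (nat \<Rightarrow> real) \<Rightarrow> nat set set" where
  "greedy_mPVC n m a X Y =
     {j. \<exists>is. PV_ordering n m X Y is \<and> j \<in> mPVC_select n a X Y (nested_family is)}"

definition greedy_MPVC ::
  "nat \<Rightarrow> nat \<Rightarrow> real \<Rightarrow> (nat \<Rightarrow> nat \<Rightarrow> real) \<Rightarrow> (nat \<Rightarrow> real) \<Rightarrow> nat set set" where
  "greedy_MPVC n m a X Y =
     {j. \<exists>is. PV_ordering n m X Y is \<and> j \<in> MPVC_select n m a X Y (nested_family is)}"

text \<open>
  Matrices and vectors of the library are indexed from 0; the entries of a subvector with index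
  set \<open>j\<close> are listed in increasing order of the index.
\<close>

definition subvec :: "nat set \<Rightarrow> (nat \<Rightarrow> real) \<Rightarrow> real vec" where
  "subvec j v = vec (card j) (\<lambda>r. v (sorted_list_of_set j ! r))"

definition second_moment_mat :: "'a measure \<Rightarrow> nat \<Rightarrow> ('a \<Rightarrow> real vec) \<Rightarrow> real mat" where
  "second_moment_mat Q d V =
     mat d d (\<lambda>(r, s). \<integral>\<omega>. vec_index (V \<omega>) r * vec_index (V \<omega>) s \<partial>Q)"

definition pos_def_mat :: "real mat \<Rightarrow> bool" where
  "pos_def_mat A \<longleftrightarrow>
     square_mat A \<and> transpose_mat A = A \<and>
     (\<forall>v \<in> carrier_vec (dim_row A). v \<noteq> 0\<^sub>v (dim_row A) \<longrightarrow> 0 < scalar_prod v (mult_mat_vec A v))"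

definition min_eigenvalue :: "real mat \<Rightarrow> real" where
  "min_eigenvalue A = Min (spectrum A)"

text \<open>\<open>B\<close> is the symmetric positive definite square root of the inverse of \<open>A\<close>.\<close>

definition is_inv_sqrt_mat :: "real mat \<Rightarrow> real mat \<Rightarrow> bool" where
  "is_inv_sqrt_mat A B \<longleftrightarrow>
     B \<in> carrier_mat (dim_row A) (dim_row A) \<and> pos_def_mat B \<and> inverts_mat A (B * B) \<and> inverts_mat (B * B) A"

text \<open>
  Independence of two random elements whose values may have different types;
  \<open>indep_var\<close> requires equal types.
\<close>

definition indep_rv ::
  "'a measure \<Rightarrow> 'b measure \<Rightarrow> ('a \<Rightarrow> 'b) \<Rightarrow> 'c measure \<Rightarrow> ('a \<Rightarrow> 'c) \<Rightarrow> bool" where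
  "indep_rv Q N V L W \<longleftrightarrow>
     V \<in> measurable Q N \<and> W \<in> measurable Q L \<and>
     prob_space.indep_set Q
       {V -` A \<inter> space Q | A. A \<in> sets N} {W -` B \<inter> space Q | B. B \<in> sets L}"

text \<open>
  For every \<open>n \<ge> 1\<close>, on the probability space \<open>P n\<close>: \<open>x n l i\<close> is the design entry in row \<open>l\<close> and
  column \<open>i\<close>, \<open>eps n l\<close> the error of observation \<open>l\<close>, \<open>M n\<close> the number of variables, and
  \<open>\<sigma>\<close> the standard deviation of the errors. Only the entries with \<open>l \<in> {1..n}\<close> and
  \<open>i \<in> {1..M n}\<close> matter.
\<close>

definition design_row ::
  "(nat \<Rightarrow> nat \<Rightarrow> nat \<Rightarrow> 'a \<Rightarrow> real) \<Rightarrow> nat \<Rightarrow> nat \<Rightarrow> nat \<Rightarrow> 'a \<Rightarrow> (nat \<Rightarrow> real)" where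
  "design_row x n l m \<omega> = (\<lambda>i\<in>{1..m}. x n l i \<omega>)"

definition random_design ::
  "(nat \<Rightarrow> 'a measure) \<Rightarrow> (nat \<Rightarrow> nat) \<Rightarrow> (nat \<Rightarrow> nat \<Rightarrow> nat \<Rightarrow> 'a \<Rightarrow> real) \<Rightarrow>
   (nat \<Rightarrow> nat \<Rightarrow> 'a \<Rightarrow> real) \<Rightarrow> real \<Rightarrow> bool" where
  "random_design P M x eps \<sigma> \<longleftrightarrow>
     0 < \<sigma> \<and> mono_on {1..} M \<and>
     (\<forall>n\<ge>1.
        prob_space (P n) \<and>
        prob_space.indep_vars (P n) (\<lambda>l. borel) (eps n) {1..n} \<and>
        (\<forall>l\<in>{1..n}. distributed (P n) lborel (eps n l) (\<lambda>y. ennreal (normal_density 0 \<sigma> y))) \<and>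
        indep_rv (P n)
          (PiM {1..n} (\<lambda>l. borel)) (\<lambda>\<omega>. \<lambda>l\<in>{1..n}. eps n l \<omega>)
          (PiM ({1..n} \<times> {1..M n}) (\<lambda>_. borel)) (\<lambda>\<omega>. \<lambda>(l, i)\<in>{1..n} \<times> {1..M n}. x n l i \<omega>) \<and>
        prob_space.indep_vars (P n) (\<lambda>l. PiM {1..M n} (\<lambda>i. borel))
          (\<lambda>l. design_row x n l (M n)) {1..n} \<and>
        (\<forall>l\<in>{1..n}.
           distr (P n) (PiM {1..M n} (\<lambda>i. borel)) (design_row x n l (M n)) =
           distr (P n) (PiM {1..M n} (\<lambda>i. borel)) (design_row x n 1 (M n))) \<and>
        (\<forall>l\<in>{1..n}. \<forall>i\<in>{1..M n}. integrable (P n) (\<lambda>\<omega>. (x n l i \<omega>)\<^sup>2)) \<and>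
        distr (P (Suc n)) (PiM {1..M n} (\<lambda>i. borel)) (design_row x (Suc n) 1 (M n)) =
        distr (P n) (PiM {1..M n} (\<lambda>i. borel)) (design_row x n 1 (M n)))"

definition design ::
  "(nat \<Rightarrow> nat \<Rightarrow> nat \<Rightarrow> 'a \<Rightarrow> real) \<Rightarrow> nat \<Rightarrow> 'a \<Rightarrow> nat \<Rightarrow> nat \<Rightarrow> real" where
  "design x n \<omega> l i = x n l i \<omega>"

definition response ::
  "(nat \<Rightarrow> nat) \<Rightarrow> (nat \<Rightarrow> nat \<Rightarrow> nat \<Rightarrow> 'a \<Rightarrow> real) \<Rightarrow> (nat \<Rightarrow> nat \<Rightarrow> 'a \<Rightarrow> real) \<Rightarrow>
   (nat \<Rightarrow> real) \<Rightarrow> nat \<Rightarrow> 'a \<Rightarrow> nat \<Rightarrow> real" where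
  "response M x eps \<beta> n \<omega> l = (\<Sum>i = 1..M n. x n l i \<omega> * \<beta> i) + eps n l \<omega>"

definition true_model :: "(nat \<Rightarrow> real) \<Rightarrow> nat set" where
  "true_model \<beta> = {i. 1 \<le> i \<and> \<beta> i \<noteq> 0}"

definition second_moment_row ::
  "(nat \<Rightarrow> 'a measure) \<Rightarrow> (nat \<Rightarrow> nat \<Rightarrow> nat \<Rightarrow> 'a \<Rightarrow> real) \<Rightarrow> nat \<Rightarrow> nat set \<Rightarrow> real mat" where
  "second_moment_row P x n j =
     second_moment_mat (P n) (card j) (\<lambda>\<omega>. subvec j (design x n \<omega> 1))"

end

theory Submission
  imports Defs "HOL-Real_Asymp.Real_Asymp"
begin

text \<open>
  Everything rests on a gap between residual sums of squares. Let \<open>E\<close> be the squared length of the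
  noise vector. Suppose that the design is well conditioned, so that the squared length of \<open>X v\<close> is
  at least \<open>c * n * (v i)\<^sup>2\<close> for every coefficient vector \<open>v\<close> and every \<open>i\<close>, and that the squared inner
  product of the noise with \<open>X v\<close> is at most \<open>D\<close> times the squared length of \<open>X v\<close>. Fitting a model
  \<open>j\<close> leaves the residual noise plus \<open>X v\<close>, where \<open>v\<close> agrees with the true coefficients outside \<open>j\<close>.
  Completing the square shows that \<open>RSS j\<close> lies between \<open>E - D\<close> and \<open>E\<close> when \<open>j\<close> contains the true
  model \<open>t\<close>, and exceeds \<open>E\<close> by a multiple of \<open>n\<close> when \<open>j\<close> misses a true variable, provided that \<open>D\<close>
  is small compared with \<open>n\<close> (\<open>rss_gap_from_geometry\<close>).

  Given this gap, with \<open>D\<close> of the order of the number \<open>m\<close> of variables, the selection is a matter of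
  beta tails. Deleting a true variable from the full model raises the residual sum of squares more
  than deleting any other one, so the true variables come first in the ordering and the nested family
  consists of subsets and supersets of \<open>t\<close>, with \<open>t\<close> among them. It remains to compare \<open>t\<close> with a
  proper subset and with a proper superset.

  For \<open>mPVC\<close>, a proper subset has a p-value larger by an exponential factor in \<open>n\<close>, which no penalty
  of order \<open>a n = o(n)\<close> outweighs (\<open>mPVC_underfit_ineq\<close>). For a superset with \<open>d\<close> more variables the
  power of the residual ratio changes by a factor \<open>exp (O(m))\<close> only, whereas the normalising constant
  of the beta tail is multiplied by at most \<open>sqrt (m / (n - m))\<close>, hence by a negative power of \<open>n\<close>,
  for each variable added. Together with the penalty this is worth \<open>d * (a n + \<gamma> * ln n)\<close> in the exponent, and \<open>m\<close> is of
  smaller order than that (\<open>mPVC_overfit_ineq\<close>). For \<open>MPVC\<close>, the statistic of \<open>t\<close> against the full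
  model is of order \<open>m / n\<close>, so that its p-value is at least \<open>exp (- O(m))\<close>, above \<open>exp (- a n)\<close>,
  while a p-value never exceeds 1: supersets lose through their penalty. Subsets lose because their
  p-values are exponentially small in \<open>n\<close>.

  The well-conditioned design is the probabilistic core. Write the design in whitened coordinates, in
  which the second moment matrix of a row is the identity; the lower bound on the eigenvalues allows
  the return to the original ones. For a fixed direction, a sum of independent squares with bounded
  fourth moments falls below half its mean with probability at most \<open>exp (- n / (8 * C))\<close>, since only
  the lower tail of nonnegative variables is concerned (\<open>sum_of_squares_lower_tail\<close>). A grid of mesh
  \<open>1 / n\<^sup>2\<close> has at most \<open>exp (O(m * ln n))\<close> points, and \<open>m * ln n = o(n)\<close> by the growth condition, so a
  union bound covers the grid; the crude Frobenius bound then passes from the grid to all directions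
  (\<open>lower_frame_bound_from_grid\<close>). The bound on \<open>D\<close> comes from the Markov inequality, as the whitened
  columns have noise inner products of mean square \<open>n * \<sigma>\<^sup>2\<close>.

  All constants are taken in the form: for each \<open>\<rho> > 0\<close> there is a constant \<open>L\<close> such that the gap holds
  with probability at least \<open>1 - \<rho>\<close> for large \<open>n\<close>. As the comparison of criteria is eventually valid
  for any constants, the probability of selecting \<open>t\<close> tends to 1
  (\<open>consistency_of_separated_selection\<close>).
\<close>

section \<open>Least squares by orthogonalisation\<close>

definition ip :: "nat \<Rightarrow> (nat \<Rightarrow> real) \<Rightarrow> (nat \<Rightarrow> real) \<Rightarrow> real" where
  "ip n u v = (\<Sum>l = 1..n. u l * v l)"

abbreviation (input) ip_sq :: "nat \<Rightarrow> (nat \<Rightarrow> real) \<Rightarrow> real" where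
  "ip_sq n u \<equiv> ip n u u"

text \<open>
  The residual of \<open>Y\<close> after projection on the columns in the list, in the recursive Gram--Schmidt
  form. It is an explicit expression in the entries, hence measurable in the data. A column that
  depends on the later ones in the list has \<open>e = 0\<close>, and division by zero then leaves the residual
  unchanged, as it should.
\<close>

primrec gs_resid :: "nat \<Rightarrow> (nat \<Rightarrow> nat \<Rightarrow> real) \<Rightarrow> nat list \<Rightarrow> (nat \<Rightarrow> real) \<Rightarrow> nat \<Rightarrow> real" where
  "gs_resid n X [] Y = Y"
| "gs_resid n X (i # js) Y =
     (let r = gs_resid n X js Y; e = gs_resid n X js (\<lambda>l. X l i)
      in (\<lambda>l. r l - ip n r e / ip_sq n e * e l))"

lemma ip_commute: "ip n u v = ip n v u"
  by (simp add: ip_def mult.commute)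

lemma ip_diff_left: "ip n (\<lambda>l. u l - v l) w = ip n u w - ip n v w"
  by (simp add: ip_def left_diff_distrib sum_subtractf)

lemma ip_add_left: "ip n (\<lambda>l. u l + v l) w = ip n u w + ip n v w"
  by (simp add: ip_def distrib_right sum.distrib)

lemma ip_scale_left: "ip n (\<lambda>l. c * u l) w = c * ip n u w"
  by (simp add: ip_def sum_distrib_left mult.assoc)

lemma ip_add_right: "ip n w (\<lambda>l. u l + v l) = ip n w u + ip n w v"
  by (simp add: ip_def distrib_left sum.distrib)

lemma ip_scale_right: "ip n w (\<lambda>l. c * u l) = c * ip n w u"
  by (simp add: ip_def sum_distrib_left mult_ac)

lemma ip_sum_right: "ip n w (\<lambda>l. \<Sum>i\<in>j. f i l) = (\<Sum>i\<in>j. ip n w (f i))"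
  by (simp add: ip_def sum_distrib_left) (rule sum.swap)

lemma ip_self_nonneg: "0 \<le> ip_sq n u"
  by (simp add: ip_def sum_nonneg)

lemma ip_self_eq_0D: "ip_sq n u = 0 \<Longrightarrow> l \<in> {1..n} \<Longrightarrow> u l = 0"
  by (simp add: ip_def sum_nonneg_eq_0_iff)

lemma ip_self_zero_imp: "ip_sq n u = 0 \<Longrightarrow> ip n w u = 0"
  unfolding ip_def[of n w] by (rule sum.neutral) (use ip_self_eq_0D in auto)

lemma gs_resid_fit:
  assumes "distinct js"
  shows "\<exists>b. \<forall>l. gs_resid n X js Y l = Y l - (\<Sum>i\<in>set js. X l i * b i)"
  using assms
proof (induction js arbitrary: Y)
  case Nil
  then show ?case by simp
next
  case (Cons k js)
  obtain b where b: "\<And>l. gs_resid n X js Y l = Y l - (\<Sum>i\<in>set js. X l i * b i)"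
    using Cons by fastforce
  obtain g where g: "\<And>l. gs_resid n X js (\<lambda>l. X l k) l = X l k - (\<Sum>i\<in>set js. X l i * g i)"
    using Cons by fastforce
  (* the coefficient of Y on the part of column k that is orthogonal to the columns js *)
  define \<theta> where "\<theta> = ip n (gs_resid n X js Y) (gs_resid n X js (\<lambda>l. X l k)) /
    ip_sq n (gs_resid n X js (\<lambda>l. X l k))"
  define b' where "b' = (\<lambda>i. if i = k then \<theta> else b i - \<theta> * g i)"
  have "gs_resid n X (k # js) Y l = Y l - (\<Sum>i\<in>set (k # js). X l i * b' i)" for l
  proof -
    have "(\<Sum>i\<in>set js. X l i * b' i) = (\<Sum>i\<in>set js. X l i * (b i - \<theta> * g i))"
      using Cons.prems by (intro sum.cong) (auto simp: b'_def)
    also have "\<dots> = (\<Sum>i\<in>set js. X l i * b i) - \<theta> * (\<Sum>i\<in>set js. X l i * g i)"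
      by (simp add: right_diff_distrib sum_subtractf sum_distrib_left mult_ac)
    finally have "(\<Sum>i\<in>set (k # js). X l i * b' i) =
        X l k * \<theta> + ((\<Sum>i\<in>set js. X l i * b i) - \<theta> * (\<Sum>i\<in>set js. X l i * g i))"
      using Cons.prems by (simp add: b'_def)
    moreover have "gs_resid n X (k # js) Y l = gs_resid n X js Y l - \<theta> * gs_resid n X js (\<lambda>l. X l k) l"
      by (simp add: Let_def \<theta>_def)
    moreover have "y - s - \<theta> * (z - u) = y - (z * \<theta> + (s - \<theta> * u))" for y s z u
      by (simp add: algebra_simps)
    ultimately show ?thesis
      by (simp only: b g)
  qed
  then show ?case by blast
qed

lemma gs_resid_orthogonal:
  assumes "distinct js" "i \<in> set js"
  shows "ip n (gs_resid n X js Y) (\<lambda>l. X l i) = 0"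
  using assms
proof (induction js arbitrary: Y i)
  case Nil
  then show ?case by simp
next
  case (Cons k js)
  define r where "r = gs_resid n X js Y"
  define e where "e = gs_resid n X js (\<lambda>l. X l k)"
  obtain g where g: "\<And>l. e l = X l k - (\<Sum>i\<in>set js. X l i * g i)"
    unfolding e_def using gs_resid_fit[of js n X "\<lambda>l. X l k"] Cons.prems(1) by auto
  define \<theta> where "\<theta> = ip n r e / ip_sq n e"
  have re: "gs_resid n X (k # js) Y = (\<lambda>l. r l - \<theta> * e l)"
    by (simp add: Let_def r_def e_def \<theta>_def)
  have or: "ip n r (\<lambda>l. X l i) = 0" if "i \<in> set js" for i
    unfolding r_def using Cons that by simp
  have oe: "ip n e (\<lambda>l. X l i) = 0" if "i \<in> set js" for i
    unfolding e_def using Cons that by simp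
  have Xk: "(\<lambda>l. X l k) = (\<lambda>l. e l + (\<Sum>i\<in>set js. g i * X l i))"
    by (auto simp: g mult.commute)
  show ?case
  proof (cases "i \<in> set js")
    case True
    then show ?thesis
      unfolding re by (simp add: ip_diff_left ip_scale_left or oe)
  next
    case False
    then have i: "i = k" using Cons.prems by simp
    have "ip n r (\<lambda>l. X l k) = ip n r e" "ip n e (\<lambda>l. X l k) = ip_sq n e"
      by (simp_all add: Xk ip_add_right ip_sum_right ip_scale_right or oe)
    then show ?thesis
      unfolding re i using ip_self_zero_imp[of n e r]
      by (simp add: ip_diff_left ip_scale_left) (simp add: \<theta>_def)
  qed
qed

lemma sq_resid_ip: "sq_resid n X Y j b = ip_sq n (\<lambda>l. Y l - (\<Sum>i\<in>j. X l i * b i))"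
  by (simp add: sq_resid_def ip_def power2_eq_square)

text \<open>
  By Pythagoras, coefficients whose residual is orthogonal to all columns are optimal, and the
  Gram--Schmidt residual provides such coefficients also for collinear columns.
\<close>

lemma least_squares_exists:
  assumes "finite j"
  obtains b where "is_arg_min (sq_resid n X Y j) (\<lambda>b. True) b"
    and "sq_resid n X Y j b = ip_sq n (gs_resid n X (sorted_list_of_set j) Y)"
proof -
  define js where "js = sorted_list_of_set j"
  have js: "distinct js" "set js = j" using assms by (auto simp: js_def)
  define r where "r = gs_resid n X js Y"
  obtain b where b: "\<And>l. r l = Y l - (\<Sum>i\<in>j. X l i * b i)"
    unfolding r_def using gs_resid_fit[OF js(1), of n X Y] js(2) by auto
  have orth: "ip n r (\<lambda>l. X l i) = 0" if "i \<in> j" for i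
    unfolding r_def using js that by (intro gs_resid_orthogonal) auto
  have le: "sq_resid n X Y j b \<le> sq_resid n X Y j c" for c
  proof -
    define d where "d = (\<lambda>l. \<Sum>i\<in>j. (b i - c i) * X l i)"
    have rd: "ip n r d = 0"
      unfolding d_def by (simp add: ip_sum_right ip_scale_right orth)
    have eq: "Y l - (\<Sum>i\<in>j. X l i * c i) = r l + d l" for l
      by (simp add: b d_def algebra_simps sum_subtractf)
    have "sq_resid n X Y j c = ip_sq n r + 2 * ip n r d + ip_sq n d"
      unfolding sq_resid_ip eq by (simp add: ip_add_left ip_add_right ip_commute[of n d r])
    moreover have "sq_resid n X Y j b = ip_sq n r"
      unfolding sq_resid_ip b[symmetric] by simp
    ultimately show ?thesis using rd ip_self_nonneg[of n d] by simp
  qed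
  show ?thesis
  proof (rule that)
    show "is_arg_min (sq_resid n X Y j) (\<lambda>b. True) b"
      using le by (auto simp: is_arg_min_def not_less)
    show "sq_resid n X Y j b = ip_sq n (gs_resid n X (sorted_list_of_set j) Y)"
      unfolding sq_resid_ip b[symmetric] r_def js_def by simp
  qed
qed

lemma ls_fit_is_arg_min:
  assumes "finite j"
  shows "is_arg_min (sq_resid n X Y j) (\<lambda>b. True) (ls_fit n X Y j)"
proof -
  obtain b where "is_arg_min (sq_resid n X Y j) (\<lambda>b. True) b"
    using least_squares_exists[OF assms, of n X Y] .
  then show ?thesis
    unfolding ls_fit_def arg_min_def by (rule someI[of "is_arg_min (sq_resid n X Y j) (\<lambda>b. True)"])
qed

lemma RSS_le: "finite j \<Longrightarrow> RSS n X Y j \<le> sq_resid n X Y j b"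
  unfolding RSS_def using ls_fit_is_arg_min[of j n X Y] by (auto simp: is_arg_min_def not_less)

text \<open>
  This eliminates the choice of a minimiser from \<open>RSS\<close> and makes it a measurable function of the
  data.
\<close>

lemma RSS_gs_resid:
  assumes "finite j"
  shows "RSS n X Y j = ip_sq n (gs_resid n X (sorted_list_of_set j) Y)"
proof -
  obtain b where b: "is_arg_min (sq_resid n X Y j) (\<lambda>b. True) b"
    and eq: "sq_resid n X Y j b = ip_sq n (gs_resid n X (sorted_list_of_set j) Y)"
    using least_squares_exists[OF assms, of n X Y] .
  have "RSS n X Y j \<le> sq_resid n X Y j b" by (rule RSS_le[OF assms])
  moreover have "sq_resid n X Y j b \<le> RSS n X Y j"
    using b unfolding RSS_def by (auto simp: is_arg_min_def not_less)
  ultimately show ?thesis using eq by simp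
qed

lemma RSS_nonneg: "0 \<le> RSS n X Y j"
  unfolding RSS_def sq_resid_def by (simp add: sum_nonneg)

lemma RSS_antimono:
  assumes "finite k" "j \<subseteq> k"
  shows "RSS n X Y k \<le> RSS n X Y j"
proof -
  have fj: "finite j" using assms finite_subset by blast
  define b where "b = (\<lambda>i. if i \<in> j then ls_fit n X Y j i else 0)"
  have eq: "(\<Sum>i\<in>k. X l i * b i) = (\<Sum>i\<in>j. X l i * ls_fit n X Y j i)" for l
    using assms unfolding b_def by (intro sum.mono_neutral_cong_right) auto
  have "RSS n X Y k \<le> sq_resid n X Y k b" by (rule RSS_le[OF assms(1)])
  also have "\<dots> = RSS n X Y j" unfolding RSS_def sq_resid_def eq ..
  finally show ?thesis .
qed

lemma borel_measurable_gs_resid: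
  assumes X: "\<And>l i. l \<in> {1..n} \<Longrightarrow> i \<in> set js \<Longrightarrow> (\<lambda>\<omega>. X \<omega> l i) \<in> borel_measurable Q"
    and Y: "\<And>l. l \<in> {1..n} \<Longrightarrow> (\<lambda>\<omega>. Y \<omega> l) \<in> borel_measurable Q"
    and l: "l \<in> {1..n}"
  shows "(\<lambda>\<omega>. gs_resid n (X \<omega>) js (Y \<omega>) l) \<in> borel_measurable Q"
  using assms
proof (induction js arbitrary: Y l)
  case Nil
  then show ?case by simp
next
  case (Cons k js)
  have m1: "(\<lambda>\<omega>. gs_resid n (X \<omega>) js (Y \<omega>) l) \<in> borel_measurable Q" if "l \<in> {1..n}" for l
    using Cons.prems that by (intro Cons.IH) auto
  have m2: "(\<lambda>\<omega>. gs_resid n (X \<omega>) js (\<lambda>l. X \<omega> l k) l) \<in> borel_measurable Q" if "l \<in> {1..n}" for l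
    using Cons.prems that by (intro Cons.IH) auto
  show ?case
    unfolding gs_resid.simps Let_def ip_def
    by (intro borel_measurable_diff borel_measurable_times borel_measurable_divide
        borel_measurable_sum m1 m2 Cons.prems(3))
qed

lemma borel_measurable_RSS:
  assumes "\<And>l i. l \<in> {1..n} \<Longrightarrow> i \<in> j \<Longrightarrow> (\<lambda>\<omega>. X \<omega> l i) \<in> borel_measurable Q"
    and "\<And>l. l \<in> {1..n} \<Longrightarrow> (\<lambda>\<omega>. Y \<omega> l) \<in> borel_measurable Q"
    and j: "finite j"
  shows "(\<lambda>\<omega>. RSS n (X \<omega>) (Y \<omega>) j) \<in> borel_measurable Q"
  unfolding RSS_gs_resid[OF j] ip_def using assms
  by (intro borel_measurable_sum borel_measurable_times borel_measurable_gs_resid) auto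

section \<open>Tails of the beta distribution\<close>

definition beta_kernel :: "real \<Rightarrow> real \<Rightarrow> real \<Rightarrow> real" where
  "beta_kernel \<alpha> b x = x powr (\<alpha> - 1) * (1 - x) powr (b - 1)"

definition beta_tail :: "real \<Rightarrow> real \<Rightarrow> real \<Rightarrow> real" where
  "beta_tail \<alpha> b r = integral {r..1} (beta_kernel \<alpha> b)"

lemma beta_kernel_nonneg: "0 \<le> x \<Longrightarrow> x \<le> 1 \<Longrightarrow> 0 \<le> beta_kernel \<alpha> b x"
  by (simp add: beta_kernel_def)

lemma beta_kernel_has_integral:
  assumes "0 < \<alpha>" "0 < b"
  shows "(beta_kernel \<alpha> b has_integral Beta \<alpha> b) {0..1}"
  using has_integral_Beta_real[OF assms] by (simp add: beta_kernel_def[abs_def])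

lemma beta_kernel_integrable:
  assumes "0 < \<alpha>" "0 < b" "0 \<le> r" "s \<le> 1"
  shows "beta_kernel \<alpha> b integrable_on {r..s}"
  using beta_kernel_has_integral[OF assms(1,2)] assms(3,4)
  by (meson has_integral_integrable integrable_on_subinterval atLeastatMost_subset_iff)

lemma beta_tail_0: "0 < \<alpha> \<Longrightarrow> 0 < b \<Longrightarrow> beta_tail \<alpha> b 0 = Beta \<alpha> b"
  unfolding beta_tail_def using beta_kernel_has_integral by (rule integral_unique)

lemma beta_tail_split:
  assumes "0 < \<alpha>" "0 < b" "0 \<le> r" "r \<le> s" "s \<le> 1"
  shows "beta_tail \<alpha> b r = integral {r..s} (beta_kernel \<alpha> b) + beta_tail \<alpha> b s"
  unfolding beta_tail_def using assms
  by (intro Henstock_Kurzweil_Integration.integral_combine[symmetric] beta_kernel_integrable) auto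

lemma beta_tail_nonneg: "0 < \<alpha> \<Longrightarrow> 0 < b \<Longrightarrow> 0 \<le> r \<Longrightarrow> 0 \<le> beta_tail \<alpha> b r"
  unfolding beta_tail_def
  by (intro integral_nonneg beta_kernel_integrable) (auto simp: beta_kernel_nonneg)

lemma Beta_real_pos: "0 < \<alpha> \<Longrightarrow> 0 < b \<Longrightarrow> 0 < Beta \<alpha> (b::real)"
  by (simp add: Beta_def Gamma_real_pos)

text \<open>
  The conventions agree at the endpoints: \<open>beta_density\<close> is 0 at 0 and 1 by definition, and the
  kernel is so because 0 to any power \<open>powr\<close> is 0.
\<close>

lemma emeasure_beta_distribution_atMost:
  assumes "0 < \<alpha>" "0 < b" "0 \<le> r" "r \<le> 1"
  shows "emeasure (beta_distribution \<alpha> b) {..r} =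
    ennreal (integral {0..r} (beta_kernel \<alpha> b) / Beta \<alpha> b)"
proof -
  have B: "0 < Beta \<alpha> b" using assms by (intro Beta_real_pos)
  have meas: "beta_density \<alpha> b \<in> borel_measurable borel"
    unfolding beta_density_def[abs_def] by measurable
  have "emeasure (beta_distribution \<alpha> b) {..r} =
      (\<integral>\<^sup>+x. ennreal (beta_density \<alpha> b x) * indicator {..r} x \<partial>lborel)"
    unfolding beta_distribution_def using meas by (intro emeasure_density) auto
  also have "\<dots> = (\<integral>\<^sup>+x. ennreal (beta_kernel \<alpha> b x / Beta \<alpha> b) * indicator {0..r} x \<partial>lborel)"
    using assms
    by (intro nn_integral_cong)
      (auto simp: beta_density_def beta_kernel_def indicator_def not_less order.order_iff_strict)
  also have "\<dots> = ennreal (integral {0..r} (beta_kernel \<alpha> b) / Beta \<alpha> b)"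
  proof (rule nn_integral_has_integral_lebesgue')
    show "0 \<le> beta_kernel \<alpha> b x / Beta \<alpha> b" if "x \<in> {0..r}" for x
      using that assms B by (simp add: beta_kernel_nonneg)
    show "((\<lambda>x. beta_kernel \<alpha> b x / Beta \<alpha> b) has_integral
        integral {0..r} (beta_kernel \<alpha> b) / Beta \<alpha> b) {0..r}"
      using assms by (intro has_integral_divide integrable_integral beta_kernel_integrable) auto
  qed
  finally show ?thesis .
qed

lemma prob_space_beta_distribution:
  assumes "0 < \<alpha>" "0 < b"
  shows "prob_space (beta_distribution \<alpha> b)"
proof
  have meas: "beta_density \<alpha> b \<in> borel_measurable borel"
    unfolding beta_density_def[abs_def] by measurable
  have "emeasure (beta_distribution \<alpha> b) (space (beta_distribution \<alpha> b)) =
      (\<integral>\<^sup>+x. ennreal (beta_density \<alpha> b x) * indicator UNIV x \<partial>lborel)"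
    unfolding beta_distribution_def using meas by (subst emeasure_density) auto
  also have "\<dots> = (\<integral>\<^sup>+x. ennreal (beta_density \<alpha> b x) * indicator {..1} x \<partial>lborel)"
    by (intro nn_integral_cong) (auto simp: beta_density_def indicator_def)
  also have "\<dots> = emeasure (beta_distribution \<alpha> b) {..1}"
    unfolding beta_distribution_def using meas by (intro emeasure_density[symmetric]) auto
  also have "\<dots> = 1"
    using emeasure_beta_distribution_atMost[OF assms, of 1] beta_tail_0[OF assms]
      Beta_real_pos[OF assms] by (simp add: beta_tail_def)
  finally show "emeasure (beta_distribution \<alpha> b) (space (beta_distribution \<alpha> b)) = 1" .
qed

lemma one_minus_cdf_beta:
  assumes "0 < \<alpha>" "0 < b" "0 \<le> r" "r \<le> 1"
  shows "1 - cdf (beta_distribution \<alpha> b) r = beta_tail \<alpha> b r / Beta \<alpha> b"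
proof -
  have B: "0 < Beta \<alpha> b" using assms by (intro Beta_real_pos)
  have I: "0 \<le> integral {0..r} (beta_kernel \<alpha> b)"
    using assms by (intro integral_nonneg beta_kernel_integrable) (auto simp: beta_kernel_nonneg)
  have "cdf (beta_distribution \<alpha> b) r = integral {0..r} (beta_kernel \<alpha> b) / Beta \<alpha> b"
    unfolding cdf_def measure_def emeasure_beta_distribution_atMost[OF assms]
    using B I by simp
  moreover have "Beta \<alpha> b = integral {0..r} (beta_kernel \<alpha> b) + beta_tail \<alpha> b r"
    using beta_tail_split[of \<alpha> b 0 r] assms by (simp add: beta_tail_0)
  ultimately show ?thesis using B by (simp add: field_simps)
qed

lemma one_minus_cdf_beta_antimono:
  assumes "0 < \<alpha>" "0 < b" "r \<le> s"
  shows "1 - cdf (beta_distribution \<alpha> b) s \<le> 1 - cdf (beta_distribution \<alpha> b) r"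
proof -
  interpret prob_space "beta_distribution \<alpha> b" by (rule prob_space_beta_distribution[OF assms(1,2)])
  have "measure (beta_distribution \<alpha> b) {..r} \<le> measure (beta_distribution \<alpha> b) {..s}"
    using assms(3) by (intro finite_measure_mono) (auto simp: beta_distribution_def)
  then show ?thesis unfolding cdf_def by simp
qed

lemma one_minus_cdf_beta_le_1: "1 - cdf (beta_distribution \<alpha> b) r \<le> 1"
  by (simp add: cdf_def)

text \<open>
  Raising an exponent decreases powers of numbers in the unit interval, so both exponents can be
  raised by 1; this bounds the kernel uniformly also where it has a singularity.
\<close>

lemma beta_block_lower:
  assumes "0 < \<alpha>" "0 < b" "0 < u" "u \<le> v" "v < 1"
  shows "(v - u) * (u powr \<alpha> * (1 - v) powr b) \<le> integral {u..v} (beta_kernel \<alpha> b)"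
proof -
  have "integral {u..v} (\<lambda>x. u powr \<alpha> * (1 - v) powr b) \<le> integral {u..v} (beta_kernel \<alpha> b)"
  proof (rule integral_le)
    show "beta_kernel \<alpha> b integrable_on {u..v}"
      using assms by (intro beta_kernel_integrable) auto
    fix x assume x: "x \<in> {u..v}"
    have "u powr \<alpha> \<le> x powr \<alpha>" using x assms by (intro powr_mono2) auto
    also have "\<dots> \<le> x powr (\<alpha> - 1)" using x assms by (intro powr_mono') auto
    finally have 1: "u powr \<alpha> \<le> x powr (\<alpha> - 1)" .
    have "(1 - v) powr b \<le> (1 - x) powr b" using x assms by (intro powr_mono2) auto
    also have "\<dots> \<le> (1 - x) powr (b - 1)" using x assms by (intro powr_mono') auto
    finally show "u powr \<alpha> * (1 - v) powr b \<le> beta_kernel \<alpha> b x"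
      unfolding beta_kernel_def using 1 by (intro mult_mono) auto
  qed auto
  then show ?thesis using assms by (simp add: mult_ac)
qed

lemma beta_tail_strict_antimono:
  assumes "0 < \<alpha>" "0 < b" "0 \<le> r" "r < s" "s \<le> 1"
  shows "beta_tail \<alpha> b s < beta_tail \<alpha> b r"
proof -
  define u v where "u = (2 * r + s) / 3" and "v = (r + 2 * s) / 3"
  have uv: "0 < u" "r \<le> u" "u < v" "v < 1" "v \<le> s" using assms by (auto simp: u_def v_def)
  have "0 < (v - u) * (u powr \<alpha> * (1 - v) powr b)" using uv by simp
  also have "\<dots> \<le> integral {u..v} (beta_kernel \<alpha> b)"
    using assms uv by (intro beta_block_lower) auto
  finally have I: "0 < integral {u..v} (beta_kernel \<alpha> b)" .
  have nn: "0 \<le> integral {p..q} (beta_kernel \<alpha> b)" if "0 \<le> p" "q \<le> 1" for p q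
    using assms that by (intro integral_nonneg beta_kernel_integrable) (auto simp: beta_kernel_nonneg)
  have "beta_tail \<alpha> b r = integral {r..u} (beta_kernel \<alpha> b) + beta_tail \<alpha> b u"
    using assms uv by (intro beta_tail_split) auto
  moreover have "beta_tail \<alpha> b u = integral {u..v} (beta_kernel \<alpha> b) + beta_tail \<alpha> b v"
    using assms uv by (intro beta_tail_split) auto
  moreover have "beta_tail \<alpha> b v = integral {v..s} (beta_kernel \<alpha> b) + beta_tail \<alpha> b s"
    using assms uv by (intro beta_tail_split) auto
  ultimately show ?thesis using I nn[of r u] nn[of v s] assms uv by simp
qed

lemma has_integral_one_minus_powr:
  fixes b :: real
  assumes "0 < b" "r \<le> 1"
  shows "((\<lambda>x. (1 - x) powr (b - 1)) has_integral (1 - r) powr b / b) {r..1}"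
proof -
  have "((\<lambda>x. (1 - x) powr (b - 1)) has_integral
      (- ((1 - 1) powr b / b)) - (- ((1 - r) powr b / b))) {r..1}"
  proof (rule fundamental_theorem_of_calculus_interior)
    show "continuous_on {r..1} (\<lambda>x. - ((1 - x) powr b / b))"
      using assms by (intro continuous_intros continuous_on_powr') auto
    show "((\<lambda>x. - ((1 - x) powr b / b)) has_vector_derivative (1 - x) powr (b - 1)) (at x)"
      if "x \<in> {r<..<1}" for x
      unfolding has_real_derivative_iff_has_vector_derivative[symmetric]
      using that assms by (auto intro!: derivative_eq_intros simp: powr_diff)
  qed (use assms in auto)
  then show ?thesis using assms by simp
qed

text \<open>
  On \<open>[r, 1]\<close> the first factor of the kernel lies between \<open>r powr \<alpha>\<close> and \<open>1 / r\<close>, and what remains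
  integrates to \<open>(1 - r) powr b / b\<close>. The bounds here and in \<open>beta_tail_lower\<close> differ by the factor
  \<open>r powr (- \<alpha> - 1)\<close>. For \<open>r\<close> bounded away from 0 its logarithm is of the order of the number of
  variables, which the penalties dominate.
\<close>

lemma beta_tail_upper:
  assumes "0 < \<alpha>" "0 < b" "0 < r" "r \<le> 1"
  shows "beta_tail \<alpha> b r \<le> (1 - r) powr b / (r * b)"
proof -
  have H: "((\<lambda>x. 1 / r * (1 - x) powr (b - 1)) has_integral 1 / r * ((1 - r) powr b / b)) {r..1}"
    using assms by (intro has_integral_mult_right has_integral_one_minus_powr)
  have "beta_tail \<alpha> b r \<le> 1 / r * ((1 - r) powr b / b)"
    unfolding beta_tail_def
  proof (rule has_integral_le[OF integrable_integral H])
    show "beta_kernel \<alpha> b integrable_on {r..1}" using assms by (intro beta_kernel_integrable) auto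
    fix x assume x: "x \<in> {r..1}"
    have "x powr (\<alpha> - 1) \<le> x powr (- 1)" using x assms by (intro powr_mono') auto
    also have "\<dots> = 1 / x" using x assms by (simp add: powr_minus_divide)
    also have "\<dots> \<le> 1 / r" using x assms by (simp add: field_simps)
    finally show "beta_kernel \<alpha> b x \<le> 1 / r * (1 - x) powr (b - 1)"
      unfolding beta_kernel_def by (intro mult_right_mono) auto
  qed
  then show ?thesis by simp
qed

lemma beta_tail_lower:
  assumes "0 < \<alpha>" "0 < b" "0 < r" "r \<le> 1"
  shows "r powr \<alpha> * (1 - r) powr b / b \<le> beta_tail \<alpha> b r"
proof -
  have H: "((\<lambda>x. r powr \<alpha> * (1 - x) powr (b - 1)) has_integral r powr \<alpha> * ((1 - r) powr b / b)) {r..1}"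
    using assms by (intro has_integral_mult_right has_integral_one_minus_powr)
  have "r powr \<alpha> * ((1 - r) powr b / b) \<le> beta_tail \<alpha> b r"
    unfolding beta_tail_def
  proof (rule has_integral_le[OF H integrable_integral])
    show "beta_kernel \<alpha> b integrable_on {r..1}" using assms by (intro beta_kernel_integrable) auto
    fix x assume x: "x \<in> {r..1}"
    have "r powr \<alpha> \<le> x powr \<alpha>" using x assms by (intro powr_mono2) auto
    also have "\<dots> \<le> x powr (\<alpha> - 1)" using x assms by (intro powr_mono') auto
    finally show "r powr \<alpha> * (1 - x) powr (b - 1) \<le> beta_kernel \<alpha> b x"
      unfolding beta_kernel_def by (intro mult_right_mono) auto
  qed
  then show ?thesis by simp
qed

lemma beta_initial_upper:
  assumes "0 < \<alpha>" "1 \<le> b" "0 \<le> r" "r \<le> 1"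
  shows "integral {0..r} (beta_kernel \<alpha> b) \<le> r powr \<alpha> / \<alpha>"
proof -
  have H: "((\<lambda>x. x powr (\<alpha> - 1)) has_integral r powr (\<alpha> - 1 + 1) / (\<alpha> - 1 + 1)) {0..r}"
    using assms by (intro has_integral_powr_from_0) auto
  have "integral {0..r} (beta_kernel \<alpha> b) \<le> r powr (\<alpha> - 1 + 1) / (\<alpha> - 1 + 1)"
  proof (rule has_integral_le[OF integrable_integral H])
    show "beta_kernel \<alpha> b integrable_on {0..r}" using assms by (intro beta_kernel_integrable) auto
    fix x assume x: "x \<in> {0..r}"
    have "(1 - x) powr (b - 1) \<le> 1" using x assms by (intro powr_le1) auto
    then show "beta_kernel \<alpha> b x \<le> x powr (\<alpha> - 1)"
      unfolding beta_kernel_def by (intro mult_left_le) auto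
  qed
  then show ?thesis by simp
qed

lemma Beta_le_2:
  assumes "1 / 2 \<le> \<alpha>" "1 \<le> b"
  shows "Beta \<alpha> b \<le> (2::real)"
proof -
  have "Beta \<alpha> b = integral {0..1} (beta_kernel \<alpha> b)"
    using beta_tail_0[of \<alpha> b] assms by (simp add: beta_tail_def)
  also have "\<dots> \<le> 1 powr \<alpha> / \<alpha>" using assms by (intro beta_initial_upper) auto
  also have "\<dots> \<le> 2" using assms by (simp add: field_simps)
  finally show ?thesis .
qed

text \<open>
  For \<open>\<alpha> \<ge> 1 / 2\<close> the integral of \<open>x powr (\<alpha> - 1)\<close> over \<open>[r, 4 * r]\<close> is at least the one over
  \<open>[0, r]\<close>, because \<open>4 powr \<alpha> - 1 \<ge> 1\<close>. The other factor of the kernel costs at most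
  \<open>(1 - 4 * r) powr b\<close> on \<open>[r, 4 * r]\<close>. So the tail carries at least that fraction of the mass of
  \<open>[0, r]\<close>. Comparing two parts of the same integral avoids an estimate of the Beta function and with it a power
  of \<open>b\<close>; against such a power \<open>a n\<close> would have to dominate \<open>ln n\<close>.
\<close>

lemma beta_tail_near_0_lower:
  assumes "1 / 2 \<le> \<alpha>" "1 \<le> b" "0 \<le> r" "4 * r < 1"
  shows "(1 - 4 * r) powr b / 2 \<le> beta_tail \<alpha> b r / Beta \<alpha> b"
proof (cases "r = 0")
  case True
  have "Beta \<alpha> b > 0" using assms by (intro Beta_real_pos) auto
  then show ?thesis using True assms beta_tail_0[of \<alpha> b] by simp
next
  case False
  then have r: "0 < r" using assms by simp
  define q where "q = (1 - 4 * r) powr b"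
  define A0 where "A0 = integral {0..r} (beta_kernel \<alpha> b)"
  have ab: "0 < \<alpha>" "0 < b" using assms by auto
  have q: "0 \<le> q" "q \<le> 1" unfolding q_def using assms by (auto intro!: powr_le1)
  have B: "Beta \<alpha> b = A0 + beta_tail \<alpha> b r"
    using beta_tail_split[of \<alpha> b 0 r] assms ab by (simp add: beta_tail_0 A0_def)
  have A0: "A0 \<le> r powr \<alpha> / \<alpha>"
    unfolding A0_def using assms by (intro beta_initial_upper) auto
  have "((\<lambda>x. x powr (\<alpha> - 1)) has_integral (4 * r) powr (\<alpha> - 1 + 1) / (\<alpha> - 1 + 1)) {0..4 * r}"
    using assms by (intro has_integral_powr_from_0) auto
  moreover have "((\<lambda>x. x powr (\<alpha> - 1)) has_integral r powr (\<alpha> - 1 + 1) / (\<alpha> - 1 + 1)) {0..r}"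
    using assms by (intro has_integral_powr_from_0) auto
  ultimately have P: "(\<lambda>x. x powr (\<alpha> - 1)) integrable_on {r..4 * r}"
    and Peq: "integral {r..4 * r} (\<lambda>x. x powr (\<alpha> - 1)) = (4 * r) powr \<alpha> / \<alpha> - r powr \<alpha> / \<alpha>"
  proof -
    assume I4: "((\<lambda>x. x powr (\<alpha> - 1)) has_integral (4 * r) powr (\<alpha> - 1 + 1) / (\<alpha> - 1 + 1)) {0..4 * r}"
      and I1: "((\<lambda>x. x powr (\<alpha> - 1)) has_integral r powr (\<alpha> - 1 + 1) / (\<alpha> - 1 + 1)) {0..r}"
    show "(\<lambda>x. x powr (\<alpha> - 1)) integrable_on {r..4 * r}"
      by (rule integrable_on_subinterval[OF has_integral_integrable[OF I4]]) (use r in auto)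
    have "integral {0..r} (\<lambda>x. x powr (\<alpha> - 1)) + integral {r..4 * r} (\<lambda>x. x powr (\<alpha> - 1)) =
        integral {0..4 * r} (\<lambda>x. x powr (\<alpha> - 1))"
      by (rule Henstock_Kurzweil_Integration.integral_combine) (use r has_integral_integrable[OF I4] in auto)
    then show "integral {r..4 * r} (\<lambda>x. x powr (\<alpha> - 1)) = (4 * r) powr \<alpha> / \<alpha> - r powr \<alpha> / \<alpha>"
      using integral_unique[OF I4] integral_unique[OF I1] by simp
  qed
  have "4 powr (1 / 2) \<le> (4::real) powr \<alpha>" using assms by (intro powr_mono) auto
  then have "2 \<le> (4::real) powr \<alpha>" by (simp add: powr_half_sqrt)
  then have "2 * r powr \<alpha> \<le> (4 * r) powr \<alpha>" using r by (simp add: powr_mult)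
  then have "r powr \<alpha> / \<alpha> \<le> (4 * r) powr \<alpha> / \<alpha> - r powr \<alpha> / \<alpha>"
    using ab by (simp add: field_simps)
  then have "q * (r powr \<alpha> / \<alpha>) \<le> q * integral {r..4 * r} (\<lambda>x. x powr (\<alpha> - 1))"
    unfolding Peq using q by (intro mult_left_mono) auto
  also have "\<dots> = integral {r..4 * r} (\<lambda>x. q * x powr (\<alpha> - 1))" by simp
  also have "\<dots> \<le> integral {r..4 * r} (beta_kernel \<alpha> b)"
  proof (rule integral_le)
    show "(\<lambda>x. q * x powr (\<alpha> - 1)) integrable_on {r..4 * r}"
      using P by (rule integrable_on_mult_right)
    show "beta_kernel \<alpha> b integrable_on {r..4 * r}"
      using assms ab by (intro beta_kernel_integrable) auto
    fix x assume x: "x \<in> {r..4 * r}"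
    have "q \<le> (1 - x) powr b" unfolding q_def using x assms by (intro powr_mono2) auto
    also have "\<dots> \<le> (1 - x) powr (b - 1)" using x assms r by (intro powr_mono') auto
    finally have "x powr (\<alpha> - 1) * q \<le> beta_kernel \<alpha> b x"
      unfolding beta_kernel_def by (intro mult_left_mono) auto
    then show "q * x powr (\<alpha> - 1) \<le> beta_kernel \<alpha> b x" by (simp add: mult.commute)
  qed
  also have "\<dots> \<le> beta_tail \<alpha> b r"
    using beta_tail_split[of \<alpha> b r "4 * r"] beta_tail_nonneg[of \<alpha> b "4 * r"] assms ab r by simp
  finally have "q * (r powr \<alpha> / \<alpha>) \<le> beta_tail \<alpha> b r" .
  moreover have "q * A0 \<le> q * (r powr \<alpha> / \<alpha>)" using A0 q by (intro mult_left_mono)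
  ultimately have "q * A0 \<le> beta_tail \<alpha> b r" by linarith
  moreover have "q * beta_tail \<alpha> b r \<le> beta_tail \<alpha> b r"
    using q beta_tail_nonneg[of \<alpha> b r] assms ab by (intro mult_left_le_one_le) auto
  moreover have "0 < Beta \<alpha> b" using ab by (intro Beta_real_pos)
  ultimately show ?thesis
    unfolding q_def[symmetric] using B by (simp add: field_simps)
qed

text \<open>
  Logarithmic convexity at the midpoint of \<open>x\<close> and \<open>x + 1\<close>.
\<close>

lemma Gamma_add_half_le:
  assumes "0 < (x::real)"
  shows "Gamma (x + 1 / 2) \<le> sqrt x * Gamma x"
proof -
  have G: "0 < Gamma x" "Gamma x \<noteq> 0" using Gamma_real_pos[OF assms] by auto
  have "(ln \<circ> Gamma) ((1 - 1 / 2) *\<^sub>R x + (1 / 2) *\<^sub>R (x + 1)) \<le>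
      (1 - 1 / 2) * (ln \<circ> Gamma) x + 1 / 2 * (ln \<circ> Gamma) (x + 1)"
    using assms by (intro convex_onD[OF log_convex_Gamma_real]) auto
  moreover have "(1 - 1 / 2) *\<^sub>R x + (1 / 2) *\<^sub>R (x + 1) = x + 1 / 2" by (simp add: field_simps)
  moreover have "ln (Gamma (x + 1)) = ln x + ln (Gamma x)"
    using assms G Gamma_plus1[of x] by (auto simp: ln_mult nonpos_Ints_def)
  ultimately have "ln (Gamma (x + 1 / 2)) \<le> ln x / 2 + ln (Gamma x)" by (simp add: field_simps)
  also have "\<dots> = ln (sqrt x * Gamma x)"
    using assms G by (simp add: ln_mult ln_sqrt less_imp_neq[symmetric])
  finally show ?thesis
    using assms by (subst (asm) ln_le_cancel_iff) (auto simp: Gamma_real_pos)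
qed

text \<open>
  One more variable in a model moves half a unit from \<open>b\<close> to \<open>\<alpha>\<close>. This is the effect on the
  constant that multiplies the p-value in the tail bounds.
\<close>

lemma Beta_half_step:
  assumes "0 < \<alpha>" "1 / 2 < (b::real)"
  shows "(b - 1 / 2) * Beta (\<alpha> + 1 / 2) (b - 1 / 2) \<le> sqrt (\<alpha> / b) * (b * Beta \<alpha> b)"
proof -
  have 1: "(b - 1 / 2) * Gamma (b - 1 / 2) = Gamma (b + 1 / 2)"
    using assms Gamma_plus1[of "b - 1 / 2"] by (auto simp: nonpos_Ints_def add.commute)
  have "sqrt b * sqrt b = b" using assms by simp
  then have 2: "sqrt b = b / sqrt b" using assms by (simp add: field_simps)
  have "(b - 1 / 2) * Beta (\<alpha> + 1 / 2) (b - 1 / 2) = Gamma (\<alpha> + 1 / 2) * Gamma (b + 1 / 2) / Gamma (\<alpha> + b)"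
    unfolding Beta_def 1[symmetric] by simp
  also have "\<dots> \<le> (sqrt \<alpha> * Gamma \<alpha>) * (sqrt b * Gamma b) / Gamma (\<alpha> + b)"
    using assms by (intro divide_right_mono mult_mono Gamma_add_half_le) (auto intro!: less_imp_le[OF Gamma_real_pos])
  also have "\<dots> = sqrt (\<alpha> / b) * (b * Beta \<alpha> b)"
    by (subst 2) (simp add: Beta_def real_sqrt_divide)
  finally show ?thesis .
qed

section \<open>Inequalities between p-values\<close>

text \<open>
  The product of \<open>b\<close> and the Beta function by which a bound on \<open>beta_tail\<close> is divided to give one on
  the p-value of a model with \<open>p\<close> variables against the empty model.
\<close>

definition beta_scale :: "nat \<Rightarrow> nat \<Rightarrow> real" where
  "beta_scale n p = (real n - real p) / 2 * Beta (real p / 2) ((real n - real p) / 2)"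

lemma beta_scale_pos: "1 \<le> p \<Longrightarrow> p < n \<Longrightarrow> 0 < beta_scale n p"
  unfolding beta_scale_def by (intro mult_pos_pos Beta_real_pos) auto

lemma beta_scale_Suc:
  assumes "1 \<le> p" "Suc p < n"
  shows "beta_scale n (Suc p) \<le> sqrt (real p / (real n - real p)) * beta_scale n p"
proof -
  have eq: "(real n - real (Suc p)) / 2 = (real n - real p) / 2 - 1 / 2"
    "real (Suc p) / 2 = real p / 2 + 1 / 2" by (auto simp: field_simps)
  have "(real n - real p) / 2 > 1 / 2" using assms by simp
  then show ?thesis
    unfolding beta_scale_def eq
    using Beta_half_step[of "real p / 2" "(real n - real p) / 2"] assms by simp
qed

text \<open>
  Each of the \<open>d\<close> additional variables contributes a factor of the order \<open>sqrt (m / n)\<close>. This is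
  the part of the penalty on overfitting that the p-value itself provides.
\<close>

lemma beta_scale_add:
  assumes "1 \<le> p" "p + d \<le> m" "m < n"
  shows "beta_scale n (p + d) \<le> sqrt (real m / (real n - real m)) ^ d * beta_scale n p"
  using assms(2)
proof (induction d)
  case 0
  then show ?case by simp
next
  case (Suc d)
  have "beta_scale n (p + Suc d) \<le> sqrt (real (p + d) / (real n - real (p + d))) * beta_scale n (p + d)"
    using beta_scale_Suc[of "p + d" n] Suc.prems assms by simp
  also have "\<dots> \<le> sqrt (real m / (real n - real m)) * (sqrt (real m / (real n - real m)) ^ d * beta_scale n p)"
  proof (rule mult_mono)
    show "sqrt (real (p + d) / (real n - real (p + d))) \<le> sqrt (real m / (real n - real m))"
      using Suc.prems assms by (intro real_sqrt_le_mono frac_le) auto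
    show "beta_scale n (p + d) \<le> sqrt (real m / (real n - real m)) ^ d * beta_scale n p"
      using Suc by simp
    show "0 \<le> beta_scale n (p + d)"
      using beta_scale_pos[of "p + d" n] Suc.prems assms by simp
    show "0 \<le> sqrt (real m / (real n - real m))" using assms by simp
  qed
  finally show ?case by simp
qed

lemma p_value_beta_tail:
  assumes "pj < pk" "pk < n" "0 \<le> r" "r \<le> 1"
  shows "p_value n r pk pj =
    beta_tail ((real pk - real pj) / 2) ((real n - real pk) / 2) r /
    Beta ((real pk - real pj) / 2) ((real n - real pk) / 2)"
  unfolding p_value_def using assms by (intro one_minus_cdf_beta) auto

lemma p_value_le_1: "p_value n r pk pj \<le> 1"
  unfolding p_value_def by (rule one_minus_cdf_beta_le_1)

lemma p_value_antimono:
  assumes "pj < pk" "pk < n" "r \<le> s"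
  shows "p_value n s pk pj \<le> p_value n r pk pj"
  unfolding p_value_def using assms by (intro one_minus_cdf_beta_antimono) auto

lemma p_value_strict_antimono:
  assumes "pj < pk" "pk < n" "0 \<le> r" "r < s" "s \<le> 1"
  shows "p_value n s pk pj < p_value n r pk pj"
  using assms
  by (auto simp: p_value_beta_tail intro!: divide_strict_right_mono beta_tail_strict_antimono Beta_real_pos)

lemma p_value_upper:
  assumes "1 \<le> p" "p < n" "0 < q" "q < 1"
  shows "p_value n (1 - q) p 0 \<le> q powr ((real n - real p) / 2) / ((1 - q) * beta_scale n p)"
proof -
  have B: "0 < Beta (real p / 2) ((real n - real p) / 2)"
    using assms by (intro Beta_real_pos) auto
  have "beta_tail (real p / 2) ((real n - real p) / 2) (1 - q)
      \<le> (1 - (1 - q)) powr ((real n - real p) / 2) / ((1 - q) * ((real n - real p) / 2))"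
    using assms by (intro beta_tail_upper) auto
  from divide_right_mono[OF this less_imp_le[OF B]] show ?thesis
    using assms by (simp add: p_value_beta_tail beta_scale_def mult.assoc)
qed

lemma p_value_lower:
  assumes "1 \<le> p" "p < n" "0 \<le> q" "q < 1"
  shows "(1 - q) powr (real p / 2) * q powr ((real n - real p) / 2) / beta_scale n p \<le> p_value n (1 - q) p 0"
proof -
  have B: "0 < Beta (real p / 2) ((real n - real p) / 2)"
    using assms by (intro Beta_real_pos) auto
  have "(1 - q) powr (real p / 2) * (1 - (1 - q)) powr ((real n - real p) / 2) / ((real n - real p) / 2)
      \<le> beta_tail (real p / 2) ((real n - real p) / 2) (1 - q)"
    using assms by (intro beta_tail_lower) auto
  from divide_right_mono[OF this less_imp_le[OF B]] show ?thesis
    using assms by (simp add: p_value_beta_tail beta_scale_def mult.assoc)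
qed

text \<open>
  Here \<open>q\<close> and \<open>q'\<close> are the residual sums of squares of the true model and of a larger one, relative
  to the empty model. Passing from \<open>q'\<close> to \<open>q\<close> multiplies the power in the tail bounds by at most
  \<open>exp (K * m)\<close>, the crude factors \<open>1 / r\<close> and \<open>r powr \<alpha>\<close> cost \<open>exp ((m + 1) * ln (1 / r0))\<close>, and the
  ratio of the scales gains \<open>exp (- \<gamma> * ln n)\<close> for each additional variable.
\<close>

lemma mPVC_overfit_ineq:
  assumes p: "1 \<le> p" "p < p'" "p' \<le> m" "m < n"
    and r0: "0 < r0" "r0 < 1"
    and q: "0 < q'" "q' \<le> q" "q \<le> 1 - r0" "q \<le> q' * (1 + K * real m / real n)"
    and K: "0 \<le> K" and a: "0 \<le> a" and g: "0 \<le> \<gamma>"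
    and ratio: "real m / (real n - real m) \<le> real n powr (- 2 * \<gamma>)"
    and small: "K * real m + (real m + 1) * ln (1 / r0) < a + \<gamma> * ln (real n)"
  shows "exp (real p * a) * p_value n (1 - q) p 0 < exp (real p' * a) * p_value n (1 - q') p' 0"
proof -
  define d where "d = p' - p"
  have d: "p' = p + d" "1 \<le> d" using p by (auto simp: d_def)
  define b b' where "b = (real n - real p) / 2" and "b' = (real n - real p') / 2"
  have b: "0 < b'" "b' \<le> b" "b' \<le> real n" using p by (auto simp: b_def b'_def)
  define P P' where "P = p_value n (1 - q) p 0" and "P' = p_value n (1 - q') p' 0"
  have h: "0 < beta_scale n p" "0 < beta_scale n p'" using p by (auto intro!: beta_scale_pos)
  have n1: "1 < real n" using p by simp
  have Ple: "P \<le> q powr b / (r0 * beta_scale n p)"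
  proof -
    have "P \<le> q powr b / ((1 - q) * beta_scale n p)"
      unfolding P_def b_def using p q r0 by (intro p_value_upper) auto
    also have "\<dots> \<le> q powr b / (r0 * beta_scale n p)"
      using q r0 h by (intro divide_left_mono mult_right_mono mult_pos_pos) auto
    finally show ?thesis .
  qed
  have P'ge: "r0 powr real m * q' powr b' / beta_scale n p' \<le> P'"
  proof -
    have "r0 powr real m \<le> r0 powr (real p' / 2)" using r0 p by (intro powr_mono') auto
    also have "\<dots> \<le> (1 - q') powr (real p' / 2)" using r0 q by (intro powr_mono2) auto
    finally have "r0 powr real m * q' powr b' / beta_scale n p' \<le>
        (1 - q') powr (real p' / 2) * q' powr b' / beta_scale n p'"
      using h by (intro divide_right_mono mult_right_mono) auto
    also have "\<dots> \<le> P'"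
      unfolding P'_def b'_def using p q r0 by (intro p_value_lower) auto
    finally show ?thesis .
  qed
  have qb: "q powr b \<le> exp (K * real m) * q' powr b'"
  proof -
    have "q powr b \<le> q powr b'" using q r0 b by (intro powr_mono') auto
    also have "\<dots> \<le> (q' * (1 + K * real m / real n)) powr b'" using q b by (intro powr_mono2) auto
    also have "\<dots> = q' powr b' * (1 + K * real m / real n) powr b'" by (rule powr_mult)
    also have "\<dots> \<le> q' powr b' * exp (K * real m)"
    proof (rule mult_left_mono)
      have "(1 + K * real m / real n) powr b' \<le> exp (K * real m / real n) powr b'"
        using K b by (intro powr_mono2 exp_ge_add_one_self) auto
      also have "\<dots> = exp (K * real m / real n * b')" by (simp add: powr_def mult.commute)
      also have "\<dots> \<le> exp (K * real m / real n * real n)"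
        unfolding exp_le_cancel_iff using K b by (intro mult_left_mono) auto
      finally show "(1 + K * real m / real n) powr b' \<le> exp (K * real m)" using n1 by simp
    qed auto
    finally show ?thesis by (simp add: mult.commute)
  qed
  have hh: "beta_scale n p' \<le> exp (- \<gamma> * ln (real n) * real d) * beta_scale n p"
  proof -
    have "beta_scale n p' \<le> sqrt (real m / (real n - real m)) ^ d * beta_scale n p"
      unfolding d(1) using p d by (intro beta_scale_add) auto
    also have "\<dots> \<le> exp (- \<gamma> * ln (real n)) ^ d * beta_scale n p"
    proof (intro mult_right_mono power_mono)
      have "sqrt (real m / (real n - real m)) \<le> sqrt (real n powr (- 2 * \<gamma>))"
        using ratio by (rule real_sqrt_le_mono)
      also have "\<dots> = (real n powr (- 2 * \<gamma>)) powr (1 / 2)" by (simp add: powr_half_sqrt)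
      also have "\<dots> = exp (- \<gamma> * ln (real n))" using n1 by (simp add: powr_powr) (simp add: powr_def)
      finally show "sqrt (real m / (real n - real m)) \<le> exp (- \<gamma> * ln (real n))" .
    qed (use p h in auto)
    also have "exp (- \<gamma> * ln (real n)) ^ d = exp (- \<gamma> * ln (real n) * real d)"
      by (simp add: exp_of_nat_mult[symmetric] mult.commute)
    finally show ?thesis .
  qed
  have P'pos: "0 < P'"
    using P'ge r0 q h by (smt (verit, best) divide_pos_pos mult_pos_pos powr_gt_zero)
  have main: "P \<le> exp (K * real m + (real m + 1) * ln (1 / r0) - \<gamma> * ln (real n) * real d) * P'"
  proof -
    have "q' powr b' \<le> P' * beta_scale n p' / r0 powr real m"
      using P'ge h r0 by (simp add: field_simps)
    also have "\<dots> \<le> P' * (exp (- \<gamma> * ln (real n) * real d) * beta_scale n p) / r0 powr real m"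
      using hh P'pos by (intro divide_right_mono mult_left_mono) auto
    finally have "q' powr b' \<le> P' * (exp (- \<gamma> * ln (real n) * real d) * beta_scale n p) / r0 powr real m" .
    then have "exp (K * real m) * q' powr b' / (r0 * beta_scale n p) \<le>
        exp (K * real m) * (P' * (exp (- \<gamma> * ln (real n) * real d) * beta_scale n p) / r0 powr real m) / (r0 * beta_scale n p)"
      using r0 h by (intro divide_right_mono mult_left_mono) auto
    moreover have "P \<le> exp (K * real m) * q' powr b' / (r0 * beta_scale n p)"
      by (rule order_trans[OF Ple]) (use qb r0 h in \<open>auto intro!: divide_right_mono\<close>)
    ultimately have "P \<le> exp (K * real m) * (P' * (exp (- \<gamma> * ln (real n) * real d) * beta_scale n p) / r0 powr real m) / (r0 * beta_scale n p)"
      by linarith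
    also have "\<dots> = exp (K * real m) * exp (- \<gamma> * ln (real n) * real d) * (1 / (r0 powr real m * r0)) * P'"
      using h r0 by (simp add: field_simps)
    also have "1 / (r0 powr real m * r0) = exp ((real m + 1) * ln (1 / r0))"
    proof -
      have "r0 powr real m * r0 = exp (real m * ln r0) * exp (ln r0)" using r0 by (simp add: powr_def)
      also have "\<dots> = exp ((real m + 1) * ln r0)" by (simp add: exp_add[symmetric] algebra_simps)
      finally show ?thesis using r0 by (simp add: ln_div exp_minus inverse_eq_divide)
    qed
    finally show ?thesis by (simp add: exp_add exp_diff exp_minus field_simps)
  qed
  have "a + \<gamma> * ln (real n) \<le> (a + \<gamma> * ln (real n)) * real d"
    using d a g n1 mult_left_mono[of 1 "real d" "a + \<gamma> * ln (real n)"] by simp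
  then have "K * real m + (real m + 1) * ln (1 / r0) - \<gamma> * ln (real n) * real d < a * real d"
    using small by (simp add: algebra_simps)
  then have "exp (K * real m + (real m + 1) * ln (1 / r0) - \<gamma> * ln (real n) * real d) * P' < exp (a * real d) * P'"
    using P'pos by simp
  then have "P < exp (a * real d) * P'" using main by linarith
  then have "exp (real p * a) * P < exp (real p * a) * (exp (a * real d) * P')" by simp
  also have "\<dots> = exp (real p' * a) * P'" by (simp add: d exp_add[symmetric] algebra_simps)
  finally show ?thesis unfolding P_def P'_def .
qed

text \<open>
  The converse of \<open>1 - x \<le> exp (- x)\<close>, up to a factor 2 in the exponent.
\<close>

lemma one_minus_powr_ge:
  fixes x b :: real
  assumes "0 \<le> x" "x \<le> 1 / 2" "0 \<le> b"
  shows "exp (- 2 * x * b) \<le> (1 - x) powr b"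
proof -
  have "- x - 2 * x\<^sup>2 \<le> ln (1 - x)" using assms by (intro ln_one_minus_pos_lower_bound) auto
  moreover have "x * x \<le> x * (1 / 2)" using assms by (intro mult_left_mono) auto
  ultimately have "- 2 * x \<le> ln (1 - x)" by (simp add: power2_eq_square)
  then have "- 2 * x * b \<le> ln (1 - x) * b" using assms by (intro mult_right_mono) auto
  then show ?thesis using assms by (simp add: powr_def mult.commute)
qed

text \<open>
  The larger residual of the smaller model yields the factor \<open>(1 + c) powr b\<close>, exponential in \<open>n\<close>,
  against which the scales matter only by a power of \<open>n\<close>. The statistic of the smaller model may
  be arbitrarily close to 0, where the lower tail bound degenerates. It is therefore first raised to
  \<open>1 - q' * (1 - 1 / n)\<close>, which is at least \<open>1 / n\<close> and costs a bounded factor.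
\<close>

lemma mPVC_underfit_ineq:
  assumes p: "1 \<le> p'" "p' < p" "p + 2 \<le> n"
    and r0: "0 < r0"
    and q: "0 < q0" "q0 \<le> q" "q \<le> 1 - r0" "q * (1 + c) \<le> q'" "q' \<le> 1" "0 \<le> c" and a: "0 \<le> a"
    and small: "2 * exp 4 * real n * real n powr (2 * real p) * q0 powr (- real p) / r0 * exp (real p * a)
      < (1 + c) powr ((real n - real p) / 2)"
  shows "exp (real p * a) * p_value n (1 - q) p 0 < exp (real p' * a) * p_value n (1 - q') p' 0"
proof -
  define b b' where "b = (real n - real p) / 2" and "b' = (real n - real p') / 2"
  have b: "1 \<le> b" "b \<le> b'" "b' \<le> b + real p" "b' \<le> real n"
    using p by (auto simp: b_def b'_def field_simps)
  define P P' where "P = p_value n (1 - q) p 0" and "P' = p_value n (1 - q') p' 0"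
  have h: "0 < beta_scale n p" "0 < beta_scale n p'" using p by (auto intro!: beta_scale_pos)
  have n1: "2 \<le> real n" using p by simp
  define s where "s = 1 - 1 / real n"
  have s: "0 < s" "s < 1" "1 - s = 1 / real n" using n1 by (auto simp: s_def field_simps)
  have sb: "exp (- 2) \<le> s powr \<beta>" if "0 \<le> \<beta>" "\<beta> \<le> real n" for \<beta>
  proof -
    have "exp (- 2) \<le> exp (- 2 * (1 / real n) * \<beta>)" using that n1 by (simp add: field_simps)
    also have "\<dots> \<le> s powr \<beta>"
      unfolding s_def using that n1 by (intro one_minus_powr_ge) auto
    finally show ?thesis .
  qed
  have Ple: "P \<le> q powr b / (r0 * beta_scale n p)"
  proof -
    have "P \<le> q powr b / ((1 - q) * beta_scale n p)"
      unfolding P_def b_def using p q r0 by (intro p_value_upper) auto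
    also have "\<dots> \<le> q powr b / (r0 * beta_scale n p)"
      using q r0 h by (intro divide_left_mono mult_right_mono mult_pos_pos) auto
    finally show ?thesis .
  qed
  have hle: "beta_scale n p' \<le> 2 * real n"
  proof -
    have "beta_scale n p' \<le> real n * 2"
      unfolding beta_scale_def using p by (intro mult_mono Beta_le_2 less_imp_le[OF Beta_real_pos]) auto
    then show ?thesis by simp
  qed
  have hge: "real n powr (- real p) * exp (- 2) \<le> beta_scale n p"
  proof -
    have "real n powr (- real p) \<le> real n powr (- (real p / 2))" using n1 by (intro powr_mono) auto
    also have "\<dots> = (1 / real n) powr (real p / 2)" using n1 by (simp add: powr_minus_divide powr_divide)
    finally have "real n powr (- real p) * exp (- 2) \<le> (1 / real n) powr (real p / 2) * s powr b"
      using sb[of b] b by (intro mult_mono) auto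
    also have "\<dots> \<le> b * beta_tail (real p / 2) b (1 / real n)"
      using beta_tail_lower[of "real p / 2" b "1 / real n"] p b n1 by (simp add: s_def field_simps)
    also have "\<dots> \<le> b * beta_tail (real p / 2) b 0"
    proof (rule mult_left_mono)
      show "beta_tail (real p / 2) b (1 / real n) \<le> beta_tail (real p / 2) b 0"
        using p b n1 by (intro less_imp_le[OF beta_tail_strict_antimono]) auto
    qed (use b in auto)
    also have "\<dots> = beta_scale n p"
      using p b by (subst beta_tail_0) (auto simp: beta_scale_def b_def)
    finally show ?thesis .
  qed
  have P'ge: "real n powr (- real p) * (q' * s) powr b' / beta_scale n p' \<le> P'"
  proof -
    have "0 \<le> q * (1 + c)" using q by (intro mult_nonneg_nonneg) auto
    then have q'0: "0 \<le> q'" using q by linarith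
    (* the statistic 1 - q' is raised to 1 - q' * s, which is at least 1 / n *)
    have q's: "0 \<le> q' * s" "q' * s \<le> s" "q' * s \<le> q'"
      using q s q'0 by (auto intro: mult_left_le_one_le mult_left_le)
    then have q's1: "q' * s < 1" using s by linarith
    have "real n powr (- real p) \<le> real n powr (- (real p' / 2))" using n1 p by (intro powr_mono) auto
    also have "\<dots> = (1 - s) powr (real p' / 2)" using n1 s by (simp add: powr_minus_divide powr_divide)
    also have "\<dots> \<le> (1 - q' * s) powr (real p' / 2)" using q's s p by (intro powr_mono2) linarith+
    finally have "real n powr (- real p) * (q' * s) powr b' / beta_scale n p' \<le>
        (1 - q' * s) powr (real p' / 2) * (q' * s) powr b' / beta_scale n p'"
      using h by (intro divide_right_mono mult_right_mono) auto
    also have "\<dots> \<le> p_value n (1 - q' * s) p' 0"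
      unfolding b'_def using p q's q's1 by (intro p_value_lower) auto
    also have "\<dots> \<le> P'"
      unfolding P'_def using p q's by (intro p_value_antimono) auto
    finally show ?thesis .
  qed
  have q's: "q powr b * (1 + c) powr b * q0 powr real p * exp (- 2) \<le> (q' * s) powr b'"
  proof -
    have qc: "0 < q * (1 + c)" "0 < q'" using q by (auto intro!: mult_pos_pos less_le_trans[OF _ q(4)])
    have "q0 powr real p \<le> q0 powr (b' - b)" using q r0 b by (intro powr_mono') auto
    also have "\<dots> \<le> q' powr (b' - b)"
    proof (rule powr_mono2)
      have "q \<le> q * (1 + c)" using q by (simp add: mult_le_cancel_left1)
      then show "q0 \<le> q'" using q by linarith
    qed (use q b in auto)
    finally have 1: "q0 powr real p \<le> q' powr (b' - b)" .
    have "q powr b * (1 + c) powr b = (q * (1 + c)) powr b" using q by (subst powr_mult) auto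
    also have "\<dots> \<le> q' powr b" using q qc b by (intro powr_mono2) auto
    finally have "q powr b * (1 + c) powr b * q0 powr real p * exp (- 2) \<le> q' powr b * q' powr (b' - b) * s powr b'"
      using 1 sb[of b'] b by (intro mult_mono) auto
    also have "\<dots> = (q' * s) powr b'" using qc s by (simp add: powr_mult powr_add[symmetric])
    finally show ?thesis .
  qed
  define A where "A = q powr b / (r0 * real n powr (- real p) * exp (- 2))"
  have qpos: "0 < q" using q by linarith
  have Apos: "0 < A" unfolding A_def using qpos r0 n1 by (intro divide_pos_pos mult_pos_pos) auto
  have "P \<le> A"
  proof (rule order_trans[OF Ple])
    show "q powr b / (r0 * beta_scale n p) \<le> A"
      unfolding A_def using r0 n1 hge h
      by (intro divide_left_mono) (auto intro!: mult_pos_pos mult_left_mono simp: mult.assoc)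
  qed
  define B where "B = (1 + c) powr b /
    (2 * exp 4 * real n * real n powr (2 * real p) * q0 powr (- real p) / r0)"
  have "exp (real p * a) < B"
    using small r0 q n1 unfolding B_def b_def by (simp add: field_simps)
  have "A * B \<le> P'"
  proof -
    have "A * B = real n powr (- real p) * (q powr b * (1 + c) powr b * q0 powr real p * exp (- 2)) / (2 * real n)"
    proof -
      have e4: "exp 4 = exp 2 * exp (2::real)" by (simp add: exp_add[symmetric])
      have np: "real n powr (2 * real p) = real n powr real p * real n powr real p"
        by (simp add: powr_add[symmetric])
      show ?thesis
        unfolding A_def B_def e4 np using r0 n1 q by (simp add: powr_minus exp_minus field_simps)
    qed
    also have "\<dots> \<le> real n powr (- real p) * (q' * s) powr b' / (2 * real n)"
      using q's n1 by (intro divide_right_mono mult_left_mono) auto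
    also have "\<dots> \<le> real n powr (- real p) * (q' * s) powr b' / beta_scale n p'"
      using hle h n1 by (intro divide_left_mono mult_nonneg_nonneg mult_pos_pos) auto
    finally show ?thesis using P'ge by linarith
  qed
  have "exp (real p * a) * P \<le> exp (real p * a) * A" using \<open>P \<le> A\<close> by simp
  also have "\<dots> < B * A" using \<open>exp (real p * a) < B\<close> Apos by simp
  also have "\<dots> \<le> P'" using \<open>A * B \<le> P'\<close> by (simp add: mult.commute)
  also have "\<dots> \<le> exp (real p' * a) * P'"
  proof -
    have "0 \<le> P'" using \<open>A * B \<le> P'\<close> Apos \<open>exp (real p * a) < B\<close>
      by (smt (verit) exp_gt_zero mult_pos_pos)
    then show ?thesis using a mult_right_mono[of 1 "exp (real p' * a)" P'] by simp
  qed
  finally show ?thesis unfolding P_def P'_def .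
qed

text \<open>
  As \<open>2 * b \<le> n\<close>, the lower bound \<open>(1 - 4 * r) powr b / 2\<close> is at least
  \<open>exp (- 4 * r * n) / 2\<close>.
\<close>

lemma p_value_small_R:
  assumes "p < m" "m + 2 \<le> n" "0 \<le> r" "r \<le> 1 / 8" "4 * r * real n + ln 2 < a"
  shows "exp (- a) < p_value n r m p"
proof -
  define b where "b = (real n - real m) / 2"
  have b: "1 \<le> b" "2 * b \<le> real n" using assms by (auto simp: b_def)
  have "ln 2 - a < - (4 * r * real n)" using assms by simp
  also have "\<dots> \<le> - 2 * (4 * r) * b"
    using b assms mult_left_mono[of "2 * b" "real n" "4 * r"] by simp
  finally have "exp (ln 2 - a) < exp (- 2 * (4 * r) * b)" by simp
  also have "\<dots> \<le> (1 - 4 * r) powr b" using assms b by (intro one_minus_powr_ge) auto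
  finally have "exp (- a) < (1 - 4 * r) powr b / 2" by (simp add: exp_diff exp_minus field_simps)
  also have "\<dots> \<le> beta_tail ((real m - real p) / 2) b r / Beta ((real m - real p) / 2) b"
    using assms b by (intro beta_tail_near_0_lower) auto
  also have "\<dots> = p_value n r m p" using assms by (simp add: p_value_beta_tail b_def)
  finally show ?thesis .
qed

text \<open>
  Dividing the upper tail bound at \<open>r0\<close> by the lower one at \<open>r0 / 2\<close>, which bounds the Beta function
  from below, leaves the ratio of \<open>1 - r0\<close> and \<open>1 - r0 / 2\<close> to a power of order \<open>n\<close>.
\<close>

lemma p_value_large_R:
  assumes "p < m" "m < n" "0 < r0" "r0 < 1" "r0 \<le> r"
  shows "p_value n r m p \<le> 1 / r0 * (2 / r0) ^ m * ((1 - r0) / (1 - r0 / 2)) powr ((real n - real m) / 2)"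
proof -
  define b \<alpha> s where "b = (real n - real m) / 2" and "\<alpha> = (real m - real p) / 2" and "s = r0 / 2"
  have ab: "0 < b" "0 < \<alpha>" "\<alpha> \<le> real m" using assms by (auto simp: b_def \<alpha>_def)
  have s: "0 < s" "s < 1" using assms by (auto simp: s_def)
  have L: "s powr \<alpha> * (1 - s) powr b / b \<le> Beta \<alpha> b"
    using beta_tail_lower[of \<alpha> b s] less_imp_le[OF beta_tail_strict_antimono[of \<alpha> b 0 s]]
      beta_tail_0[of \<alpha> b] ab s by linarith
  have Lpos: "0 < s powr \<alpha> * (1 - s) powr b / b" using s ab by simp
  have "p_value n r m p \<le> p_value n r0 m p" using assms by (intro p_value_antimono) auto
  also have "\<dots> = beta_tail \<alpha> b r0 / Beta \<alpha> b"
    using assms by (simp add: p_value_beta_tail b_def \<alpha>_def)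
  also have "\<dots> \<le> ((1 - r0) powr b / (r0 * b)) / (s powr \<alpha> * (1 - s) powr b / b)"
    using assms ab L Lpos by (intro frac_le beta_tail_upper) auto
  also have "\<dots> = 1 / r0 * (1 / s) powr \<alpha> * ((1 - r0) / (1 - s)) powr b"
    using assms ab s by (simp add: powr_divide)
  also have "\<dots> \<le> 1 / r0 * (1 / s) powr real m * ((1 - r0) / (1 - s)) powr b"
    using assms ab s by (intro mult_right_mono mult_left_mono powr_mono) (auto simp: s_def)
  also have "(1 / s) powr real m = (2 / r0) ^ m" using assms by (simp add: s_def powr_realpow)
  finally show ?thesis unfolding b_def s_def .
qed

section \<open>Selection under a gap between residual sums of squares\<close>

text \<open>
  The only properties of a realisation on which the selection depends. In the application \<open>E\<close> is the
  squared length of the noise, \<open>D\<close> bounds the squared length of its projection on the columns, and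
  \<open>\<theta> * n\<close> is the price of omitting a true variable.
\<close>

definition rss_gap ::
  "nat \<Rightarrow> nat \<Rightarrow> (nat \<Rightarrow> nat \<Rightarrow> real) \<Rightarrow> (nat \<Rightarrow> real) \<Rightarrow> nat set \<Rightarrow> real \<Rightarrow> real \<Rightarrow> real \<Rightarrow> real \<Rightarrow> bool"
  where
  "rss_gap n m X Y t E D \<theta> \<Lambda> \<longleftrightarrow>
     (\<forall>j. j \<subseteq> {1..m} \<longrightarrow> t \<subseteq> j \<longrightarrow> E - D \<le> RSS n X Y j \<and> RSS n X Y j \<le> E) \<and>
     (\<forall>j. j \<subseteq> {1..m} \<longrightarrow> \<not> t \<subseteq> j \<longrightarrow> E + \<theta> * real n \<le> RSS n X Y j) \<and>
     \<theta> * real n \<le> E - D \<and> E \<le> \<Lambda> * real n \<and> RSS n X Y {} \<le> \<Lambda> * real n \<and> 0 \<le> D"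

lemma PV_ordering_exists: "\<exists>is. PV_ordering n m X Y is"
proof
  show "PV_ordering n m X Y (sort_key (PV n m X Y) [1..<Suc m])"
    unfolding PV_ordering_def by (auto simp: atLeastLessThanSuc_atLeastAtMost)
qed

text \<open>
  A prefix that contains a false variable but lacks a true one would contradict the sorting.
\<close>

lemma prefix_separated:
  assumes ord: "PV_ordering n m X Y is"
    and sep: "\<And>i j. i \<in> t \<Longrightarrow> j \<in> {1..m} - t \<Longrightarrow> PV n m X Y i < PV n m X Y j"
    and t: "t \<subseteq> {1..m}"
  shows "set (take k is) \<subseteq> t \<or> t \<subseteq> set (take k is)"
proof (rule ccontr)
  assume "\<not> ?thesis"
  then obtain u v where u: "u \<in> set (take k is)" "u \<notin> t" and v: "v \<in> t" "v \<notin> set (take k is)" by auto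
  have isf: "set is = {1..m}" "sorted (map (PV n m X Y) is)" using ord by (auto simp: PV_ordering_def)
  have "v \<in> set is" using v t isf by auto
  then have vd: "v \<in> set (drop k is)"
    using v set_append[of "take k is" "drop k is"] by simp
  have "sorted (map (PV n m X Y) (take k is) @ map (PV n m X Y) (drop k is))"
    using isf(2) map_append[of "PV n m X Y" "take k is" "drop k is"] by simp
  then have "PV n m X Y u \<le> PV n m X Y v"
    using u vd by (auto simp: sorted_append)
  moreover have "u \<in> {1..m} - t" using u isf by (auto dest: in_set_takeD)
  ultimately show False using sep[OF v(1)] by force
qed

lemma nested_family_separated:
  assumes ord: "PV_ordering n m X Y is"
    and sep: "\<And>i j. i \<in> t \<Longrightarrow> j \<in> {1..m} - t \<Longrightarrow> PV n m X Y i < PV n m X Y j"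
    and t: "t \<subseteq> {1..m}" "t \<noteq> {}"
  shows "t \<in> nested_family is"
    and "j \<in> nested_family is \<Longrightarrow> j \<noteq> {} \<and> j \<subseteq> {1..m} \<and> (j \<subseteq> t \<or> t \<subseteq> j)"
proof -
  have isf: "set is = {1..m}" "distinct is" using ord by (auto simp: PV_ordering_def)
  have len: "length is = m" using isf distinct_card by fastforce
  have fin: "finite t" using t finite_subset by blast
  have ct: "1 \<le> card t" "card t \<le> m"
    using t fin card_mono[of "{1..m}" t] by (auto simp: Suc_le_eq card_gt_0_iff)
  have c: "card (set (take (card t) is)) = card t"
    using isf ct len by (simp add: distinct_card)
  have "set (take (card t) is) = t"
    using prefix_separated[OF ord sep t(1), of "card t"]
  proof
    assume "set (take (card t) is) \<subseteq> t"
    then show ?thesis using c fin by (intro card_subset_eq) auto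
  next
    assume "t \<subseteq> set (take (card t) is)"
    then show ?thesis using c by (intro card_subset_eq[symmetric]) auto
  qed
  then show "t \<in> nested_family is"
    unfolding nested_family_def using ct len by (auto intro!: exI[of _ "card t"])
  show "j \<noteq> {} \<and> j \<subseteq> {1..m} \<and> (j \<subseteq> t \<or> t \<subseteq> j)" if j: "j \<in> nested_family is"
  proof -
    obtain k where k: "j = set (take k is)" "1 \<le> k" "k \<le> length is"
      using j by (auto simp: nested_family_def)
    then show ?thesis
      using prefix_separated[OF ord sep t(1), of k] isf by (auto dest: in_set_takeD)
  qed
qed

text \<open>
  A strict optimum over the nested family leaves no ties, and the separation of the p-values leaves
  no ties between true and false variables in the ordering. So every run of the procedure returns
  \<open>t\<close>.
\<close>

lemma greedy_mPVC_eqI: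
  assumes sep: "\<And>i j. i \<in> t \<Longrightarrow> j \<in> {1..m} - t \<Longrightarrow> PV n m X Y i < PV n m X Y j"
    and t: "t \<subseteq> {1..m}" "t \<noteq> {}"
    and crit: "\<And>j. j \<noteq> {} \<Longrightarrow> j \<subseteq> {1..m} \<Longrightarrow> j \<subset> t \<or> t \<subset> j \<Longrightarrow> mPVC_crit n a X Y t < mPVC_crit n a X Y j"
  shows "greedy_mPVC n m a X Y = {t}"
proof -
  have "mPVC_select n a X Y (nested_family is) = {t}" if ord: "PV_ordering n m X Y is" for "is"
  proof -
    have fam1: "t \<in> nested_family is"
      by (rule nested_family_separated(1)[OF ord sep t])
    have fam2: "mPVC_crit n a X Y t < mPVC_crit n a X Y j" if "j \<in> nested_family is" "j \<noteq> t" for j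
    proof -
      have "j \<noteq> {} \<and> j \<subseteq> {1..m} \<and> (j \<subseteq> t \<or> t \<subseteq> j)"
        by (rule nested_family_separated(2)[OF ord sep t that(1)])
      then show ?thesis using that(2) by (intro crit) auto
    qed
    have nl: "\<not> mPVC_crit n a X Y y < mPVC_crit n a X Y t" if "y \<in> nested_family is" for y
      using fam2[OF that] by (cases "y = t") auto
    have "is_arg_min (mPVC_crit n a X Y) (\<lambda>k. k \<in> nested_family is) j \<longleftrightarrow> j = t" for j
    proof
      assume *: "is_arg_min (mPVC_crit n a X Y) (\<lambda>k. k \<in> nested_family is) j"
      show "j = t"
      proof (rule ccontr)
        assume "j \<noteq> t"
        with * show False using fam1 fam2[of j] by (auto simp: is_arg_min_def)
      qed
    next
      assume "j = t"
      with fam1 nl show "is_arg_min (mPVC_crit n a X Y) (\<lambda>k. k \<in> nested_family is) j"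
        unfolding is_arg_min_def by blast
    qed
    then show ?thesis
      unfolding mPVC_select_def is_arg_min_def[of card] by auto
  qed
  then show ?thesis
    unfolding greedy_mPVC_def using PV_ordering_exists[of n m X Y] by auto
qed

lemma greedy_MPVC_eqI:
  assumes sep: "\<And>i j. i \<in> t \<Longrightarrow> j \<in> {1..m} - t \<Longrightarrow> PV n m X Y i < PV n m X Y j"
    and t: "t \<subseteq> {1..m}" "t \<noteq> {}"
    and crit: "\<And>j. j \<noteq> {} \<Longrightarrow> j \<subseteq> {1..m} \<Longrightarrow> j \<subset> t \<or> t \<subset> j \<Longrightarrow> MPVC_crit n m a X Y j < MPVC_crit n m a X Y t"
  shows "greedy_MPVC n m a X Y = {t}"
proof -
  have "MPVC_select n m a X Y (nested_family is) = {t}" if ord: "PV_ordering n m X Y is" for "is"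
  proof -
    have fam1: "t \<in> nested_family is"
      by (rule nested_family_separated(1)[OF ord sep t])
    have fam2: "MPVC_crit n m a X Y j < MPVC_crit n m a X Y t" if "j \<in> nested_family is" "j \<noteq> t" for j
    proof -
      have "j \<noteq> {} \<and> j \<subseteq> {1..m} \<and> (j \<subseteq> t \<or> t \<subseteq> j)"
        by (rule nested_family_separated(2)[OF ord sep t that(1)])
      then show ?thesis using that(2) by (intro crit) auto
    qed
    have nl: "\<not> MPVC_crit n m a X Y t < MPVC_crit n m a X Y y" if "y \<in> nested_family is" for y
      using fam2[OF that] by (cases "y = t") auto
    have "is_arg_max (MPVC_crit n m a X Y) (\<lambda>k. k \<in> nested_family is) j \<longleftrightarrow> j = t" for j
    proof
      assume *: "is_arg_max (MPVC_crit n m a X Y) (\<lambda>k. k \<in> nested_family is) j"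
      show "j = t"
      proof (rule ccontr)
        assume "j \<noteq> t"
        with * show False using fam1 fam2[of j] by (auto simp: is_arg_max_def)
      qed
    next
      assume "j = t"
      with fam1 nl show "is_arg_max (MPVC_crit n m a X Y) (\<lambda>k. k \<in> nested_family is) j"
        unfolding is_arg_max_def by blast
    qed
    then show ?thesis
      unfolding MPVC_select_def by auto
  qed
  then show ?thesis
    unfolding greedy_MPVC_def using PV_ordering_exists[of n m X Y] by auto
qed

text \<open>
  One realisation with a gap; the two margins above \<open>m\<close> keep the second shape parameter of every
  p-value at least 1.
\<close>

locale separated_fit =
  fixes n m :: nat and X :: "nat \<Rightarrow> nat \<Rightarrow> real" and Y :: "nat \<Rightarrow> real" and t :: "nat set"
    and E D \<theta> \<Lambda> :: real
  assumes gap: "rss_gap n m X Y t E D \<theta> \<Lambda>"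
    and t_sub: "t \<subseteq> {1..m}" and t_ne: "t \<noteq> {}"
    and pos: "0 < \<theta>" "0 < \<Lambda>" and m_less: "m + 2 \<le> n"
begin

abbreviation rss :: "nat set \<Rightarrow> real" where "rss \<equiv> RSS n X Y"

lemma n_pos: "0 < real n" using m_less by simp

lemma RSS_super: "j \<subseteq> {1..m} \<Longrightarrow> t \<subseteq> j \<Longrightarrow> E - D \<le> rss j \<and> rss j \<le> E"
  using gap unfolding rss_gap_def by blast

lemma RSS_missing: "j \<subseteq> {1..m} \<Longrightarrow> \<not> t \<subseteq> j \<Longrightarrow> E + \<theta> * real n \<le> rss j"
  using gap unfolding rss_gap_def by blast

lemma E_D: "\<theta> * real n \<le> E - D" "E \<le> \<Lambda> * real n" "rss {} \<le> \<Lambda> * real n" "0 \<le> D"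
  using gap unfolding rss_gap_def by auto

lemma E_pos: "0 < E - D" "0 < E"
  using E_D mult_pos_pos[OF pos(1) n_pos] by linarith+

lemma RSS_full_pos: "0 < rss {1..m}"
  using RSS_super[of "{1..m}"] t_sub E_pos by simp

lemma RSS_pos: "j \<subseteq> {1..m} \<Longrightarrow> 0 < rss j"
  using RSS_antimono[of "{1..m}" j n X Y] RSS_full_pos by simp

lemma R_stat_alt: "j \<subseteq> {1..m} \<Longrightarrow> R_stat n X Y j k = 1 - rss k / rss j"
  using RSS_pos[of j] by (simp add: R_stat_def diff_divide_distrib)

text \<open>
  This bound and the two that follow translate the gap into the bounds on \<open>1 - R_stat\<close> that the p-value
  inequalities require.
\<close>

lemma fit_ratio_le:
  assumes "j \<subseteq> {1..m}" "t \<subseteq> j" "i \<subseteq> {1..m}" "\<not> t \<subseteq> i"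
  shows "rss j / rss i \<le> 1 - \<theta> / (\<Lambda> + \<theta>)"
proof -
  have "rss j / rss i \<le> E / (E + \<theta> * real n)"
    using RSS_super[OF assms(1,2)] RSS_missing[OF assms(3,4)] E_pos mult_pos_pos[OF pos(1) n_pos] RSS_nonneg
    by (intro frac_le) auto
  also have "\<dots> = 1 - \<theta> * real n / (E + \<theta> * real n)"
    using E_pos mult_pos_pos[OF pos(1) n_pos] by (simp add: divide_simps)
  also have "\<dots> \<le> 1 - \<theta> / (\<Lambda> + \<theta>)"
  proof -
    have "\<theta> / (\<Lambda> + \<theta>) = \<theta> * real n / ((\<Lambda> + \<theta>) * real n)" using n_pos by simp
    also have "\<dots> \<le> \<theta> * real n / (E + \<theta> * real n)"
      using E_D pos n_pos add_pos_pos[OF E_pos(2) mult_pos_pos[OF pos(1) n_pos]]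
      by (intro divide_left_mono mult_pos_pos) (auto simp: distrib_right)
    finally show ?thesis by simp
  qed
  finally show ?thesis .
qed

lemma fit_ratio_ge:
  assumes "j \<subseteq> {1..m}" "t \<subseteq> j" "i \<subseteq> {1..m}" "\<not> t \<subseteq> i"
  shows "1 + \<theta> / \<Lambda> \<le> rss i / rss j"
proof -
  have "\<theta> / \<Lambda> * E \<le> \<theta> / \<Lambda> * (\<Lambda> * real n)"
    using E_D pos by (intro mult_left_mono) auto
  then have "1 + \<theta> / \<Lambda> \<le> (E + \<theta> * real n) / E"
    using E_pos pos by (simp add: field_simps)
  also have "\<dots> \<le> rss i / rss j"
    using RSS_super[OF assms(1,2)] RSS_missing[OF assms(3,4)] E_pos mult_pos_pos[OF pos(1) n_pos] RSS_pos[OF assms(1)]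
    by (intro frac_le) auto
  finally show ?thesis .
qed

lemma fit_ratio_close:
  assumes "j \<subseteq> {1..m}" "t \<subseteq> j" "i \<subseteq> {1..m}" "t \<subseteq> i"
  shows "rss i / rss j \<le> 1 + D / (\<theta> * real n)"
proof -
  have "rss i / rss j \<le> E / (E - D)"
    using RSS_super[OF assms(1,2)] RSS_super[OF assms(3,4)] E_pos by (intro frac_le) auto
  also have "\<dots> = 1 + D / (E - D)" using E_pos by (simp add: field_simps)
  also have "\<dots> \<le> 1 + D / (\<theta> * real n)"
    using E_D mult_pos_pos[OF pos(1) n_pos] by (intro add_left_mono divide_left_mono) auto
  finally show ?thesis .
qed

text \<open>
  All p-values of the ordering step have the same shape parameters, so their order is the reverse of
  the order of the statistics, and thereby that of the residual sums of squares after deletion.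
\<close>

lemma PV_separated:
  assumes "i \<in> t" "j \<in> {1..m} - t"
  shows "PV n m X Y i < PV n m X Y j"
proof -
  let ?f = "{1..m}"
  have m: "1 \<le> m" using assms by auto
  have sub: "?f - {i} \<subseteq> ?f" "?f - {j} \<subseteq> ?f" by auto
  have i: "\<not> t \<subseteq> ?f - {i}" using assms by auto
  have j: "t \<subseteq> ?f - {j}" using assms t_sub by auto
  have "rss (?f - {j}) < rss (?f - {i})"
    using RSS_super[OF sub(2) j] RSS_missing[OF sub(1) i] mult_pos_pos[OF pos(1) n_pos] by linarith
  then have "rss ?f / rss (?f - {i}) < rss ?f / rss (?f - {j})"
    using RSS_full_pos RSS_pos[OF sub(1)] RSS_pos[OF sub(2)] by (intro divide_strict_left_mono) auto
  moreover have "rss ?f / rss (?f - {j}) \<le> 1"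
    using RSS_antimono[of ?f "?f - {j}" n X Y] RSS_pos[OF sub(2)] by simp
  moreover have "0 \<le> rss ?f / rss (?f - {i})" by (simp add: RSS_nonneg)
  ultimately show ?thesis
    unfolding PV_def R_stat_alt[OF sub(1)] R_stat_alt[OF sub(2)]
    using m m_less by (intro p_value_strict_antimono) auto
qed

lemma greedy_mPVC_eq:
  assumes a: "0 \<le> a" and g: "0 \<le> \<gamma>" and D: "D \<le> K * \<theta> * real m"
    and r0: "r0 = \<theta> / (\<Lambda> + \<theta>)"
    and ratio: "real m / (real n - real m) \<le> real n powr (- 2 * \<gamma>)"
    and small: "K * real m + (real m + 1) * ln (1 / r0) < a + \<gamma> * ln (real n)"
    and under: "2 * exp 4 * real n * real n powr (2 * real (card t)) * (\<theta> / \<Lambda>) powr (- real (card t)) / r0 *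
        exp (real (card t) * a) < (1 + \<theta> / \<Lambda>) powr ((real n - real (card t)) / 2)"
  shows "greedy_mPVC n m a X Y = {t}"
proof (rule greedy_mPVC_eqI[OF PV_separated t_sub t_ne])
  fix j assume j: "j \<noteq> {}" "j \<subseteq> {1..m}" "j \<subset> t \<or> t \<subset> j"
  define q where "q = (\<lambda>k. rss k / rss {})"
  have fin: "finite t" "finite j" using t_sub j finite_subset by blast+
  have nt: "\<not> t \<subseteq> {}" using t_ne by simp
  have r0b: "0 < r0" "r0 < 1" using pos by (auto simp: r0 field_simps)
  have ct: "1 \<le> card t" "card t \<le> m" using t_ne fin t_sub card_mono[of "{1..m}" t]
    by (auto simp: Suc_le_eq card_gt_0_iff)
  have cj: "1 \<le> card j" "card j \<le> m" using j fin card_mono[of "{1..m}" j]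
    by (auto simp: Suc_le_eq card_gt_0_iff)
  have qpos: "0 < q k" if "k \<subseteq> {1..m}" for k unfolding q_def using RSS_pos that by simp
  have qt: "q t \<le> 1 - r0" unfolding q_def r0 by (rule fit_ratio_le) (use t_sub nt in auto)
  have crit: "mPVC_crit n a X Y k = exp (real (card k) * a) * p_value n (1 - q k) (card k) 0" if "k \<noteq> {}" for k
    using that by (simp add: mPVC_crit_def R_stat_alt q_def)
  have Kn: "0 \<le> K"
  proof -
    have "0 \<le> K * (\<theta> * real m)" using D E_D by (simp add: mult.assoc)
    moreover have "0 < \<theta> * real m" using pos ct by simp
    ultimately show ?thesis by (simp add: zero_le_mult_iff)
  qed
  show "mPVC_crit n a X Y t < mPVC_crit n a X Y j"
    unfolding crit[OF t_ne] crit[OF j(1)]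
    using j(3)
  proof
    assume jt: "j \<subset> t"
    have ratio': "1 + \<theta> / \<Lambda> \<le> rss j / rss t"
      by (rule fit_ratio_ge) (use jt t_sub j in auto)
    show "exp (real (card t) * a) * p_value n (1 - q t) (card t) 0 < exp (real (card j) * a) * p_value n (1 - q j) (card j) 0"
    proof (rule mPVC_underfit_ineq)
      show "card j < card t" using jt fin psubset_card_mono by blast
      show "\<theta> / \<Lambda> \<le> q t"
      proof -
        have "\<theta> / \<Lambda> = (\<theta> * real n) / (\<Lambda> * real n)" using n_pos by simp
        also have "\<dots> \<le> q t"
          unfolding q_def using RSS_super[OF t_sub subset_refl] E_D RSS_pos[of "{}"] pos
          by (intro frac_le) (auto simp: RSS_nonneg)
        finally show ?thesis .
      qed
      show "q t * (1 + \<theta> / \<Lambda>) \<le> q j"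
        using mult_left_mono[OF ratio' less_imp_le[OF qpos[OF t_sub]]] RSS_pos[OF t_sub] by (simp add: q_def)
      show "q j \<le> 1" unfolding q_def using RSS_antimono[of j "{}" n X Y] fin RSS_pos[of "{}"] by simp
    qed (use ct cj m_less r0b qt pos a under in auto)
  next
    assume tj: "t \<subset> j"
    have close: "rss t / rss j \<le> 1 + D / (\<theta> * real n)"
      by (rule fit_ratio_close) (use tj t_sub j in auto)
    show "exp (real (card t) * a) * p_value n (1 - q t) (card t) 0 < exp (real (card j) * a) * p_value n (1 - q j) (card j) 0"
    proof (rule mPVC_overfit_ineq)
      show "card t < card j" using tj fin psubset_card_mono by blast
      show "q j \<le> q t" unfolding q_def using RSS_antimono[of j t n X Y] fin tj RSS_pos[of "{}"]
        by (intro divide_right_mono) auto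
      have "D / (\<theta> * real n) \<le> K * real m / real n"
        using D pos n_pos by (simp add: field_simps)
      then have "rss t / rss j \<le> 1 + K * real m / real n" using close by linarith
      from mult_left_mono[OF this less_imp_le[OF qpos[OF j(2)]]]
      show "q t \<le> q j * (1 + K * real m / real n)" using RSS_pos[OF j(2)] by (simp add: q_def)
    qed (use ct cj m_less r0b qt pos a g ratio small Kn qpos j in auto)
  qed
qed

lemma greedy_MPVC_eq:
  assumes a: "0 \<le> a" and D: "D \<le> K * \<theta> * real m"
    and r0: "r0 = \<theta> / (\<Lambda> + \<theta>)"
    and Km: "K * real m / real n \<le> 1 / 8"
    and small: "4 * K * real m + ln 2 < a"
    and under: "1 / r0 * (2 / r0) ^ m * ((1 - r0) / (1 - r0 / 2)) powr ((real n - real m) / 2)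
      < exp (- (real (card t) + 1) * a)"
  shows "greedy_MPVC n m a X Y = {t}"
proof (rule greedy_MPVC_eqI[OF PV_separated t_sub t_ne])
  let ?f = "{1..m}"
  fix j assume j: "j \<noteq> {}" "j \<subseteq> {1..m}" "j \<subset> t \<or> t \<subset> j"
  have fin: "finite t" "finite j" using t_sub j finite_subset by blast+
  have r0b: "0 < r0" "r0 < 1" using pos by (auto simp: r0 field_simps)
  have card_lt: "card k < m" if "k \<subset> ?f" for k using psubset_card_mono[of ?f k] that by simp
  have t_crit: "exp (- (real (card t) + 1) * a) < MPVC_crit n m a X Y t" if tf: "t \<noteq> ?f"
  proof -
    have close: "rss t / rss ?f \<le> 1 + D / (\<theta> * real n)"
      by (rule fit_ratio_close) (use t_sub in auto)
    define r where "r = 1 - rss ?f / rss t"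
    have r0': "0 \<le> r" unfolding r_def
      using RSS_antimono[of ?f t n X Y] t_sub RSS_pos[OF t_sub] by simp
    have "r \<le> D / (\<theta> * real n)"
    proof -
      have "r = (rss t - rss ?f) / rss t" using RSS_pos[OF t_sub] by (simp add: r_def field_simps)
      also have "\<dots> \<le> D / (\<theta> * real n)"
        using RSS_super[OF t_sub subset_refl] RSS_super[of ?f] t_sub E_D mult_pos_pos[OF pos(1) n_pos]
        by (intro frac_le) auto
      finally show ?thesis .
    qed
    also have "\<dots> \<le> K * real m / real n" using D pos n_pos by (simp add: field_simps)
    finally have rK: "r \<le> K * real m / real n" .
    then have rn: "4 * r * real n \<le> 4 * K * real m" using n_pos by (simp add: field_simps)
    have "exp (- a) < p_value n r m (card t)"
    proof (rule p_value_small_R)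
      show "card t < m" using card_lt tf t_sub by blast
    qed (use m_less r0' order_trans[OF rK Km] rn small in auto)
    moreover have "exp (- (real (card t) + 1) * a) = exp (- (real (card t) * a)) * exp (- a)"
      by (simp add: exp_add[symmetric] algebra_simps)
    ultimately show ?thesis
      using tf by (simp add: MPVC_crit_def R_stat_alt[OF t_sub] r_def)
  qed
  have t_crit': "exp (- (real (card t) + 1) * a) \<le> MPVC_crit n m a X Y t"
  proof (cases "t = ?f")
    case True
    then show ?thesis using a by (simp add: MPVC_crit_def algebra_simps)
  next
    case False
    then show ?thesis using t_crit by simp
  qed
  show "MPVC_crit n m a X Y j < MPVC_crit n m a X Y t"
    using j(3)
  proof
    assume jt: "j \<subset> t"
    then have jf: "j \<subset> ?f" using t_sub by auto
    have "rss ?f / rss j \<le> 1 - \<theta> / (\<Lambda> + \<theta>)"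
      by (rule fit_ratio_le) (use t_sub jt j in auto)
    then have "r0 \<le> R_stat n X Y j ?f" unfolding R_stat_alt[OF j(2)] r0 by simp
    then have "p_value n (R_stat n X Y j ?f) m (card j) \<le>
        1 / r0 * (2 / r0) ^ m * ((1 - r0) / (1 - r0 / 2)) powr ((real n - real m) / 2)"
      using card_lt[OF jf] m_less r0b by (intro p_value_large_R) auto
    also have "\<dots> < MPVC_crit n m a X Y t" using under t_crit' by linarith
    finally have less: "p_value n (R_stat n X Y j ?f) m (card j) < MPVC_crit n m a X Y t" .
    have "0 < MPVC_crit n m a X Y t" using t_crit' by (rule less_le_trans[OF exp_gt_zero])
    moreover have "exp (- (real (card j) * a)) \<le> 1" using a by simp
    ultimately have "exp (- (real (card j) * a)) * p_value n (R_stat n X Y j ?f) m (card j) < MPVC_crit n m a X Y t"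
    proof (cases "0 \<le> p_value n (R_stat n X Y j ?f) m (card j)")
      case True
      then have "exp (- (real (card j) * a)) * p_value n (R_stat n X Y j ?f) m (card j)
          \<le> p_value n (R_stat n X Y j ?f) m (card j)"
        using a by (intro mult_left_le_one_le) auto
      then show ?thesis using less by linarith
    next
      case False
      then have "exp (- (real (card j) * a)) * p_value n (R_stat n X Y j ?f) m (card j) < 0"
        by (intro mult_pos_neg) auto
      then show ?thesis using \<open>0 < MPVC_crit n m a X Y t\<close> by linarith
    qed
    moreover have "MPVC_crit n m a X Y j = exp (- (real (card j) * a)) * p_value n (R_stat n X Y j ?f) m (card j)"
      using jf unfolding MPVC_crit_def by auto
    ultimately show ?thesis by simp
  next
    assume tj: "t \<subset> j"
    have "real (card t) + 1 \<le> real (card j)" using psubset_card_mono[OF fin(2) tj] by simp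
    then have le: "exp (- (real (card j) * a)) \<le> exp (- (real (card t) + 1) * a)"
      using mult_right_mono[of "real (card t) + 1" "real (card j)" a] a
      unfolding exp_le_cancel_iff by linarith
    have tf: "t \<noteq> ?f" using tj j by auto
    have "MPVC_crit n m a X Y j \<le> exp (- (real (card j) * a)) * 1"
      unfolding MPVC_crit_def by (intro mult_left_mono) (auto simp: p_value_le_1)
    also have "\<dots> < MPVC_crit n m a X Y t" using le_less_trans[OF le t_crit[OF tf]] by simp
    finally show ?thesis .
  qed
qed

end

section \<open>Asymptotic comparison of the rates\<close>

text \<open>
  The growth condition bounds the number of variables by a power of \<open>n\<close> with exponent below 1. This
  is what turns \<open>m / (n - m)\<close> into a negative power of \<open>n\<close> and makes \<open>m * ln n\<close> negligible.
\<close>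

lemma growth_imp_power_bound:
  fixes M :: "nat \<Rightarrow> nat"
  assumes "0 < \<eta>" and growth: "(\<lambda>n. real (M n) powr (1 + \<eta>) / real n) \<longlonglongrightarrow> 0"
  shows "eventually (\<lambda>n. real (M n) \<le> real n powr (1 / (1 + \<eta>))) sequentially"
proof -
  have "eventually (\<lambda>n. real (M n) powr (1 + \<eta>) / real n < 1) sequentially"
    using growth by (rule order_tendstoD) simp
  then show ?thesis using eventually_gt_at_top[of 0]
  proof eventually_elim
    case (elim n)
    then have "real (M n) powr (1 + \<eta>) \<le> real n" by (simp add: field_simps)
    then have "(real (M n) powr (1 + \<eta>)) powr (1 / (1 + \<eta>)) \<le> real n powr (1 / (1 + \<eta>))"
      using assms by (intro powr_mono2) auto
    then show ?case using assms by (simp add: powr_powr)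
  qed
qed

lemma eventually_ratio:
  fixes M :: "nat \<Rightarrow> nat"
  assumes \<eta>: "0 < \<eta>" and growth: "(\<lambda>n. real (M n) powr (1 + \<eta>) / real n) \<longlonglongrightarrow> 0"
    and \<gamma>: "\<gamma> = \<eta> / (4 * (1 + \<eta>))"
  shows "eventually (\<lambda>n. real (M n) / (real n - real (M n)) \<le> real n powr (- 2 * \<gamma>)) sequentially"
proof -
  define \<delta> where "\<delta> = \<eta> / (1 + \<eta>)"
  have \<delta>: "0 < \<delta>" "\<delta> < 1" "1 / (1 + \<eta>) = 1 - \<delta>" "2 * \<gamma> = \<delta> / 2"
    using \<eta> by (auto simp: \<delta>_def \<gamma> field_simps)
  have "eventually (\<lambda>n::nat. 2 * real n powr (1 - \<delta>) \<le> real n) sequentially"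
    using \<delta> by real_asymp
  moreover have "eventually (\<lambda>n::nat. real n powr (1 - \<delta>) * 2 \<le> real n powr (- (\<delta> / 2)) * real n) sequentially"
    using \<delta> by real_asymp
  ultimately show ?thesis
    using growth_imp_power_bound[OF \<eta> growth] eventually_gt_at_top[of 0]
  proof eventually_elim
    case (elim n)
    have le: "real (M n) \<le> real n powr (1 - \<delta>)" using elim \<delta> by simp
    have half: "real n / 2 \<le> real n - real (M n)" using elim le by simp
    have "real (M n) / (real n - real (M n)) \<le> real n powr (1 - \<delta>) / (real n / 2)"
      using le half elim by (intro frac_le) auto
    also have "\<dots> \<le> real n powr (- (\<delta> / 2))" using elim by (simp add: field_simps)
    also have "- (\<delta> / 2) = - 2 * \<gamma>" using \<delta>(4) by simp
    finally show ?case .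
  qed
qed

lemma growth_imp_o_n:
  fixes M :: "nat \<Rightarrow> nat"
  assumes \<eta>: "0 < \<eta>" and growth: "(\<lambda>n. real (M n) powr (1 + \<eta>) / real n) \<longlonglongrightarrow> 0"
  shows "(\<lambda>n. real (M n) / real n) \<longlonglongrightarrow> 0"
proof (rule tendsto_sandwich)
  show "eventually (\<lambda>n. 0 \<le> real (M n) / real n) sequentially" by simp
  show "eventually (\<lambda>n. real (M n) / real n \<le> real (M n) powr (1 + \<eta>) / real n) sequentially"
  proof (rule always_eventually, rule allI)
    fix n
    have "real (M n) \<le> real (M n) powr (1 + \<eta>)"
    proof (cases "M n = 0")
      case False
      then have "real (M n) powr 1 \<le> real (M n) powr (1 + \<eta>)" using \<eta> by (intro powr_mono) auto
      then show ?thesis using False by simp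
    qed simp
    then show "real (M n) / real n \<le> real (M n) powr (1 + \<eta>) / real n" by (rule divide_right_mono) simp
  qed
qed (use growth in auto)

lemma eventually_le_small:
  fixes f g :: "nat \<Rightarrow> real"
  assumes "(\<lambda>n. f n / g n) \<longlonglongrightarrow> 0" "0 < \<delta>" "eventually (\<lambda>n. 0 < g n) sequentially"
  shows "eventually (\<lambda>n. f n \<le> \<delta> * g n) sequentially"
proof -
  have "eventually (\<lambda>n. f n / g n < \<delta>) sequentially"
    using assms(1,2) by (rule order_tendstoD)
  then show ?thesis using assms(3) by eventually_elim (simp add: field_simps)
qed

text \<open>
  As there is at least one variable, \<open>m + 1 \<le> 2 * m\<close>, and the left-hand side is at most a constant
  times \<open>m\<close>.
\<close>

lemma eventually_overfit_small:
  fixes M :: "nat \<Rightarrow> nat" and a :: "nat \<Rightarrow> real"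
  assumes a: "\<And>n. 0 \<le> a n" and \<gamma>: "0 < \<gamma>" and K: "0 \<le> K" and r0: "0 < r0" "r0 < 1"
    and ratio: "(\<lambda>n. real (M n) / (a n + ln (real n))) \<longlonglongrightarrow> 0"
    and M1: "eventually (\<lambda>n. 1 \<le> M n) sequentially"
  shows "eventually (\<lambda>n. K * real (M n) + (real (M n) + 1) * ln (1 / r0) < a n + \<gamma> * ln (real n)) sequentially"
proof -
  define C where "C = K + 2 * ln (1 / r0) + 1"
  have l: "0 < ln (1 / r0)" using r0 by simp
  have C: "0 < C" using K l by (simp add: C_def)
  define \<delta> where "\<delta> = min 1 \<gamma> / (2 * C)"
  have \<delta>: "0 < \<delta>" using \<gamma> C by (simp add: \<delta>_def)
  have g: "eventually (\<lambda>n. 0 < a n + ln (real n)) sequentially"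
    using eventually_gt_at_top[of 1] by eventually_elim (use a in \<open>auto intro!: add_nonneg_pos\<close>)
  from eventually_le_small[OF ratio \<delta> g] M1 eventually_gt_at_top[of 1]
  show ?thesis
  proof eventually_elim
    case (elim n)
    have L: "0 < ln (real n)" using elim by simp
    have "(real (M n) + 1) * ln (1 / r0) \<le> (2 * real (M n)) * ln (1 / r0)"
      using elim l by (intro mult_right_mono) auto
    then have "K * real (M n) + (real (M n) + 1) * ln (1 / r0) \<le> (C - 1) * real (M n)"
      by (simp add: C_def algebra_simps)
    also have "\<dots> < C * real (M n)" using elim by simp
    also have "\<dots> \<le> C * (\<delta> * (a n + ln (real n)))" using elim C by (intro mult_left_mono) auto
    also have "\<dots> = min 1 \<gamma> / 2 * a n + min 1 \<gamma> / 2 * ln (real n)"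
      using C by (simp add: \<delta>_def field_simps)
    also have "\<dots> \<le> 1 * a n + \<gamma> * ln (real n)"
      using a[of n] L \<gamma> by (intro add_mono mult_right_mono) auto
    finally show ?case by simp
  qed
qed

lemma eventually_underfit_mPVC:
  fixes a :: "nat \<Rightarrow> real"
  assumes a: "(\<lambda>n. a n / real n) \<longlonglongrightarrow> 0" and pos: "0 < \<theta>" "0 < \<Lambda>" "0 < r0"
  shows "eventually (\<lambda>n. 2 * exp 4 * real n * real n powr (2 * real p) * (\<theta> / \<Lambda>) powr (- real p) / r0 *
      exp (real p * a n) < (1 + \<theta> / \<Lambda>) powr ((real n - real p) / 2)) sequentially"
proof -
  define l where "l = ln (1 + \<theta> / \<Lambda>)"
  have l: "0 < l" unfolding l_def by (rule ln_gt_zero) (use pos in simp)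
  have "0 < 1 + \<theta> / \<Lambda>" using pos by (intro add_pos_pos divide_pos_pos) auto
  then have ne: "1 + \<theta> / \<Lambda> \<noteq> 0" by simp
  define c where "c = 2 * exp 4 * (\<theta> / \<Lambda>) powr (- real p) / r0"
  have c: "0 < c" using pos by (simp add: c_def)
  have "eventually (\<lambda>n. a n \<le> l / (8 * (real p + 1)) * real n) sequentially"
    using a l by (intro eventually_le_small) (auto intro: eventually_gt_at_top)
  moreover have "eventually (\<lambda>n. ln c + (2 * real p + 1) * ln (real n) + l / 8 * real n < l * (real n - real p) / 2) sequentially"
    using l by real_asymp
  ultimately show ?thesis using eventually_gt_at_top[of 0]
  proof eventually_elim
    case (elim n)
    have "real p * a n \<le> real p * (l / (8 * (real p + 1)) * real n)" using elim by (intro mult_left_mono) auto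
    also have "\<dots> = real p / (real p + 1) * (l / 8 * real n)" by (simp add: field_simps)
    also have "\<dots> \<le> 1 * (l / 8 * real n)" using l by (intro mult_right_mono) auto
    finally have "ln c + (2 * real p + 1) * ln (real n) + real p * a n < l * (real n - real p) / 2"
      using elim by linarith
    then have "exp (ln c + (2 * real p + 1) * ln (real n) + real p * a n) < exp (l * (real n - real p) / 2)" by simp
    also have "exp (l * (real n - real p) / 2) = (1 + \<theta> / \<Lambda>) powr ((real n - real p) / 2)"
      using ne by (simp add: l_def powr_def mult.commute)
    also have "exp (ln c + (2 * real p + 1) * ln (real n) + real p * a n) = c * real n powr (2 * real p + 1) * exp (real p * a n)"
      using c elim by (simp add: exp_add powr_def)
    also have "\<dots> = 2 * exp 4 * real n * real n powr (2 * real p) * (\<theta> / \<Lambda>) powr (- real p) / r0 * exp (real p * a n)"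
      using elim by (simp add: c_def powr_add)
    finally show ?case .
  qed
qed

lemma eventually_underfit_MPVC:
  fixes a :: "nat \<Rightarrow> real" and M :: "nat \<Rightarrow> nat"
  assumes a: "(\<lambda>n. a n / real n) \<longlonglongrightarrow> 0" and M: "(\<lambda>n. real (M n) / real n) \<longlonglongrightarrow> 0" and r0: "0 < r0" "r0 < 1"
  shows "eventually (\<lambda>n. 1 / r0 * (2 / r0) ^ M n * ((1 - r0) / (1 - r0 / 2)) powr ((real n - real (M n)) / 2)
      < exp (- (real p + 1) * a n)) sequentially"
proof -
  define l where "l = - ln ((1 - r0) / (1 - r0 / 2))"
  have l: "0 < l" using r0 by (simp add: l_def)
  define k where "k = ln (2 / r0)"
  have k: "0 < k" using r0 by (simp add: k_def)
  have "eventually (\<lambda>n. a n \<le> l / (8 * (real p + 1)) * real n) sequentially"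
    using a l by (intro eventually_le_small) (auto intro: eventually_gt_at_top)
  moreover have "eventually (\<lambda>n. real (M n) \<le> l / (8 * (k + l)) * real n) sequentially"
    using M l k by (intro eventually_le_small) (auto intro: eventually_gt_at_top)
  moreover have "eventually (\<lambda>n. - ln r0 < l / 8 * real n) sequentially"
    using l by real_asymp
  ultimately show ?thesis
  proof eventually_elim
    case (elim n)
    have "(real p + 1) * a n \<le> (real p + 1) * (l / (8 * (real p + 1)) * real n)" using elim by (intro mult_left_mono) auto
    also have "\<dots> = l / 8 * real n" by (simp add: field_simps)
    finally have 1: "(real p + 1) * a n \<le> l / 8 * real n" .
    have "(k + l) * real (M n) \<le> (k + l) * (l / (8 * (k + l)) * real n)" using elim k l by (intro mult_left_mono) auto
    also have "\<dots> = l / 8 * real n" using k l by (simp add: field_simps)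
    finally have 2: "k * real (M n) + l * real (M n) \<le> l / 8 * real n" by (simp add: distrib_right)
    have 3: "0 \<le> l * real (M n)" "0 \<le> l * real n" using l by auto
    have 4: "l * ((real n - real (M n)) / 2) = (l * real n - l * real (M n)) / 2"
      "real (M n) * k = k * real (M n)" "l / 8 * real n = l * real n / 8"
      by (simp_all add: right_diff_distrib)
    have "- ln r0 + real (M n) * k - l * ((real n - real (M n)) / 2) < - ((real p + 1) * a n)"
    proof -
      have "u + z - (y - x) / 2 < - w"
        if "w \<le> y / 8" "z + x \<le> y / 8" "0 \<le> x" "0 \<le> y" "u < y / 8" for u w x y z :: real
        using that by (simp add: field_simps)
      then show ?thesis using 1 2 3 elim(3) unfolding 4 by blast
    qed
    then have "exp (- ln r0 + real (M n) * k - l * ((real n - real (M n)) / 2)) < exp (- (real p + 1) * a n)"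
      by (simp only: exp_less_cancel_iff mult_minus_left)
    moreover have "exp (- ln r0 + real (M n) * k - l * ((real n - real (M n)) / 2)) =
        1 / r0 * (2 / r0) ^ M n * ((1 - r0) / (1 - r0 / 2)) powr ((real n - real (M n)) / 2)"
    proof -
      have e1: "exp (- ln r0) = 1 / r0" using r0 by (simp add: exp_minus inverse_eq_divide)
      have e2: "exp (real (M n) * k) = (2 / r0) ^ M n" using r0 by (simp add: k_def exp_of_nat_mult)
      have e3: "exp (- (l * ((real n - real (M n)) / 2))) = ((1 - r0) / (1 - r0 / 2)) powr ((real n - real (M n)) / 2)"
        using r0 by (simp add: l_def powr_def mult.commute)
      have "exp (- ln r0 + real (M n) * k - l * ((real n - real (M n)) / 2)) =
        exp (- ln r0) * exp (real (M n) * k) * exp (- (l * ((real n - real (M n)) / 2)))"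
        by (simp only: exp_add[symmetric] diff_conv_add_uminus)
      then show ?thesis by (simp only: e1 e2 e3)
    qed
    ultimately show ?case by (simp only:)
  qed
qed

lemma eventually_MPVC_small:
  fixes M :: "nat \<Rightarrow> nat" and a :: "nat \<Rightarrow> real"
  assumes inf: "filterlim a at_top sequentially" and ratio: "(\<lambda>n. real (M n) / a n) \<longlonglongrightarrow> 0" and K: "0 < K"
  shows "eventually (\<lambda>n. 4 * K * real (M n) + ln 2 < a n) sequentially"
proof -
  have big: "eventually (\<lambda>n. 2 < a n) sequentially" using inf by (simp add: filterlim_at_top_dense)
  then have "eventually (\<lambda>n. 0 < a n) sequentially" by eventually_elim simp
  then have "eventually (\<lambda>n. real (M n) \<le> 1 / (8 * K) * a n) sequentially"
    using ratio K by (intro eventually_le_small) auto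
  then show ?thesis using big
  proof eventually_elim
    case (elim n)
    have "4 * K * real (M n) \<le> 4 * K * (1 / (8 * K) * a n)" using elim K by (intro mult_left_mono) auto
    also have "\<dots> = a n / 2" using K by simp
    finally show ?case using elim ln_2_less_1 by linarith
  qed
qed

section \<open>The gap from the geometry of the design\<close>

definition lin_comb :: "nat \<Rightarrow> (nat \<Rightarrow> nat \<Rightarrow> real) \<Rightarrow> (nat \<Rightarrow> real) \<Rightarrow> nat \<Rightarrow> real" where
  "lin_comb m X v l = (\<Sum>i = 1..m. X l i * v i)"

text \<open>
  With \<open>s\<close> the length of \<open>X v\<close>, the residual sum of squares of a fit is at least
  \<open>E - 2 * sqrt D * s + s\<^sup>2\<close>. In general this is at least \<open>E - D\<close>. If a true variable is missing, then
  \<open>s\<^sup>2\<close> is at least \<open>g * n\<close>, and \<open>4 * sqrt D \<le> s\<close> reduces the cross term to half of \<open>s\<^sup>2\<close>.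
\<close>

lemma rss_gap_from_geometry:
  assumes t: "t \<subseteq> {1..m}" and \<beta>: "\<And>i. i \<in> {1..m} - t \<Longrightarrow> \<beta> i = 0"
    and Y: "Y = (\<lambda>l. lin_comb m X \<beta> l + \<epsilon> l)"
    and curv: "\<And>v i. i \<in> {1..m} \<Longrightarrow> c * real n * (v i)\<^sup>2 \<le> ip_sq n (lin_comb m X v)"
    and noise: "\<And>v. (ip n \<epsilon> (lin_comb m X v))\<^sup>2 \<le> D * ip_sq n (lin_comb m X v)"
    and D: "0 \<le> D" "16 * D \<le> g * real n"
    and g: "\<And>i. i \<in> t \<Longrightarrow> g \<le> c * (\<beta> i)\<^sup>2" and \<theta>: "2 * \<theta> \<le> g"
    and E: "\<theta> * real n \<le> ip_sq n \<epsilon> - D" "ip_sq n \<epsilon> \<le> \<Lambda> * real n" "ip_sq n Y \<le> \<Lambda> * real n"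
  shows "rss_gap n m X Y t (ip_sq n \<epsilon>) D \<theta> \<Lambda>"
proof -
  let ?E = "ip_sq n \<epsilon>"
  have expand: "\<exists>v. RSS n X Y j = ?E + 2 * ip n \<epsilon> (lin_comb m X v) + ip_sq n (lin_comb m X v) \<and>
      (\<forall>i \<in> {1..m} - j. v i = \<beta> i)" if j: "j \<subseteq> {1..m}" for j
  proof -
    define b where "b = ls_fit n X Y j"
    (* the error of the fitted coefficients, extended by 0 outside j *)
    define v where "v = (\<lambda>i. \<beta> i - (if i \<in> j then b i else 0))"
    have "(\<Sum>i\<in>j. X l i * b i) = (\<Sum>i = 1..m. X l i * (if i \<in> j then b i else 0))" for l
      using j by (intro sum.mono_neutral_cong_left) auto
    then have res: "Y l - (\<Sum>i\<in>j. X l i * b i) = \<epsilon> l + lin_comb m X v l" for l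
      by (simp add: Y lin_comb_def v_def right_diff_distrib sum_subtractf)
    have "RSS n X Y j = ip_sq n (\<lambda>l. \<epsilon> l + lin_comb m X v l)"
      unfolding RSS_def sq_resid_ip b_def[symmetric] res ..
    also have "\<dots> = ?E + 2 * ip n \<epsilon> (lin_comb m X v) + ip_sq n (lin_comb m X v)"
      by (simp add: ip_add_left ip_add_right ip_commute[of n "lin_comb m X v" \<epsilon>])
    finally show ?thesis by (intro exI[of _ v]) (auto simp: v_def)
  qed
  have cross: "- sqrt D * sqrt (ip_sq n (lin_comb m X v)) \<le> ip n \<epsilon> (lin_comb m X v)" for v
  proof -
    have "\<bar>ip n \<epsilon> (lin_comb m X v)\<bar> \<le> sqrt (D * ip_sq n (lin_comb m X v))"
      using noise[of v] by (metis real_sqrt_abs real_sqrt_le_mono)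
    then show ?thesis by (simp add: real_sqrt_mult)
  qed
  have lower: "?E - D \<le> RSS n X Y j" if j: "j \<subseteq> {1..m}" for j
  proof -
    obtain v where v: "RSS n X Y j = ?E + 2 * ip n \<epsilon> (lin_comb m X v) + ip_sq n (lin_comb m X v)"
      using expand[OF j] by blast
    define s where "s = sqrt (ip_sq n (lin_comb m X v))"
    have s2: "s\<^sup>2 = ip_sq n (lin_comb m X v)" unfolding s_def by (simp add: ip_self_nonneg)
    have "0 \<le> (s - sqrt D)\<^sup>2" by simp
    also have "\<dots> = s\<^sup>2 + D - 2 * (sqrt D * s)" using D by (simp add: power2_diff)
    finally have "2 * (sqrt D * s) \<le> s\<^sup>2 + D" by simp
    moreover have "- (sqrt D * s) \<le> ip n \<epsilon> (lin_comb m X v)" using cross[of v] by (simp add: s_def)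
    ultimately show ?thesis unfolding v s2[symmetric] by linarith
  qed
  have missing: "?E + \<theta> * real n \<le> RSS n X Y j" if j: "j \<subseteq> {1..m}" "\<not> t \<subseteq> j" for j
  proof -
    obtain v where v: "RSS n X Y j = ?E + 2 * ip n \<epsilon> (lin_comb m X v) + ip_sq n (lin_comb m X v)"
      and vb: "\<forall>i \<in> {1..m} - j. v i = \<beta> i"
      using expand[OF j(1)] by blast
    obtain i where i: "i \<in> t" "i \<notin> j" using j by auto
    define s where "s = sqrt (ip_sq n (lin_comb m X v))"
    have s2: "s\<^sup>2 = ip_sq n (lin_comb m X v)" unfolding s_def by (simp add: ip_self_nonneg)
    have s0: "0 \<le> s" by (simp add: s_def ip_self_nonneg)
    have "g * real n \<le> c * (\<beta> i)\<^sup>2 * real n" using g[OF i(1)] by (intro mult_right_mono) auto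
    also have "\<dots> = c * real n * (v i)\<^sup>2" using vb i t by auto
    also have "\<dots> \<le> s\<^sup>2" unfolding s2 using i t by (intro curv) auto
    finally have gs: "g * real n \<le> s\<^sup>2" .
    have "(4 * sqrt D)\<^sup>2 \<le> s\<^sup>2" using D gs by (simp add: power_mult_distrib)
    then have "4 * sqrt D \<le> s" using s0 by (rule power2_le_imp_le)
    then have "4 * sqrt D * s \<le> s * s" using s0 by (rule mult_right_mono)
    then have "2 * (sqrt D * s) \<le> s\<^sup>2 / 2" by (simp add: power2_eq_square)
    moreover have "2 * (\<theta> * real n) \<le> g * real n" using \<theta> mult_right_mono[of "2 * \<theta>" g "real n"] by simp
    moreover have "- (sqrt D * s) \<le> ip n \<epsilon> (lin_comb m X v)" using cross[of v] by (simp add: s_def)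
    ultimately show ?thesis
      using gs unfolding v s2[symmetric] by linarith
  qed
  have upper: "RSS n X Y j \<le> ?E" if j: "j \<subseteq> {1..m}" "t \<subseteq> j" for j
  proof -
    have fin: "finite j" "finite t" using j t finite_subset by blast+
    have "(\<Sum>i\<in>t. X l i * \<beta> i) = lin_comb m X \<beta> l" for l
      unfolding lin_comb_def using t \<beta> by (intro sum.mono_neutral_cong_left) auto
    then have "sq_resid n X Y t \<beta> = ?E" unfolding sq_resid_ip by (simp add: Y)
    then show ?thesis
      using RSS_le[OF fin(2), of n X Y \<beta>] RSS_antimono[OF fin(1) j(2), of n X Y] by simp
  qed
  have "RSS n X Y {} = ip_sq n Y" by (simp add: RSS_def sq_resid_ip)
  then show ?thesis
    unfolding rss_gap_def using lower missing upper E D by auto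
qed

definition sq_norm :: "nat \<Rightarrow> (nat \<Rightarrow> real) \<Rightarrow> real" where
  "sq_norm m v = (\<Sum>i = 1..m. (v i)\<^sup>2)"

lemma sq_norm_nonneg: "0 \<le> sq_norm m v"
  by (simp add: sq_norm_def sum_nonneg)

lemma sq_norm_scale: "sq_norm m (\<lambda>i. c * v i) = c\<^sup>2 * sq_norm m v"
  by (simp add: sq_norm_def power_mult_distrib sum_distrib_left)

lemma lin_comb_scale: "lin_comb m X (\<lambda>i. c * v i) l = c * lin_comb m X v l"
  by (simp add: lin_comb_def sum_distrib_left mult_ac)

lemma lin_comb_add: "lin_comb m X (\<lambda>i. u i + v i) l = lin_comb m X u l + lin_comb m X v l"
  by (simp add: lin_comb_def distrib_left sum.distrib)

lemma lin_comb_sq_le: "(lin_comb m X v l)\<^sup>2 \<le> sq_norm m (X l) * sq_norm m v"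
  unfolding lin_comb_def sq_norm_def by (rule Cauchy_Schwarz_ineq_sum)

text \<open>
  A perturbation costs at most half of the squared length and its own squared length, because
  \<open>(u l + 2 * v l)\<^sup>2\<close> is nonnegative.
\<close>

lemma ip_half_lower:
  "ip_sq n u / 2 - ip_sq n v \<le> ip_sq n (\<lambda>l. u l + v l)"
proof -
  have "(u l)\<^sup>2 / 2 - (v l)\<^sup>2 \<le> (u l + v l)\<^sup>2" for l
  proof -
    have "0 \<le> (u l + 2 * v l)\<^sup>2" by simp
    then show ?thesis by (simp add: power2_eq_square algebra_simps)
  qed
  then have "(\<Sum>l = 1..n. (u l)\<^sup>2 / 2 - (v l)\<^sup>2) \<le> (\<Sum>l = 1..n. (u l + v l)\<^sup>2)" by (intro sum_mono)
  then show ?thesis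
    by (simp add: ip_def power2_eq_square sum_subtractf sum_divide_distrib)
qed

text \<open>
  The grid points are kept as integer vectors, since the inequalities to be checked on the grid are
  invariant under scaling.
\<close>

definition int_grid :: "nat \<Rightarrow> nat \<Rightarrow> (nat \<Rightarrow> int) set" where
  "int_grid m N = PiE {1..m} (\<lambda>_. {- int N..int N})"

lemma finite_int_grid: "finite (int_grid m N)"
  unfolding int_grid_def by (intro finite_PiE) auto

lemma card_int_grid: "card (int_grid m N) = (2 * N + 1) ^ m"
  unfolding int_grid_def by (subst card_PiE) (auto simp: nat_add_distrib nat_mult_distrib)

text \<open>
  A unit vector is approximated by the grid with mesh \<open>1 / n\<^sup>2\<close> up to an error of squared length at
  most \<open>m / n ^ 4\<close>. The Frobenius bound turns this into an error of squared length at most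
  \<open>(m / n)\<^sup>2 \<le> 1\<close> in the image, which is negligible against \<open>n\<close>. In numbers, the
  approximating vector has squared length at least \<open>1 / 4\<close>, its image at least \<open>n / 8\<close>, and the image of
  the unit vector at least \<open>n / 16 - 1\<close>.
\<close>

lemma lower_frame_bound_from_grid:
  assumes mn: "m \<le> n" "64 \<le> n"
    and frob: "(\<Sum>l = 1..n. sq_norm m (z l)) \<le> (real n)\<^sup>2 * real m"
    and grid: "\<And>g. g \<in> int_grid m (n\<^sup>2) \<Longrightarrow> 0 < sq_norm m (\<lambda>i. real_of_int (g i)) \<Longrightarrow>
      real n / 2 * sq_norm m (\<lambda>i. real_of_int (g i)) \<le>
      ip_sq n (lin_comb m z (\<lambda>i. real_of_int (g i)))"
  shows "real n / 32 * sq_norm m w \<le> ip_sq n (lin_comb m z w)"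
proof -
  have unit: "real n / 32 \<le> ip_sq n (lin_comb m z u)" if u: "sq_norm m u = 1" for u
  proof -
    define N where "N = n\<^sup>2"
    have N: "0 < real N" "real n \<le> real N" "(real N)\<^sup>2 = real n ^ 4"
      using mn power_mult[of "real n" 2 2] by (auto simp: N_def power2_eq_square)
    define g where "g = (\<lambda>i\<in>{1..m}. \<lfloor>real N * u i\<rfloor>)"
    have u1: "\<bar>u i\<bar> \<le> 1" if "i \<in> {1..m}" for i
    proof -
      have "(u i)\<^sup>2 \<le> sq_norm m u" unfolding sq_norm_def using that by (intro member_le_sum) auto
      then show ?thesis using u by (simp add: abs_square_le_1)
    qed
    have gm: "g \<in> int_grid m N"
      unfolding int_grid_def
    proof (intro PiE_I)
      fix i assume i: "i \<in> {1..m}"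
      have "\<bar>real N * u i\<bar> \<le> real N * 1" unfolding abs_mult using u1[OF i] by (intro mult_mono) auto
      then have "- real N \<le> real N * u i" "real N * u i \<le> real N" by linarith+
      then have "- int N \<le> \<lfloor>real N * u i\<rfloor>" "\<lfloor>real N * u i\<rfloor> \<le> int N" by linarith+
      then show "g i \<in> {- int N..int N}" using i by (simp add: g_def)
    qed (auto simp: g_def)
    define d where "d = (\<lambda>i. u i - real_of_int (g i) / real N)"
    have dle: "(d i)\<^sup>2 \<le> 1 / (real N)\<^sup>2" if i: "i \<in> {1..m}" for i
    proof -
      have "\<bar>real N * u i - real_of_int \<lfloor>real N * u i\<rfloor>\<bar> \<le> 1" by linarith
      then have "(real N * u i - real_of_int \<lfloor>real N * u i\<rfloor>)\<^sup>2 \<le> 1" by (simp add: abs_square_le_1)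
      moreover have "d i = (real N * u i - real_of_int \<lfloor>real N * u i\<rfloor>) / real N"
        using i N by (simp add: d_def g_def field_simps)
      ultimately show ?thesis by (simp add: power_divide divide_right_mono)
    qed
    have dn: "sq_norm m d \<le> real m / (real N)\<^sup>2"
    proof -
      have "sq_norm m d \<le> (\<Sum>i = 1..m. 1 / (real N)\<^sup>2)" unfolding sq_norm_def by (intro sum_mono dle) auto
      then show ?thesis by simp
    qed
    have Zd: "ip_sq n (lin_comb m z d) \<le> 1"
    proof -
      have "ip_sq n (lin_comb m z d) \<le> (\<Sum>l = 1..n. sq_norm m (z l) * sq_norm m d)"
        unfolding ip_def power2_eq_square[symmetric] by (intro sum_mono lin_comb_sq_le)
      also have "\<dots> = (\<Sum>l = 1..n. sq_norm m (z l)) * sq_norm m d" by (simp add: sum_distrib_right)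
      also have "\<dots> \<le> ((real n)\<^sup>2 * real m) * (real m / (real N)\<^sup>2)"
        using frob dn by (intro mult_mono) (auto simp: sq_norm_nonneg)
      also have "\<dots> = (real m / real n)\<^sup>2" using mn unfolding N(3) by (simp add: field_simps power2_eq_square power4_eq_xxxx)
      also have "\<dots> \<le> 1" using mn by (intro power_le_one) auto
      finally show ?thesis .
    qed
    define h where "h = (\<lambda>i. 1 / real N * real_of_int (g i))"
    have ud: "u = (\<lambda>i. h i + d i)" by (auto simp: h_def d_def)
    have hn: "1 / 4 \<le> sq_norm m h"
    proof -
      have "(u i)\<^sup>2 / 2 - (d i)\<^sup>2 \<le> (h i)\<^sup>2" for i
      proof -
        have "0 \<le> (u i - 2 * d i)\<^sup>2" by simp
        then show ?thesis by (simp add: ud power2_eq_square algebra_simps)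
      qed
      then have "(\<Sum>i = 1..m. (u i)\<^sup>2 / 2 - (d i)\<^sup>2) \<le> sq_norm m h" unfolding sq_norm_def by (intro sum_mono)
      then have "sq_norm m u / 2 - sq_norm m d \<le> sq_norm m h"
        by (simp add: sq_norm_def sum_subtractf sum_divide_distrib)
      moreover have "real m / (real N)\<^sup>2 \<le> 1 / 4"
      proof -
        have "4 * real m \<le> real n * real n" using mn by (intro mult_mono) auto
        also have "\<dots> \<le> real N * real N" using N by (intro mult_mono) auto
        finally have "real m \<le> 1 / 4 * (real N)\<^sup>2" by (simp add: power2_eq_square)
        then show ?thesis using N(1) by (subst pos_divide_le_eq) auto
      qed
      ultimately show ?thesis using dn u by linarith
    qed
    have hg: "sq_norm m h = (1 / real N)\<^sup>2 * sq_norm m (\<lambda>i. real_of_int (g i))"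
      unfolding h_def by (rule sq_norm_scale)
    have "0 < sq_norm m (\<lambda>i. real_of_int (g i))"
    proof -
      have "sq_norm m (\<lambda>i. real_of_int (g i)) \<noteq> 0" using hn unfolding hg by auto
      then show ?thesis using sq_norm_nonneg[of m "\<lambda>i. real_of_int (g i)"] by linarith
    qed
    then have "(1 / real N)\<^sup>2 * (real n / 2 * sq_norm m (\<lambda>i. real_of_int (g i))) \<le> (1 / real N)\<^sup>2 *
        ip_sq n (lin_comb m z (\<lambda>i. real_of_int (g i)))"
      using grid gm unfolding N_def by (intro mult_left_mono) auto
    also have "\<dots> = ip_sq n (lin_comb m z h)"
      unfolding h_def lin_comb_scale by (simp only: ip_scale_left ip_scale_right power2_eq_square mult.assoc)
    finally have "real n / 2 * sq_norm m h \<le> ip_sq n (lin_comb m z h)"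
      unfolding hg by (simp add: mult_ac)
    moreover have "real n / 2 * (1 / 4) \<le> real n / 2 * sq_norm m h" using hn by (intro mult_left_mono) auto
    ultimately have hh: "real n / 8 \<le> ip_sq n (lin_comb m z h)" by linarith
    have "lin_comb m z u = (\<lambda>l. lin_comb m z h l + lin_comb m z d l)"
      by (subst ud) (auto simp: lin_comb_add)
    then show ?thesis
      using ip_half_lower[of n "lin_comb m z h" "lin_comb m z d"] hh Zd mn by simp
  qed
  show ?thesis
  proof (cases "sq_norm m w = 0")
    case True
    then show ?thesis by (simp add: ip_self_nonneg)
  next
    case False
    then have W: "0 < sq_norm m w" using sq_norm_nonneg[of m w] by simp
    define r where "r = sqrt (sq_norm m w)"
    have r: "0 < r" "r\<^sup>2 = sq_norm m w" using W by (auto simp: r_def)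
    define u where "u = (\<lambda>i. 1 / r * w i)"
    have "sq_norm m u = 1" unfolding u_def sq_norm_scale using r W by (simp add: power_divide)
    then have "real n / 32 \<le> ip_sq n (lin_comb m z u)" by (rule unit)
    also have "\<dots> = (1 / r)\<^sup>2 * ip_sq n (lin_comb m z w)"
      unfolding u_def lin_comb_scale by (simp only: ip_scale_left ip_scale_right power2_eq_square mult.assoc)
    also have "(1 / r)\<^sup>2 = 1 / sq_norm m w" by (simp add: power_divide r(2))
    finally show ?thesis using W by (simp add: field_simps)
  qed
qed

text \<open>
  The inner product of the noise with a combination of columns is at most the length of the
  coefficient vector times that of the vector of inner products with the columns. The frame bound
  replaces the length of the coefficients by that of the combination.
\<close>

lemma noise_bound_from_frame:
  assumes frame: "\<And>w. real n / 32 * sq_norm m w \<le> ip_sq n (lin_comb m z w)" and n: "0 < n"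
  shows "(ip n \<epsilon> (lin_comb m z w))\<^sup>2 \<le>
    32 / real n * (\<Sum>i = 1..m. (ip n \<epsilon> (\<lambda>l. z l i))\<^sup>2) * ip_sq n (lin_comb m z w)"
proof -
  have "ip n \<epsilon> (lin_comb m z w) = (\<Sum>i = 1..m. ip n \<epsilon> (\<lambda>l. z l i) * w i)"
    unfolding lin_comb_def[abs_def] ip_sum_right
    by (intro sum.cong) (simp_all add: ip_def sum_distrib_left sum_distrib_right mult_ac)
  then have "(ip n \<epsilon> (lin_comb m z w))\<^sup>2 \<le> (\<Sum>i = 1..m. (ip n \<epsilon> (\<lambda>l. z l i))\<^sup>2) * sq_norm m w"
    unfolding sq_norm_def using Cauchy_Schwarz_ineq_sum by simp
  also have "\<dots> \<le> (\<Sum>i = 1..m. (ip n \<epsilon> (\<lambda>l. z l i))\<^sup>2) *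
      (32 / real n * ip_sq n (lin_comb m z w))"
    using frame[of w] n by (intro mult_left_mono) (auto simp: sum_nonneg field_simps)
  finally show ?thesis by (simp add: mult_ac)
qed

section \<open>Lower tails of sums of squares\<close>

text \<open>
  The product of the quadratics \<open>1 - y + y\<^sup>2 / 2\<close> and \<open>1 + y + y\<^sup>2 / 2\<close> is \<open>1 + y ^ 4 / 4\<close>.
\<close>

lemma exp_minus_le_quadratic:
  fixes y :: real
  assumes "0 \<le> y"
  shows "exp (- y) \<le> 1 - y + y\<^sup>2 / 2"
proof -
  have p: "0 < 1 + y + y\<^sup>2 / 2" using assms by (intro add_pos_nonneg) auto
  have "1 \<le> (1 - y + y\<^sup>2 / 2) * (1 + y + y\<^sup>2 / 2)"
  proof -
    have "(1 - y + y\<^sup>2 / 2) * (1 + y + y\<^sup>2 / 2) = 1 + (y\<^sup>2)\<^sup>2 / 4"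
      by (simp add: power2_eq_square field_simps)
    then show ?thesis by simp
  qed
  then have "1 / (1 + y + y\<^sup>2 / 2) \<le> 1 - y + y\<^sup>2 / 2"
    using p by (simp add: pos_divide_le_eq)
  moreover have "exp (- y) \<le> 1 / (1 + y + y\<^sup>2 / 2)"
    using exp_lower_Taylor_quadratic[OF assms] p by (simp add: exp_minus inverse_eq_divide frac_le)
  ultimately show ?thesis by linarith
qed

text \<open>
  The exponential moment method for the negative of a nonnegative variable: the quadratic upper bound
  for \<open>exp (- y)\<close> involves only the first two moments of the squares. The parameter
  \<open>1 / (2 * C * \<tau>)\<close> makes the linear term win by a constant.
\<close>

lemma (in prob_space) sum_of_squares_lower_tail:
  fixes V :: "'i \<Rightarrow> 'a \<Rightarrow> real"
  assumes fin: "finite I" and indep: "indep_vars (\<lambda>_. borel) V I"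
    and int2: "\<And>i. i \<in> I \<Longrightarrow> integrable M (\<lambda>\<omega>. (V i \<omega>)\<^sup>2)"
    and int4: "\<And>i. i \<in> I \<Longrightarrow> integrable M (\<lambda>\<omega>. (V i \<omega>) ^ 4)"
    and m2: "\<And>i. i \<in> I \<Longrightarrow> expectation (\<lambda>\<omega>. (V i \<omega>)\<^sup>2) = \<tau>"
    and m4: "\<And>i. i \<in> I \<Longrightarrow> expectation (\<lambda>\<omega>. (V i \<omega>) ^ 4) \<le> C * \<tau>\<^sup>2"
    and pos: "0 < \<tau>" "0 < C"
  shows "prob {\<omega> \<in> space M. (\<Sum>i\<in>I. (V i \<omega>)\<^sup>2) \<le> real (card I) * \<tau> / 2} \<le> exp (- real (card I) / (8 * C))"
proof -
  define s where "s = 1 / (2 * C * \<tau>)"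
  have s: "0 < s" using pos by (simp add: s_def)
  define U where "U = (\<lambda>i \<omega>. exp (- s * (V i \<omega>)\<^sup>2))"
  have rv: "random_variable borel (V i)" if "i \<in> I" for i
    using indep that by (auto simp: indep_vars_def)
  have indU: "indep_vars (\<lambda>_. borel) U I"
    unfolding U_def using indep_vars_compose[OF indep, of "\<lambda>_ v. exp (- s * v\<^sup>2)" "\<lambda>_. borel"]
    by (simp add: comp_def)
  have intU: "integrable M (U i)" if "i \<in> I" for i
    using rv[OF that] s unfolding U_def
    by (intro integrable_const_bound[where B = 1]) auto
  have EU: "expectation (U i) \<le> exp (- 3 / (8 * C))" if i: "i \<in> I" for i
  proof -
    have "expectation (U i) \<le> expectation (\<lambda>\<omega>. 1 - s * (V i \<omega>)\<^sup>2 + s\<^sup>2 / 2 * (V i \<omega>) ^ 4)"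
    proof (rule integral_mono)
      show "integrable M (\<lambda>\<omega>. 1 - s * (V i \<omega>)\<^sup>2 + s\<^sup>2 / 2 * (V i \<omega>) ^ 4)"
        using int2[OF i] int4[OF i] by (intro Bochner_Integration.integrable_add Bochner_Integration.integrable_diff integrable_mult_right integrable_const) auto
      fix \<omega>
      have "exp (- (s * (V i \<omega>)\<^sup>2)) \<le> 1 - s * (V i \<omega>)\<^sup>2 + (s * (V i \<omega>)\<^sup>2)\<^sup>2 / 2"
        using s by (intro exp_minus_le_quadratic) simp
      also have "(s * (V i \<omega>)\<^sup>2)\<^sup>2 / 2 = s\<^sup>2 / 2 * (V i \<omega>) ^ 4"
        by (simp add: power_mult_distrib flip: power_mult)
      finally show "U i \<omega> \<le> 1 - s * (V i \<omega>)\<^sup>2 + s\<^sup>2 / 2 * (V i \<omega>) ^ 4" by (simp add: U_def)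
    qed (rule intU[OF i])
    also have "\<dots> = 1 - s * \<tau> + s\<^sup>2 / 2 * expectation (\<lambda>\<omega>. (V i \<omega>) ^ 4)"
      using int2[OF i] int4[OF i] m2[OF i] by (simp add: prob_space)
    also have "\<dots> \<le> 1 - s * \<tau> + s\<^sup>2 / 2 * (C * \<tau>\<^sup>2)"
      using m4[OF i] by (intro add_left_mono mult_left_mono) auto
    also have "\<dots> = 1 + (- 3 / (8 * C))"
      using pos by (simp add: s_def power2_eq_square field_simps)
    also have "\<dots> \<le> exp (- 3 / (8 * C))" by (rule exp_ge_add_one_self)
    finally show ?thesis .
  qed
  have prod: "expectation (\<lambda>\<omega>. \<Prod>i\<in>I. U i \<omega>) = (\<Prod>i\<in>I. expectation (U i))"
    using fin indU intU by (rule indep_vars_lebesgue_integral)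
  have intP: "integrable M (\<lambda>\<omega>. \<Prod>i\<in>I. U i \<omega>)"
    using fin indU intU by (rule indep_vars_integrable)
  have Pexp: "(\<Prod>i\<in>I. U i \<omega>) = exp (- s * (\<Sum>i\<in>I. (V i \<omega>)\<^sup>2))" for \<omega>
    using fin by (simp add: U_def sum_distrib_left exp_sum sum_negf flip: sum_negf)
  define c where "c = exp (- (real (card I) / (4 * C)))"
  have "prob {\<omega> \<in> space M. (\<Sum>i\<in>I. (V i \<omega>)\<^sup>2) \<le> real (card I) * \<tau> / 2} \<le>
      prob {\<omega> \<in> space M. c \<le> (\<Prod>i\<in>I. U i \<omega>)}"
  proof (rule finite_measure_mono)
    show "{\<omega> \<in> space M. c \<le> (\<Prod>i\<in>I. U i \<omega>)} \<in> events"
      using intP by measurable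
    show "{\<omega> \<in> space M. (\<Sum>i\<in>I. (V i \<omega>)\<^sup>2) \<le> real (card I) * \<tau> / 2} \<subseteq> {\<omega> \<in> space M. c \<le> (\<Prod>i\<in>I. U i \<omega>)}"
    proof (intro subsetI CollectI conjI; elim CollectE conjE)
      fix \<omega> assume "(\<Sum>i\<in>I. (V i \<omega>)\<^sup>2) \<le> real (card I) * \<tau> / 2"
      then have "s * (\<Sum>i\<in>I. (V i \<omega>)\<^sup>2) \<le> s * (real (card I) * \<tau> / 2)" using s by (intro mult_left_mono) auto
      also have "\<dots> = real (card I) / (4 * C)" using pos by (simp add: s_def)
      finally show "c \<le> (\<Prod>i\<in>I. U i \<omega>)" unfolding Pexp c_def by simp
    qed
  qed
  also have "\<dots> \<le> expectation (\<lambda>\<omega>. \<Prod>i\<in>I. U i \<omega>) / c"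
    using intP by (intro integral_Markov_inequality_measure[where A = "{}"]) (auto simp: Pexp c_def)
  also have "\<dots> \<le> (\<Prod>i\<in>I. exp (- 3 / (8 * C))) / c"
    unfolding prod using EU by (intro divide_right_mono prod_mono) (auto simp: c_def U_def)
  also have "\<dots> = exp (- real (card I) / (8 * C))"
  proof -
    have "(\<Prod>i\<in>I. exp (- 3 / (8 * C))) = exp (real (card I) * (- 3 / (8 * C)))"
      by (simp only: prod_constant exp_of_nat_mult)
    then show ?thesis using pos by (simp add: c_def exp_diff[symmetric] field_simps del: exp_diff)
  qed
  finally show ?thesis .
qed

section \<open>Whitened designs\<close>

text \<open>
  Real functions of the two independent elements have a common type and are independent in the sense
  of \<open>indep_var\<close>.
\<close>

lemma indep_rv_compose:
  assumes "prob_space Q" and ind: "indep_rv Q N V L W"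
    and f: "f \<in> borel_measurable N" and g: "g \<in> borel_measurable L"
  shows "prob_space.indep_var Q borel (\<lambda>\<omega>. f (V \<omega>)) borel (\<lambda>\<omega>. g (W \<omega>) :: real)"
proof -
  interpret prob_space Q by fact
  have V: "V \<in> measurable Q N" and W: "W \<in> measurable Q L"
    and I: "indep_set {V -` A \<inter> space Q | A. A \<in> sets N} {W -` B \<inter> space Q | B. B \<in> sets L}"
    using ind by (auto simp: indep_rv_def)
  have fV: "(\<lambda>\<omega>. f (V \<omega>)) \<in> borel_measurable Q" using V f by (rule measurable_compose)
  have gW: "(\<lambda>\<omega>. g (W \<omega>)) \<in> borel_measurable Q" using W g by (rule measurable_compose)
  have subf: "\<exists>B\<in>sets N. (\<lambda>\<omega>. f (V \<omega>)) -` A \<inter> space Q = V -` B \<inter> space Q" if "A \<in> sets borel" for A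
    using measurable_sets[OF f that] measurable_space[OF V]
    by (intro bexI[of _ "f -` A \<inter> space N"]) auto
  have subg: "\<exists>B\<in>sets L. (\<lambda>\<omega>. g (W \<omega>)) -` A \<inter> space Q = W -` B \<inter> space Q" if "A \<in> sets borel" for A
    using measurable_sets[OF g that] measurable_space[OF W]
    by (intro bexI[of _ "g -` A \<inter> space L"]) auto
  have "indep_set {(\<lambda>\<omega>. f (V \<omega>)) -` A \<inter> space Q | A. A \<in> sets borel} {(\<lambda>\<omega>. g (W \<omega>)) -` A \<inter> space Q | A. A \<in> sets borel}"
    unfolding indep_sets2_eq
  proof (intro conjI ballI)
    show "{(\<lambda>\<omega>. f (V \<omega>)) -` A \<inter> space Q | A. A \<in> sets borel} \<subseteq> events"
      using measurable_sets[OF fV] by auto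
    show "{(\<lambda>\<omega>. g (W \<omega>)) -` A \<inter> space Q | A. A \<in> sets borel} \<subseteq> events"
      using measurable_sets[OF gW] by auto
    fix a b assume "a \<in> {(\<lambda>\<omega>. f (V \<omega>)) -` A \<inter> space Q | A. A \<in> sets borel}"
      and "b \<in> {(\<lambda>\<omega>. g (W \<omega>)) -` A \<inter> space Q | A. A \<in> sets borel}"
    then obtain A B where AB: "A \<in> sets borel" "a = (\<lambda>\<omega>. f (V \<omega>)) -` A \<inter> space Q"
        "B \<in> sets borel" "b = (\<lambda>\<omega>. g (W \<omega>)) -` B \<inter> space Q" by auto
    obtain A' where "A' \<in> sets N" "a = V -` A' \<inter> space Q" using subf[OF AB(1)] AB(2) by auto
    moreover obtain B' where "B' \<in> sets L" "b = W -` B' \<inter> space Q" using subg[OF AB(3)] AB(4) by auto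
    ultimately show "prob (a \<inter> b) = prob a * prob b"
      by (intro indep_setD[OF I]) auto
  qed
  moreover have "Int_stable {h -` A \<inter> space Q | A. A \<in> sets borel}" for h :: "'a \<Rightarrow> real"
    unfolding Int_stable_def
  proof clarify
    fix A B :: "real set" assume "A \<in> sets borel" "B \<in> sets borel"
    then show "\<exists>D. h -` A \<inter> space Q \<inter> (h -` B \<inter> space Q) = h -` D \<inter> space Q \<and> D \<in> sets borel"
      by (intro exI[of _ "A \<inter> B"]) auto
  qed
  ultimately show ?thesis
    unfolding indep_var_eq using fV gW by (intro conjI indep_set_sigma_sets) auto
qed

text \<open>
  In the expansion of the square only the diagonal terms survive, as the noise is uncorrelated and
  independent of the weights.
\<close>

lemma (in prob_space) second_moment_of_weighted_noise:
  fixes \<epsilon> u :: "nat \<Rightarrow> 'a \<Rightarrow> real"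
  assumes cov: "\<And>l k. l \<in> {1..n} \<Longrightarrow> k \<in> {1..n} \<Longrightarrow>
      indep_var borel (\<lambda>\<omega>. \<epsilon> l \<omega> * \<epsilon> k \<omega>) borel (\<lambda>\<omega>. u l \<omega> * u k \<omega>)"
    and int\<epsilon>: "\<And>l k. l \<in> {1..n} \<Longrightarrow> k \<in> {1..n} \<Longrightarrow> integrable M (\<lambda>\<omega>. \<epsilon> l \<omega> * \<epsilon> k \<omega>)"
    and intu: "\<And>l k. l \<in> {1..n} \<Longrightarrow> k \<in> {1..n} \<Longrightarrow> integrable M (\<lambda>\<omega>. u l \<omega> * u k \<omega>)"
    and E\<epsilon>: "\<And>l k. l \<in> {1..n} \<Longrightarrow> k \<in> {1..n} \<Longrightarrow> expectation (\<lambda>\<omega>. \<epsilon> l \<omega> * \<epsilon> k \<omega>) = (if l = k then \<sigma>\<^sup>2 else 0)"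
    and Eu: "\<And>l. l \<in> {1..n} \<Longrightarrow> expectation (\<lambda>\<omega>. u l \<omega> * u l \<omega>) = 1"
  shows "integrable M (\<lambda>\<omega>. (ip n (\<lambda>l. \<epsilon> l \<omega>) (\<lambda>l. u l \<omega>))\<^sup>2)"
    and "expectation (\<lambda>\<omega>. (ip n (\<lambda>l. \<epsilon> l \<omega>) (\<lambda>l. u l \<omega>))\<^sup>2) = real n * \<sigma>\<^sup>2"
proof -
  have sq: "(ip n (\<lambda>l. \<epsilon> l \<omega>) (\<lambda>l. u l \<omega>))\<^sup>2 =
      (\<Sum>l = 1..n. \<Sum>k = 1..n. (\<epsilon> l \<omega> * \<epsilon> k \<omega>) * (u l \<omega> * u k \<omega>))" for \<omega>
    unfolding ip_def power2_eq_square sum_product by (intro sum.cong) (auto simp: mult_ac)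
  have I: "integrable M (\<lambda>\<omega>. (\<epsilon> l \<omega> * \<epsilon> k \<omega>) * (u l \<omega> * u k \<omega>))" if "l \<in> {1..n}" "k \<in> {1..n}" for l k
    by (rule indep_var_integrable[OF cov[OF that] int\<epsilon>[OF that] intu[OF that]])
  show "integrable M (\<lambda>\<omega>. (ip n (\<lambda>l. \<epsilon> l \<omega>) (\<lambda>l. u l \<omega>))\<^sup>2)"
    unfolding sq by (intro Bochner_Integration.integrable_sum I)
  have "expectation (\<lambda>\<omega>. (ip n (\<lambda>l. \<epsilon> l \<omega>) (\<lambda>l. u l \<omega>))\<^sup>2) =
      (\<Sum>l = 1..n. expectation (\<lambda>\<omega>. \<Sum>k = 1..n. (\<epsilon> l \<omega> * \<epsilon> k \<omega>) * (u l \<omega> * u k \<omega>)))"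
    unfolding sq by (rule Bochner_Integration.integral_sum) (intro Bochner_Integration.integrable_sum I)
  also have "\<dots> = (\<Sum>l = 1..n. \<Sum>k = 1..n. expectation (\<lambda>\<omega>. (\<epsilon> l \<omega> * \<epsilon> k \<omega>) * (u l \<omega> * u k \<omega>)))"
    by (intro sum.cong refl Bochner_Integration.integral_sum I)
  also have "\<dots> = (\<Sum>l = 1..n. \<Sum>k = 1..n. if l = k then \<sigma>\<^sup>2 else 0)"
  proof (intro sum.cong refl)
    fix l k assume lk: "l \<in> {1..n}" "k \<in> {1..n}"
    have "expectation (\<lambda>\<omega>. (\<epsilon> l \<omega> * \<epsilon> k \<omega>) * (u l \<omega> * u k \<omega>)) =
        expectation (\<lambda>\<omega>. \<epsilon> l \<omega> * \<epsilon> k \<omega>) * expectation (\<lambda>\<omega>. u l \<omega> * u k \<omega>)"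
      by (rule indep_var_lebesgue_integral[OF cov[OF lk] int\<epsilon>[OF lk] intu[OF lk]])
    also have "\<dots> = (if l = k then \<sigma>\<^sup>2 else 0)" using E\<epsilon>[OF lk] Eu[OF lk(1)] by auto
    finally show "expectation (\<lambda>\<omega>. (\<epsilon> l \<omega> * \<epsilon> k \<omega>) * (u l \<omega> * u k \<omega>)) = (if l = k then \<sigma>\<^sup>2 else 0)" .
  qed
  also have "\<dots> = real n * \<sigma>\<^sup>2" by (simp add: sum.delta)
  finally show "expectation (\<lambda>\<omega>. (ip n (\<lambda>l. \<epsilon> l \<omega>) (\<lambda>l. u l \<omega>))\<^sup>2) = real n * \<sigma>\<^sup>2" .
qed

lemma (in prob_space) Markov_ge:
  assumes "integrable M f" "\<And>\<omega>. 0 \<le> (f \<omega> :: real)" "expectation f \<le> b" "0 < c"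
  shows "prob {\<omega> \<in> space M. c \<le> f \<omega>} \<le> b / c"
proof -
  have "prob {\<omega> \<in> space M. c \<le> f \<omega>} \<le> expectation f / c"
    using assms by (intro integral_Markov_inequality_measure[where A = "{}"]) auto
  also have "\<dots> \<le> b / c" using assms by (intro divide_right_mono) auto
  finally show ?thesis .
qed

text \<open>
  The rows of \<open>z\<close> are independent with identity second moment matrix and fourth moments bounded by
  \<open>C\<close> in all directions. Formulating this for the linear combinations of the columns is what the grid
  argument uses.
\<close>

locale white_sample = prob_space +
  fixes n m :: nat and z :: "nat \<Rightarrow> nat \<Rightarrow> 'a \<Rightarrow> real" and \<epsilon> :: "nat \<Rightarrow> 'a \<Rightarrow> real" and \<sigma> C :: real
  assumes C_pos: "0 < C"
    and rows_indep: "\<And>w. indep_vars (\<lambda>_. borel) (\<lambda>l \<omega>. lin_comb m (\<lambda>l i. z l i \<omega>) w l) {1..n}"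
    and int2: "\<And>w l. l \<in> {1..n} \<Longrightarrow> integrable M (\<lambda>\<omega>. (lin_comb m (\<lambda>l i. z l i \<omega>) w l)\<^sup>2)"
    and int4: "\<And>w l. l \<in> {1..n} \<Longrightarrow> integrable M (\<lambda>\<omega>. (lin_comb m (\<lambda>l i. z l i \<omega>) w l) ^ 4)"
    and m2: "\<And>w l. l \<in> {1..n} \<Longrightarrow> expectation (\<lambda>\<omega>. (lin_comb m (\<lambda>l i. z l i \<omega>) w l)\<^sup>2) = sq_norm m w"
    and m4: "\<And>w l. l \<in> {1..n} \<Longrightarrow> expectation (\<lambda>\<omega>. (lin_comb m (\<lambda>l i. z l i \<omega>) w l) ^ 4) \<le> C * (sq_norm m w)\<^sup>2"
    and noise_int: "\<And>i. i \<in> {1..m} \<Longrightarrow> integrable M (\<lambda>\<omega>. (ip n (\<lambda>l. \<epsilon> l \<omega>) (\<lambda>l. z l i \<omega>))\<^sup>2)"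
    and noise_exp: "\<And>i. i \<in> {1..m} \<Longrightarrow> expectation (\<lambda>\<omega>. (ip n (\<lambda>l. \<epsilon> l \<omega>) (\<lambda>l. z l i \<omega>))\<^sup>2) = real n * \<sigma>\<^sup>2"
begin

abbreviation Z :: "'a \<Rightarrow> nat \<Rightarrow> nat \<Rightarrow> real" where
  "Z \<omega> \<equiv> \<lambda>l i. z l i \<omega>"

lemma lin_comb_unit: "i \<in> {1..m} \<Longrightarrow> lin_comb m X (\<lambda>k. if k = i then 1 else 0) l = X l i"
  unfolding lin_comb_def by (subst sum.remove[of _ i]) auto

lemma sq_norm_unit: "i \<in> {1..m} \<Longrightarrow> sq_norm m (\<lambda>k. if k = i then 1 else 0) = 1"
  unfolding sq_norm_def by (subst sum.remove[of _ i]) auto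

lemma entry_int2: "l \<in> {1..n} \<Longrightarrow> i \<in> {1..m} \<Longrightarrow> integrable M (\<lambda>\<omega>. (z l i \<omega>)\<^sup>2)"
  using int2[of l "\<lambda>k. if k = i then 1 else 0"] by (simp add: lin_comb_unit)

lemma entry_m2: "l \<in> {1..n} \<Longrightarrow> i \<in> {1..m} \<Longrightarrow> expectation (\<lambda>\<omega>. (z l i \<omega>)\<^sup>2) = 1"
  using m2[of l "\<lambda>k. if k = i then 1 else 0"] by (simp add: lin_comb_unit sq_norm_unit)

lemma frobenius_tail:
  assumes "1 \<le> n" "1 \<le> m"
  shows "prob {\<omega> \<in> space M. (real n)\<^sup>2 * real m \<le> (\<Sum>l = 1..n. sq_norm m (Z \<omega> l))} \<le> 1 / real n"
proof -
  have I: "integrable M (\<lambda>\<omega>. \<Sum>l = 1..n. sq_norm m (Z \<omega> l))"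
    unfolding sq_norm_def by (intro Bochner_Integration.integrable_sum entry_int2)
  have "expectation (\<lambda>\<omega>. \<Sum>l = 1..n. sq_norm m (Z \<omega> l)) = (\<Sum>l = 1..n. expectation (\<lambda>\<omega>. \<Sum>i = 1..m. (z l i \<omega>)\<^sup>2))"
    unfolding sq_norm_def
    by (rule Bochner_Integration.integral_sum) (intro Bochner_Integration.integrable_sum entry_int2)
  also have "\<dots> = (\<Sum>l = 1..n. \<Sum>i = 1..m. expectation (\<lambda>\<omega>. (z l i \<omega>)\<^sup>2))"
    by (intro sum.cong refl Bochner_Integration.integral_sum entry_int2)
  also have "\<dots> = real n * real m" by (simp add: entry_m2)
  finally have E: "expectation (\<lambda>\<omega>. \<Sum>l = 1..n. sq_norm m (Z \<omega> l)) \<le> real n * real m" by simp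
  have "prob {\<omega> \<in> space M. (real n)\<^sup>2 * real m \<le> (\<Sum>l = 1..n. sq_norm m (Z \<omega> l))} \<le> real n * real m / ((real n)\<^sup>2 * real m)"
    using assms by (intro Markov_ge[OF I _ E]) (auto simp: sum_nonneg sq_norm_nonneg)
  also have "\<dots> = 1 / real n" using assms by (simp add: power2_eq_square)
  finally show ?thesis .
qed

lemma noise_tail:
  assumes "1 \<le> n" "1 \<le> m" "0 < L"
  shows "prob {\<omega> \<in> space M. L * (real n * real m) \<le> (\<Sum>i = 1..m. (ip n (\<lambda>l. \<epsilon> l \<omega>) (\<lambda>l. z l i \<omega>))\<^sup>2)} \<le> \<sigma>\<^sup>2 / L"
proof -
  have I: "integrable M (\<lambda>\<omega>. \<Sum>i = 1..m. (ip n (\<lambda>l. \<epsilon> l \<omega>) (\<lambda>l. z l i \<omega>))\<^sup>2)"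
    by (intro Bochner_Integration.integrable_sum noise_int)
  have E: "expectation (\<lambda>\<omega>. \<Sum>i = 1..m. (ip n (\<lambda>l. \<epsilon> l \<omega>) (\<lambda>l. z l i \<omega>))\<^sup>2) \<le> real m * (real n * \<sigma>\<^sup>2)"
    by (subst Bochner_Integration.integral_sum) (auto simp: noise_int noise_exp)
  have "prob {\<omega> \<in> space M. L * (real n * real m) \<le> (\<Sum>i = 1..m. (ip n (\<lambda>l. \<epsilon> l \<omega>) (\<lambda>l. z l i \<omega>))\<^sup>2)}
      \<le> real m * (real n * \<sigma>\<^sup>2) / (L * (real n * real m))"
    using assms by (intro Markov_ge[OF I _ E]) (auto simp: sum_nonneg)
  also have "\<dots> = \<sigma>\<^sup>2 / L" using assms by simp
  finally show ?thesis .
qed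

definition grid_bad :: "(nat \<Rightarrow> int) \<Rightarrow> 'a set" where
  "grid_bad g = {\<omega> \<in> space M. 0 < sq_norm m (\<lambda>i. real_of_int (g i)) \<and>
     ip_sq n (lin_comb m (Z \<omega>) (\<lambda>i. real_of_int (g i))) \<le>
     real n / 2 * sq_norm m (\<lambda>i. real_of_int (g i))}"

lemma borel_measurable_lin_comb:
  "l \<in> {1..n} \<Longrightarrow> (\<lambda>\<omega>. lin_comb m (Z \<omega>) w l) \<in> borel_measurable M"
  using rows_indep[of w] by (auto simp: indep_vars_def)

lemma grid_bad_sets: "grid_bad g \<in> events"
proof -
  have [measurable]: "(\<lambda>\<omega>. ip_sq n (lin_comb m (Z \<omega>) w)) \<in> borel_measurable M" for w
    unfolding ip_def by (intro borel_measurable_sum borel_measurable_times borel_measurable_lin_comb)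
  show ?thesis unfolding grid_bad_def by measurable
qed

lemma grid_bad_prob: "prob (grid_bad g) \<le> exp (- real n / (8 * C))"
proof (cases "0 < sq_norm m (\<lambda>i. real_of_int (g i))")
  case True
  define w where "w = (\<lambda>i. real_of_int (g i))"
  have "prob {\<omega> \<in> space M. (\<Sum>l\<in>{1..n}. (lin_comb m (Z \<omega>) w l)\<^sup>2) \<le> real (card {1..n}) * sq_norm m w / 2}
      \<le> exp (- real (card {1..n}) / (8 * C))"
    using True C_pos by (intro sum_of_squares_lower_tail rows_indep int2 int4 m2 m4) (auto simp: w_def)
  also have "{\<omega> \<in> space M. (\<Sum>l\<in>{1..n}. (lin_comb m (Z \<omega>) w l)\<^sup>2) \<le> real (card {1..n}) * sq_norm m w / 2} = grid_bad g"
    using True by (auto simp: grid_bad_def w_def ip_def power2_eq_square)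
  finally show ?thesis by simp
next
  case False
  then show ?thesis by (simp add: grid_bad_def)
qed

text \<open>
  The number of grid points is exponential in \<open>m * ln n\<close>, the probability for a single one
  exponentially small in \<open>n\<close>.
\<close>

lemma grid_union_prob:
  "prob (\<Union>g\<in>int_grid m (n\<^sup>2). grid_bad g) \<le> (2 * (real n)\<^sup>2 + 1) ^ m * exp (- real n / (8 * C))"
proof -
  have "prob (\<Union>g\<in>int_grid m (n\<^sup>2). grid_bad g) \<le> (\<Sum>g\<in>int_grid m (n\<^sup>2). prob (grid_bad g))"
    by (intro finite_measure_subadditive_finite finite_int_grid) (auto intro: grid_bad_sets)
  also have "\<dots> \<le> (\<Sum>g\<in>int_grid m (n\<^sup>2). exp (- real n / (8 * C)))"
    by (intro sum_mono grid_bad_prob)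
  also have "\<dots> = (2 * (real n)\<^sup>2 + 1) ^ m * exp (- real n / (8 * C))"
    by (simp add: card_int_grid add.commute)
  finally show ?thesis .
qed

text \<open>
  The exceptional set collects the failure of the Frobenius bound, of the lower bound at some grid
  point, and of the Markov bound for the noise.
\<close>

lemma frame_and_noise_event:
  assumes "64 \<le> n" "1 \<le> m" "m \<le> n" "0 < L"
  obtains B where "B \<in> events"
    and "prob B \<le> 1 / real n + (2 * (real n)\<^sup>2 + 1) ^ m * exp (- real n / (8 * C)) + \<sigma>\<^sup>2 / L"
    and "\<And>\<omega> w. \<omega> \<in> space M - B \<Longrightarrow> real n / 32 * sq_norm m w \<le> ip_sq n (lin_comb m (Z \<omega>) w)"
    and "\<And>\<omega> w. \<omega> \<in> space M - B \<Longrightarrow> (ip n (\<lambda>l. \<epsilon> l \<omega>) (lin_comb m (Z \<omega>) w))\<^sup>2 \<le>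
      32 * L * real m * ip_sq n (lin_comb m (Z \<omega>) w)"
proof -
  define B1 where "B1 = {\<omega> \<in> space M. (real n)\<^sup>2 * real m \<le> (\<Sum>l = 1..n. sq_norm m (Z \<omega> l))}"
  define B2 where "B2 = (\<Union>g\<in>int_grid m (n\<^sup>2). grid_bad g)"
  define B3 where "B3 = {\<omega> \<in> space M. L * (real n * real m) \<le> (\<Sum>i = 1..m. (ip n (\<lambda>l. \<epsilon> l \<omega>) (\<lambda>l. z l i \<omega>))\<^sup>2)}"
  have "integrable M (\<lambda>\<omega>. \<Sum>l = 1..n. sq_norm m (Z \<omega> l))"
    unfolding sq_norm_def by (intro Bochner_Integration.integrable_sum entry_int2)
  then have s1: "B1 \<in> events" unfolding B1_def by measurable
  have "integrable M (\<lambda>\<omega>. \<Sum>i = 1..m. (ip n (\<lambda>l. \<epsilon> l \<omega>) (\<lambda>l. z l i \<omega>))\<^sup>2)"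
    by (intro Bochner_Integration.integrable_sum noise_int)
  then have s3: "B3 \<in> events" unfolding B3_def by measurable
  have s2: "B2 \<in> events" unfolding B2_def using finite_int_grid grid_bad_sets by (intro sets.finite_UN) auto
  have frame: "real n / 32 * sq_norm m w \<le> ip_sq n (lin_comb m (Z \<omega>) w)"
    if w: "\<omega> \<in> space M - (B1 \<union> B2 \<union> B3)" for \<omega> w
  proof (rule lower_frame_bound_from_grid)
    show "(\<Sum>l = 1..n. sq_norm m (Z \<omega> l)) \<le> (real n)\<^sup>2 * real m" using w by (auto simp: B1_def)
    fix g assume "g \<in> int_grid m (n\<^sup>2)" "0 < sq_norm m (\<lambda>i. real_of_int (g i))"
    then show "real n / 2 * sq_norm m (\<lambda>i. real_of_int (g i)) \<le>
        ip_sq n (lin_comb m (Z \<omega>) (\<lambda>i. real_of_int (g i)))"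
      using w by (auto simp: B2_def grid_bad_def)
  qed (use assms in auto)
  show ?thesis
  proof (rule that[of "B1 \<union> B2 \<union> B3"])
    show "B1 \<union> B2 \<union> B3 \<in> events" using s1 s2 s3 by auto
    have "prob (B1 \<union> B2 \<union> B3) \<le> prob B1 + prob B2 + prob B3"
      using s1 s2 s3 measure_Un_le[of "B1 \<union> B2" M B3] measure_Un_le[of B1 M B2] by auto
    then show "prob (B1 \<union> B2 \<union> B3) \<le> 1 / real n + (2 * (real n)\<^sup>2 + 1) ^ m * exp (- real n / (8 * C)) + \<sigma>\<^sup>2 / L"
      using frobenius_tail noise_tail[of L] grid_union_prob assms
      unfolding B1_def B2_def B3_def by auto
    fix \<omega> w assume w: "\<omega> \<in> space M - (B1 \<union> B2 \<union> B3)"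
    show "real n / 32 * sq_norm m w \<le> ip_sq n (lin_comb m (Z \<omega>) w)"
      by (rule frame[OF w])
    have "(ip n (\<lambda>l. \<epsilon> l \<omega>) (lin_comb m (Z \<omega>) w))\<^sup>2 \<le>
        32 / real n * (\<Sum>i = 1..m. (ip n (\<lambda>l. \<epsilon> l \<omega>) (\<lambda>l. z l i \<omega>))\<^sup>2) * ip_sq n (lin_comb m (Z \<omega>) w)"
      using assms by (intro noise_bound_from_frame frame[OF w]) auto
    also have "\<dots> \<le> 32 / real n * (L * (real n * real m)) * ip_sq n (lin_comb m (Z \<omega>) w)"
      using w by (intro mult_right_mono mult_left_mono) (auto simp: B3_def ip_self_nonneg)
    also have "32 / real n * (L * (real n * real m)) = 32 * L * real m" using assms by simp
    finally show "(ip n (\<lambda>l. \<epsilon> l \<omega>) (lin_comb m (Z \<omega>) w))\<^sup>2 \<le>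
      32 * L * real m * ip_sq n (lin_comb m (Z \<omega>) w)" .
  qed
qed

end

section \<open>Quadratic forms and the smallest eigenvalue\<close>

abbreviation (input) qform :: "real mat \<Rightarrow> real vec \<Rightarrow> real vec \<Rightarrow> real" where
  "qform B u v \<equiv> scalar_prod u (mult_mat_vec B v)"

lemma qform_symmetric:
  assumes "B \<in> carrier_mat m m" "transpose_mat B = B" "u \<in> carrier_vec m" "v \<in> carrier_vec m"
  shows "qform B u v = qform B v u"
proof -
  have "scalar_prod (mult_mat_vec (transpose_mat B) u) v = scalar_prod u (mult_mat_vec B v)"
    by (rule transpose_vec_mult_scalar[OF assms(1) assms(4) assms(3)])
  then have "scalar_prod (mult_mat_vec B u) v = scalar_prod u (mult_mat_vec B v)"
    by (simp only: assms(2))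
  moreover have "scalar_prod (mult_mat_vec B u) v = scalar_prod v (mult_mat_vec B u)"
    using assms by (intro comm_scalar_prod[of _ m]) auto
  ultimately show ?thesis by simp
qed

text \<open>
  The quadratic polynomial \<open>s \<mapsto> qform B (u + s v) (u + s v)\<close> is nonnegative.
\<close>

lemma psd_Cauchy_Schwarz:
  assumes B: "B \<in> carrier_mat m m" "transpose_mat B = B"
    and psd: "\<And>v. v \<in> carrier_vec m \<Longrightarrow> 0 \<le> qform B v v"
    and uv: "u \<in> carrier_vec m" "v \<in> carrier_vec m"
  shows "(qform B u v)\<^sup>2 \<le> qform B u u * qform B v v"
proof -
  define a b c where "a = qform B u u" and "b = qform B u v" and "c = qform B v v"
  have quad: "0 \<le> a + 2 * s * b + s\<^sup>2 * c" for s
  proof -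
    have sv: "s \<cdot>\<^sub>v v \<in> carrier_vec m" using uv by simp
    have Bu: "mult_mat_vec B u \<in> carrier_vec m" "mult_mat_vec B v \<in> carrier_vec m" using B uv by auto
    have "qform B (u + s \<cdot>\<^sub>v v) (u + s \<cdot>\<^sub>v v) =
        scalar_prod (u + s \<cdot>\<^sub>v v) (mult_mat_vec B u + s \<cdot>\<^sub>v mult_mat_vec B v)"
      using B uv by (simp add: mult_add_distrib_mat_vec[OF B(1) uv(1) sv] mult_mat_vec[OF B(1) uv(2)])
    also have "\<dots> = a + s * b + (s * qform B v u + s * (s * c))"
      using Bu uv sv
      by (simp add: add_scalar_prod_distrib[of _ m] scalar_prod_add_distrib[of _ m] a_def b_def c_def)
    also have "qform B v u = b" unfolding b_def using B uv by (intro qform_symmetric)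
    finally show ?thesis using psd[of "u + s \<cdot>\<^sub>v v"] uv sv by (simp add: power2_eq_square algebra_simps)
  qed
  have c0: "0 \<le> c" unfolding c_def using psd uv by simp
  show ?thesis
  proof (cases "c = 0")
    case True
    have "b = 0"
    proof (rule ccontr)
      assume b: "b \<noteq> 0"
      (* at this parameter the polynomial, which is linear here, equals -1 *)
      show False using quad[of "- (a + 1) / (2 * b)"] b True by (simp add: field_simps)
    qed
    then show ?thesis using True by (simp add: a_def b_def c_def)
  next
    case False
    then have c: "0 < c" using c0 by simp
    have "0 \<le> c * (a + 2 * (- b / c) * b + (- b / c)\<^sup>2 * c)" by (intro mult_nonneg_nonneg quad less_imp_le[OF c])
    also have "\<dots> = a * c - b\<^sup>2" using c by (simp add: power2_eq_square field_simps)
    finally show ?thesis by (simp add: a_def b_def c_def)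
  qed
qed

lemma scalar_prod_self_pos:
  assumes "v \<in> carrier_vec m" "v \<noteq> 0\<^sub>v m"
  shows "0 < scalar_prod v (v :: real vec)"
proof -
  obtain i where i: "i < m" "vec_index v i \<noteq> 0" using assms by (auto simp: vec_eq_iff)
  have "0 < vec_index v i * vec_index v i" using i by (simp add: less_le)
  also have "\<dots> \<le> scalar_prod v v"
    unfolding scalar_prod_def using i assms by (intro member_le_sum) auto
  finally show ?thesis .
qed

lemma qform_upper:
  assumes C: "C \<in> carrier_mat m m"
  obtains K where "0 < K" "\<And>v. v \<in> carrier_vec m \<Longrightarrow> qform C v v \<le> K * scalar_prod v v"
proof -
  define K where "K = 1 + (\<Sum>i<m. \<Sum>j<m. \<bar>C $$ (i, j)\<bar>)"
  have K: "0 < K" unfolding K_def by (intro add_pos_nonneg sum_nonneg) auto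
  have "qform C v v \<le> K * scalar_prod v v" if v: "v \<in> carrier_vec m" for v
  proof -
    have comp: "vec_index v i * vec_index v j \<le> scalar_prod v v \<and> - (vec_index v i * vec_index v j) \<le> scalar_prod v v" if "i < m" "j < m" for i j
    proof -
      have "(vec_index v k)\<^sup>2 \<le> scalar_prod v v" if "k < m" for k
        unfolding scalar_prod_def power2_eq_square using that v by (intro member_le_sum) auto
      from this[OF that(1)] this[OF that(2)]
        zero_le_power2[of "vec_index v i - vec_index v j"] zero_le_power2[of "vec_index v i + vec_index v j"]
      show ?thesis by (simp add: power2_diff power2_sum)
    qed
    have "qform C v v = (\<Sum>i<m. \<Sum>j<m. C $$ (i, j) * (vec_index v i * vec_index v j))"
      using C v by (auto simp: scalar_prod_def mult_mat_vec_def atLeast0LessThan sum_distrib_left mult_ac intro!: sum.cong)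
    also have "\<dots> \<le> (\<Sum>i<m. \<Sum>j<m. \<bar>C $$ (i, j)\<bar> * scalar_prod v v)"
    proof (intro sum_mono)
      fix i j assume "i \<in> {..<m}" "j \<in> {..<m}"
      then have "\<bar>vec_index v i * vec_index v j\<bar> \<le> scalar_prod v v" using comp[of i j] by (auto simp: abs_le_iff)
      then have "\<bar>C $$ (i, j) * (vec_index v i * vec_index v j)\<bar> \<le> \<bar>C $$ (i, j)\<bar> * scalar_prod v v"
        unfolding abs_mult[of "C $$ (i, j)"] by (intro mult_left_mono) auto
      then show "C $$ (i, j) * (vec_index v i * vec_index v j) \<le> \<bar>C $$ (i, j)\<bar> * scalar_prod v v" by linarith
    qed
    also have "\<dots> \<le> K * scalar_prod v v"
      unfolding K_def by (simp add: distrib_right sum_distrib_right) (simp add: scalar_prod_def sum_nonneg)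
    finally show ?thesis .
  qed
  with K show ?thesis by (rule that)
qed

text \<open>
  With \<open>C\<close> the inverse of \<open>B\<close>, Cauchy--Schwarz for the form of \<open>B\<close> applied to \<open>v\<close> and \<open>C v\<close> bounds the
  squared length of \<open>v\<close> by a multiple of the form at \<open>v\<close>.
\<close>

lemma psd_invertible_coercive:
  assumes B: "B \<in> carrier_mat m m" "transpose_mat B = B"
    and psd: "\<And>v. v \<in> carrier_vec m \<Longrightarrow> 0 \<le> qform B v v"
    and det: "det B \<noteq> 0"
  obtains \<mu> where "0 < \<mu>" "\<And>v. v \<in> carrier_vec m \<Longrightarrow> \<mu> * scalar_prod v v \<le> qform B v v"
proof -
  obtain C where C: "C \<in> carrier_mat m m" and CB: "C * B = 1\<^sub>m m"
    using det_non_zero_imp_unit[OF B(1) det, of "()"] unfolding Units_def ring_mat_def by auto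
  have BC: "B * C = 1\<^sub>m m" by (rule mat_mult_left_right_inverse[OF C B(1) CB])
  obtain K where K: "0 < K" "\<And>v. v \<in> carrier_vec m \<Longrightarrow> qform C v v \<le> K * scalar_prod v v"
    using qform_upper[OF C] by blast
  have "1 / K * scalar_prod v v \<le> qform B v v" if v: "v \<in> carrier_vec m" for v
  proof (cases "v = 0\<^sub>v m")
    case True
    then show ?thesis using psd[OF v] by simp
  next
    case False
    have vv: "0 < scalar_prod v v" using v False by (rule scalar_prod_self_pos)
    define w where "w = mult_mat_vec C v"
    have w: "w \<in> carrier_vec m" unfolding w_def using C v by simp
    have Bw: "mult_mat_vec B w = v"
      unfolding w_def using assoc_mult_mat_vec[OF B(1) C v] BC v by simp
    have "(scalar_prod v v)\<^sup>2 = (qform B v w)\<^sup>2" by (simp add: Bw)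
    also have "\<dots> \<le> qform B v v * qform B w w"
      using B psd v w by (rule psd_Cauchy_Schwarz)
    also have "qform B w w = qform C v v"
      unfolding Bw using comm_scalar_prod[OF w v] by (simp add: w_def)
    also have "qform B v v * qform C v v \<le> qform B v v * (K * scalar_prod v v)"
      using K(2)[OF v] psd[OF v] by (intro mult_left_mono)
    finally have "scalar_prod v v * scalar_prod v v \<le> (K * qform B v v) * scalar_prod v v"
      by (simp add: power2_eq_square mult_ac)
    then have "scalar_prod v v \<le> K * qform B v v" using vv by simp
    then show ?thesis using K(1) by (simp add: field_simps)
  qed
  then show ?thesis using K(1) by (intro that[of "1 / K"]) auto
qed

text \<open>
  The infimum \<open>s\<close> of the Rayleigh quotients is an eigenvalue, for otherwise \<open>A - s\<close> would be
  positive semidefinite and invertible, hence coercive, and \<open>s\<close> could be increased. Attainment of the infimum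
  is thus obtained algebraically.
\<close>

lemma qform_ge_min_eigenvalue:
  assumes A: "A \<in> carrier_mat m m" "transpose_mat A = A" and m: "1 \<le> m"
    and psd: "\<And>v. v \<in> carrier_vec m \<Longrightarrow> 0 \<le> qform A v v"
    and v: "v \<in> carrier_vec m"
  shows "min_eigenvalue A * scalar_prod v v \<le> qform A v v"
proof -
  define R where "R = {qform A u u / scalar_prod u u | u. u \<in> carrier_vec m \<and> u \<noteq> 0\<^sub>v m}"
  define s where "s = Inf R"
  have bdd: "bdd_below R" unfolding R_def bdd_below_def
    by (intro exI[of _ 0]) (auto intro!: divide_nonneg_pos psd scalar_prod_self_pos)
  have "unit_vec m 0 \<in> carrier_vec m" "unit_vec m 0 \<noteq> (0\<^sub>v m :: real vec)"
    using m by (auto simp: vec_eq_iff unit_vec_def)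
  then have ne: "R \<noteq> {}" unfolding R_def by blast
  have sle: "s * scalar_prod u u \<le> qform A u u" if u: "u \<in> carrier_vec m" for u
  proof (cases "u = 0\<^sub>v m")
    case True
    then show ?thesis using psd[OF u] by simp
  next
    case False
    have "s \<le> qform A u u / scalar_prod u u"
      unfolding s_def using u False bdd by (intro cInf_lower) (auto simp: R_def)
    then show ?thesis using scalar_prod_self_pos[OF u False] by (simp add: field_simps)
  qed
  define B where "B = A - s \<cdot>\<^sub>m 1\<^sub>m m"
  have B: "B \<in> carrier_mat m m" "transpose_mat B = B"
    using A by (auto simp: B_def) (rule eq_matI; auto simp: transpose_mat_def mat_eq_iff)
  have Bu: "mult_mat_vec B u = mult_mat_vec A u - s \<cdot>\<^sub>v u" if u: "u \<in> carrier_vec m" for u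
    unfolding B_def using A u
    by (subst minus_mult_distrib_mat_vec[of _ m m]) (auto intro!: eq_vecI)
  have Bq: "qform B u u = qform A u u - s * scalar_prod u u" if u: "u \<in> carrier_vec m" for u
    unfolding Bu[OF u] using A u by (subst scalar_prod_minus_distrib[of _ m]) auto
  have "det B = 0"
  proof (rule ccontr)
    assume "det B \<noteq> 0"
    then obtain \<mu> where \<mu>: "0 < \<mu>" "\<And>u. u \<in> carrier_vec m \<Longrightarrow> \<mu> * scalar_prod u u \<le> qform B u u"
      using psd_invertible_coercive[OF B] Bq sle by (metis diff_ge_0_iff_ge)
    have "s + \<mu> \<le> s"
      unfolding s_def[symmetric]
    proof -
      have "s + \<mu> \<le> Inf R"
      proof (rule cInf_greatest[OF ne])
        fix r assume "r \<in> R"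
        then obtain u where u: "r = qform A u u / scalar_prod u u" "u \<in> carrier_vec m" "u \<noteq> 0\<^sub>v m"
          by (auto simp: R_def)
        have "(s + \<mu>) * scalar_prod u u \<le> qform A u u"
          using \<mu>(2)[OF u(2)] Bq[OF u(2)] by (simp add: algebra_simps)
        then show "s + \<mu> \<le> r" unfolding u(1) using scalar_prod_self_pos[OF u(2,3)] by (simp add: field_simps)
      qed
      then show "s + \<mu> \<le> s" by (simp add: s_def)
    qed
    then show False using \<mu> by simp
  qed
  then obtain u where u: "u \<in> carrier_vec m" "u \<noteq> 0\<^sub>v m" "mult_mat_vec B u = 0\<^sub>v m"
    using det_0_iff_vec_prod_zero_field[OF B(1)] by blast
  have "mult_mat_vec A u = s \<cdot>\<^sub>v u"
  proof (rule eq_vecI)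
    show "dim_vec (mult_mat_vec A u) = dim_vec (s \<cdot>\<^sub>v u)" using A u by simp
    fix i assume i: "i < dim_vec (s \<cdot>\<^sub>v u)"
    have "vec_index (mult_mat_vec A u - s \<cdot>\<^sub>v u) i = vec_index (0\<^sub>v m) i"
      using u Bu[OF u(1)] by simp
    then show "vec_index (mult_mat_vec A u) i = vec_index (s \<cdot>\<^sub>v u) i" using A u i by simp
  qed
  then have "s \<in> spectrum A"
    unfolding spectrum_def eigenvalue_def eigenvector_def using A u by auto
  then have "min_eigenvalue A \<le> s"
    unfolding min_eigenvalue_def using card_finite_spectrum[OF A(1)] by (intro Min_le) auto
  then have "min_eigenvalue A * scalar_prod v v \<le> s * scalar_prod v v"
    by (intro mult_right_mono) (auto simp: scalar_prod_def sum_nonneg)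
  then show ?thesis using sle[OF v] by linarith
qed

section \<open>Whitening the rows of a random design\<close>

text \<open>
  A linear combination of columns, seen as a function of a whole row, to which the assumptions on
  the law of the rows apply.
\<close>

definition row_dot :: "nat \<Rightarrow> (nat \<Rightarrow> real) \<Rightarrow> (nat \<Rightarrow> real) \<Rightarrow> real" where
  "row_dot m u y = (\<Sum>k = 1..m. y k * u k)"

lemma row_dot_measurable: "row_dot m u \<in> borel_measurable (PiM {1..m} (\<lambda>i. borel))"
  unfolding row_dot_def[abs_def] by measurable

lemma lin_comb_row_dot:
  "lin_comb m (design x n \<omega>) u l = row_dot m u (design_row x n l m \<omega>)"
  by (simp add: lin_comb_def row_dot_def design_def design_row_def)

lemma subvec_full: "subvec {1..m} y = vec m (\<lambda>r. y (Suc r))"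
proof -
  have "sorted_list_of_set {1..m} = [1..<Suc m]"
    by (metis atLeastLessThanSuc_atLeastAtMost sorted_list_of_set_range)
  then show ?thesis unfolding subvec_def by (intro eq_vecI) (auto simp: nth_upt simp del: upt_Suc)
qed

text \<open>
  Translates the index range \<open>1..m\<close> of the data into the index range \<open>0..<m\<close> of vectors.
\<close>

definition vec_of :: "nat \<Rightarrow> (nat \<Rightarrow> real) \<Rightarrow> real vec" where
  "vec_of m u = vec m (\<lambda>r. u (Suc r))"

lemma vec_of_carrier: "vec_of m u \<in> carrier_vec m"
  by (simp add: vec_of_def)

lemma sum_Suc_index: "(\<Sum>k = Suc 0..m. f k) = (\<Sum>r<m. f (Suc r))"
  using sum.atLeast1_atMost_eq[of f m] by simp

lemma scalar_prod_vec_of: "scalar_prod (vec_of m u) (vec_of m v) = (\<Sum>k = 1..m. u k * v k)"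
  by (simp add: scalar_prod_def vec_of_def sum_Suc_index atLeast0LessThan)

lemma sq_norm_vec_of: "scalar_prod (vec_of m u) (vec_of m u) = sq_norm m u"
  by (simp add: scalar_prod_vec_of sq_norm_def power2_eq_square)

definition mat_fun :: "nat \<Rightarrow> real mat \<Rightarrow> (nat \<Rightarrow> real) \<Rightarrow> nat \<Rightarrow> real" where
  "mat_fun m S u i = (\<Sum>k = 1..m. S $$ (i - 1, k - 1) * u k)"

lemma vec_of_mat_fun:
  assumes "S \<in> carrier_mat m m"
  shows "vec_of m (mat_fun m S u) = mult_mat_vec S (vec_of m u)"
  using assms
  by (intro eq_vecI) (auto simp: vec_of_def mat_fun_def sum_Suc_index scalar_prod_def atLeast0LessThan intro!: sum.cong)

lemma lin_comb_mat_fun: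
  assumes S: "S \<in> carrier_mat m m" "transpose_mat S = S"
  shows "lin_comb m (\<lambda>l i. mat_fun m S (X l) i) w l = lin_comb m X (mat_fun m S w) l"
proof -
  have sym: "S $$ (i - 1, k - 1) = S $$ (k - 1, i - 1)" if "i \<in> {1..m}" "k \<in> {1..m}" for i k
  proof -
    have "transpose_mat S $$ (i - 1, k - 1) = S $$ (k - 1, i - 1)"
      using S(1) that by (intro index_transpose_mat) auto
    then show ?thesis by (simp only: S(2))
  qed
  have "lin_comb m (\<lambda>l i. mat_fun m S (X l) i) w l = (\<Sum>i = 1..m. \<Sum>k = 1..m. S $$ (i - 1, k - 1) * X l k * w i)"
    by (simp add: lin_comb_def mat_fun_def sum_distrib_right)
  also have "\<dots> = (\<Sum>k = 1..m. \<Sum>i = 1..m. S $$ (i - 1, k - 1) * X l k * w i)" by (rule sum.swap)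
  also have "\<dots> = (\<Sum>k = 1..m. \<Sum>i = 1..m. X l k * (S $$ (k - 1, i - 1) * w i))"
  proof (intro sum.cong refl)
    fix k i assume "k \<in> {1..m}" "i \<in> {1..m}"
    then show "S $$ (i - 1, k - 1) * X l k * w i = X l k * (S $$ (k - 1, i - 1) * w i)"
      using sym[of i k] by (simp only: mult_ac)
  qed
  also have "\<dots> = lin_comb m X (mat_fun m S w) l"
    by (simp add: lin_comb_def mat_fun_def sum_distrib_left)
  finally show ?thesis .
qed

text \<open>
  The setting for a single sample size, with \<open>4 * h\<close> and \<open>K\<close> for the order and the bound in the moment
  assumption.
\<close>

locale design_sample =
  fixes P :: "nat \<Rightarrow> 'a measure" and M :: "nat \<Rightarrow> nat"
    and x :: "nat \<Rightarrow> nat \<Rightarrow> nat \<Rightarrow> 'a \<Rightarrow> real" and eps :: "nat \<Rightarrow> nat \<Rightarrow> 'a \<Rightarrow> real"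
    and \<sigma> :: real and n :: nat and S :: "real mat" and K \<kappa> :: real and h :: nat
  assumes setting: "random_design P M x eps \<sigma>" and n1: "1 \<le> n" and m1: "1 \<le> M n"
    and S: "is_inv_sqrt_mat (second_moment_row P x n {1..M n}) S"
    and K: "0 \<le> K" and h: "1 \<le> h"
    and moment: "\<And>d. d \<in> carrier_vec (M n) \<Longrightarrow> sqrt (scalar_prod d d) = 1 \<Longrightarrow>
      (\<integral>\<^sup>+\<omega>. ennreal (\<bar>scalar_prod d (mult_mat_vec S (subvec {1..M n} (design x n \<omega> 1)))\<bar> ^ (4 * h)) \<partial>P n) \<le> ennreal K"
    and \<kappa>: "0 < \<kappa>" "\<kappa> < min_eigenvalue (second_moment_row P x n {1..M n})"
begin

abbreviation m :: nat where "m \<equiv> M n"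

sublocale prob_space "P n"
  using setting n1 unfolding random_design_def by blast

definition A :: "real mat" where "A = second_moment_row P x n {1..m}"

lemma sigma_pos: "0 < \<sigma>" using setting by (simp add: random_design_def)

lemma rows_indep_vars: "indep_vars (\<lambda>l. PiM {1..m} (\<lambda>i. borel)) (\<lambda>l. design_row x n l m) {1..n}"
  using setting n1 unfolding random_design_def by blast

lemma row_measurable: "l \<in> {1..n} \<Longrightarrow> design_row x n l m \<in> measurable (P n) (PiM {1..m} (\<lambda>i. borel))"
  using rows_indep_vars by (auto simp: indep_vars_def)

lemma entry_measurable:
  assumes "l \<in> {1..n}" "i \<in> {1..m}"
  shows "(\<lambda>\<omega>. x n l i \<omega>) \<in> borel_measurable (P n)"
proof -
  have "(\<lambda>\<omega>. design_row x n l m \<omega> i) \<in> borel_measurable (P n)"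
    by (rule measurable_compose[OF row_measurable[OF assms(1)] measurable_component_singleton[OF assms(2)]])
  then show ?thesis using assms by (simp add: design_row_def)
qed

lemma entry_sq_integrable: "l \<in> {1..n} \<Longrightarrow> i \<in> {1..m} \<Longrightarrow> integrable (P n) (\<lambda>\<omega>. (x n l i \<omega>)\<^sup>2)"
  using setting n1 unfolding random_design_def by blast

lemma row_distr: "l \<in> {1..n} \<Longrightarrow>
    distr (P n) (PiM {1..m} (\<lambda>i. borel)) (design_row x n l m) = distr (P n) (PiM {1..m} (\<lambda>i. borel)) (design_row x n 1 m)"
  using setting n1 unfolding random_design_def by blast

lemma row_integral_eq:
  assumes l: "l \<in> {1..n}" and f: "f \<in> borel_measurable (PiM {1..m} (\<lambda>i. borel))"
  shows "expectation (\<lambda>\<omega>. f (design_row x n l m \<omega>)) = (expectation (\<lambda>\<omega>. f (design_row x n 1 m \<omega>)) :: real)"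
    and "integrable (P n) (\<lambda>\<omega>. f (design_row x n l m \<omega>)) = integrable (P n) (\<lambda>\<omega>. f (design_row x n 1 m \<omega>))"
proof -
  have 1: "1 \<in> {1..n}" using n1 by simp
  show "expectation (\<lambda>\<omega>. f (design_row x n l m \<omega>)) = expectation (\<lambda>\<omega>. f (design_row x n 1 m \<omega>))"
    using integral_distr[OF row_measurable[OF l] f] integral_distr[OF row_measurable[OF 1] f] row_distr[OF l] by simp
  show "integrable (P n) (\<lambda>\<omega>. f (design_row x n l m \<omega>)) = integrable (P n) (\<lambda>\<omega>. f (design_row x n 1 m \<omega>))"
    using integrable_distr_eq[OF row_measurable[OF l] f] integrable_distr_eq[OF row_measurable[OF 1] f] row_distr[OF l] by simp
qed

lemma entry_prod_integrable:
  assumes "l \<in> {1..n}" "k \<in> {1..n}" "i \<in> {1..m}" "j \<in> {1..m}"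
  shows "integrable (P n) (\<lambda>\<omega>. x n l i \<omega> * x n k j \<omega>)"
proof (rule Bochner_Integration.integrable_bound)
  show "integrable (P n) (\<lambda>\<omega>. (x n l i \<omega>)\<^sup>2 + (x n k j \<omega>)\<^sup>2)"
    using assms by (intro Bochner_Integration.integrable_add entry_sq_integrable)
  show "(\<lambda>\<omega>. x n l i \<omega> * x n k j \<omega>) \<in> borel_measurable (P n)"
    using assms by (intro borel_measurable_times entry_measurable)
  show "AE \<omega> in P n. norm (x n l i \<omega> * x n k j \<omega>) \<le> norm ((x n l i \<omega>)\<^sup>2 + (x n k j \<omega>)\<^sup>2)"
  proof (rule AE_I2)
    fix \<omega>
    have "\<bar>a * b\<bar> \<le> a\<^sup>2 + b\<^sup>2" for a b :: real
    proof -
      have "0 \<le> (\<bar>a\<bar> - \<bar>b\<bar>)\<^sup>2" by simp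
      then have "2 * (\<bar>a\<bar> * \<bar>b\<bar>) \<le> a\<^sup>2 + b\<^sup>2" by (simp add: power2_diff)
      moreover have "0 \<le> \<bar>a\<bar> * \<bar>b\<bar>" by simp
      ultimately show ?thesis unfolding abs_mult by linarith
    qed
    then show "norm (x n l i \<omega> * x n k j \<omega>) \<le> norm ((x n l i \<omega>)\<^sup>2 + (x n k j \<omega>)\<^sup>2)" by simp
  qed
qed

lemma A_carrier: "A \<in> carrier_mat m m"
  by (simp add: A_def second_moment_row_def second_moment_mat_def)

lemma A_entry: "r < m \<Longrightarrow> s < m \<Longrightarrow> A $$ (r, s) = expectation (\<lambda>\<omega>. x n 1 (Suc r) \<omega> * x n 1 (Suc s) \<omega>)"
  by (simp add: A_def second_moment_row_def second_moment_mat_def subvec_full design_def del: One_nat_def)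

lemma A_symmetric: "transpose_mat A = A"
  using A_carrier by (intro eq_matI) (auto simp: A_entry mult.commute simp del: One_nat_def)

lemma S_props: "S \<in> carrier_mat m m" "transpose_mat S = S" "A * (S * S) = 1\<^sub>m m" "(S * S) * A = 1\<^sub>m m"
proof -
  have 1: "S \<in> carrier_mat m m" "pos_def_mat S" "inverts_mat A (S * S)" "inverts_mat (S * S) A"
    using S A_carrier by (auto simp: is_inv_sqrt_mat_def A_def)
  then show "S \<in> carrier_mat m m" "transpose_mat S = S" by (auto simp: pos_def_mat_def)
  show "A * (S * S) = 1\<^sub>m m" "(S * S) * A = 1\<^sub>m m"
    using 1 A_carrier by (auto simp: inverts_mat_def)
qed

lemma SAS: "S * A * S = 1\<^sub>m m"
proof -
  have SA: "S * A \<in> carrier_mat m m" using S_props A_carrier by simp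
  (* S * A is a right inverse of the square matrix S, hence a left inverse *)
  have "S * (S * A) = 1\<^sub>m m"
    using S_props(4) assoc_mult_mat[OF S_props(1) S_props(1) A_carrier] by simp
  from mat_mult_left_right_inverse[OF S_props(1) SA this] show ?thesis by simp
qed

lemma row_dot_sq_expand: "(row_dot m u y)\<^sup>2 = (\<Sum>i = 1..m. \<Sum>j = 1..m. u i * u j * (y i * y j))"
  unfolding row_dot_def power2_eq_square sum_product by (intro sum.cong refl) (simp add: mult_ac)

lemma row_dot_sq_integrable: "integrable (P n) (\<lambda>\<omega>. (row_dot m u (design_row x n 1 m \<omega>))\<^sup>2)"
  unfolding row_dot_sq_expand using n1
  by (intro Bochner_Integration.integrable_sum integrable_mult_right)
     (auto simp: design_row_def intro!: entry_prod_integrable)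

lemma row_dot_sq_expectation:
  "expectation (\<lambda>\<omega>. (row_dot m u (design_row x n 1 m \<omega>))\<^sup>2) = qform A (vec_of m u) (vec_of m u)"
proof -
  have 1: "1 \<in> {1..n}" using n1 by simp
  have I: "integrable (P n) (\<lambda>\<omega>. u i * u j * (x n 1 i \<omega> * x n 1 j \<omega>))" if "i \<in> {1..m}" "j \<in> {1..m}" for i j
    by (intro integrable_mult_right entry_prod_integrable 1 that)
  have "expectation (\<lambda>\<omega>. (row_dot m u (design_row x n 1 m \<omega>))\<^sup>2) =
      expectation (\<lambda>\<omega>. \<Sum>i = 1..m. \<Sum>j = 1..m. u i * u j * (x n 1 i \<omega> * x n 1 j \<omega>))"
    unfolding row_dot_sq_expand by (intro Bochner_Integration.integral_cong refl sum.cong) (auto simp: design_row_def)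
  also have "\<dots> = (\<Sum>i = 1..m. expectation (\<lambda>\<omega>. \<Sum>j = 1..m. u i * u j * (x n 1 i \<omega> * x n 1 j \<omega>)))"
    by (rule Bochner_Integration.integral_sum) (intro Bochner_Integration.integrable_sum I)
  also have "\<dots> = (\<Sum>i = 1..m. \<Sum>j = 1..m. expectation (\<lambda>\<omega>. u i * u j * (x n 1 i \<omega> * x n 1 j \<omega>)))"
    by (intro sum.cong refl Bochner_Integration.integral_sum I)
  also have "\<dots> = (\<Sum>i = 1..m. \<Sum>j = 1..m. u i * (A $$ (i - 1, j - 1) * u j))"
    by (intro sum.cong refl) (auto simp: A_entry mult_ac)
  also have "\<dots> = (\<Sum>i = 1..m. u i * mat_fun m A u i)"
    by (simp add: mat_fun_def sum_distrib_left)
  also have "\<dots> = qform A (vec_of m u) (vec_of m u)"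
    unfolding vec_of_mat_fun[OF A_carrier, symmetric] scalar_prod_vec_of ..
  finally show ?thesis .
qed

lemma A_psd: "v \<in> carrier_vec m \<Longrightarrow> 0 \<le> qform A v v"
proof -
  assume v: "v \<in> carrier_vec m"
  have "v = vec_of m (\<lambda>k. vec_index v (k - 1))" using v by (intro eq_vecI) (auto simp: vec_of_def)
  moreover have "0 \<le> expectation (\<lambda>\<omega>. (row_dot m (\<lambda>k. vec_index v (k - 1)) (design_row x n 1 m \<omega>))\<^sup>2)"
    by (rule Bochner_Integration.integral_nonneg) simp
  ultimately show ?thesis
    using row_dot_sq_expectation[of "\<lambda>k. vec_index v (k - 1)"] by (simp only:)
qed

text \<open>
  The whitened design.
\<close>

definition z :: "nat \<Rightarrow> nat \<Rightarrow> 'a \<Rightarrow> real" where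
  "z l i \<omega> = mat_fun m S (design x n \<omega> l) i"

lemma lin_comb_z: "lin_comb m (\<lambda>l i. z l i \<omega>) w l = lin_comb m (design x n \<omega>) (mat_fun m S w) l"
  unfolding z_def by (rule lin_comb_mat_fun[OF S_props(1,2)])

lemma whitened_second_moment:
  "qform A (vec_of m (mat_fun m S w)) (vec_of m (mat_fun m S w)) = sq_norm m w"
proof -
  let ?w = "vec_of m w"
  have Sw: "mult_mat_vec S ?w \<in> carrier_vec m" using S_props vec_of_carrier by simp
  have ASw: "mult_mat_vec A (mult_mat_vec S ?w) \<in> carrier_vec m" using A_carrier Sw by simp
  have "qform A (mult_mat_vec S ?w) (mult_mat_vec S ?w) = scalar_prod (mult_mat_vec (transpose_mat S) ?w) (mult_mat_vec A (mult_mat_vec S ?w))"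
    by (simp only: S_props(2))
  also have "\<dots> = scalar_prod ?w (mult_mat_vec S (mult_mat_vec A (mult_mat_vec S ?w)))"
    by (rule transpose_vec_mult_scalar[OF S_props(1) ASw vec_of_carrier])
  also have "mult_mat_vec S (mult_mat_vec A (mult_mat_vec S ?w)) = mult_mat_vec (S * A * S) ?w"
    using S_props(1) A_carrier vec_of_carrier[of m w] Sw by (simp add: assoc_mult_mat_vec[of _ m m _ m])
  also have "\<dots> = ?w" unfolding SAS using vec_of_carrier[of m w] by simp
  finally show ?thesis by (simp add: vec_of_mat_fun[OF S_props(1)] sq_norm_vec_of)
qed

text \<open>
  The coefficients \<open>w\<close> are \<open>S A v\<close>, the preimage of \<open>v\<close> under \<open>S\<close>. Their squared length is the second
  moment of the linear combination with coefficients \<open>v\<close>, which the smallest eigenvalue bounds.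
\<close>

lemma unwhiten:
  obtains w where "\<And>X l. lin_comb m X (mat_fun m S w) l = lin_comb m X v l" "\<kappa> * sq_norm m v \<le> sq_norm m w"
proof -
  have SA: "S * A \<in> carrier_mat m m" using S_props A_carrier by simp
  define w where "w = mat_fun m (S * A) v"
  have "vec_of m (mat_fun m S w) = mult_mat_vec (S * (S * A)) (vec_of m v)"
    unfolding w_def vec_of_mat_fun[OF S_props(1)] vec_of_mat_fun[OF SA]
    using assoc_mult_mat_vec[OF S_props(1) SA vec_of_carrier] by simp
  also have "S * (S * A) = 1\<^sub>m m"
    using S_props(4) assoc_mult_mat[OF S_props(1) S_props(1) A_carrier] by simp
  finally have eq: "vec_of m (mat_fun m S w) = vec_of m v" using vec_of_carrier[of m v] by simp
  have comp: "mat_fun m S w k = v k" if "k \<in> {1..m}" for k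
  proof -
    have "vec_index (vec_of m (mat_fun m S w)) (k - 1) = vec_index (vec_of m v) (k - 1)" by (simp only: eq)
    moreover have "Suc (k - 1) = k" "k - 1 < m" using that by auto
    ultimately show ?thesis by (simp add: vec_of_def del: One_nat_def)
  qed
  have "\<kappa> * scalar_prod (vec_of m v) (vec_of m v) \<le> min_eigenvalue A * scalar_prod (vec_of m v) (vec_of m v)"
    using \<kappa> by (intro mult_right_mono) (auto simp: A_def sq_norm_vec_of sq_norm_nonneg)
  also have "\<dots> \<le> qform A (vec_of m v) (vec_of m v)"
    by (rule qform_ge_min_eigenvalue[OF A_carrier A_symmetric m1 A_psd vec_of_carrier])
  also have "\<dots> = sq_norm m w" using whitened_second_moment[of w] unfolding eq .
  finally have "\<kappa> * sq_norm m v \<le> sq_norm m w" by (simp add: sq_norm_vec_of)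
  moreover have "lin_comb m X (mat_fun m S w) l = lin_comb m X v l" for X l
    unfolding lin_comb_def by (intro sum.cong refl) (simp add: comp)
  ultimately show ?thesis using that by blast
qed

end

section \<open>Moments of the whitened rows and of the noise\<close>

context design_sample
begin

abbreviation row :: "nat \<Rightarrow> 'a \<Rightarrow> nat \<Rightarrow> real" where "row l \<equiv> design_row x n l m"

lemma one_mem: "1 \<in> {1..n}" using n1 by simp

lemma z_row_dot: "lin_comb m (\<lambda>l i. z l i \<omega>) w l = row_dot m (mat_fun m S w) (row l \<omega>)"
  by (simp only: lin_comb_z lin_comb_row_dot)

text \<open>
  The fourth moment is dominated by the moment of order \<open>4 * h\<close>, as \<open>s \<le> 1 + s ^ h\<close> for
  \<open>s \<ge> 0\<close>.
\<close>

lemma whitened_moment_unit: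
  assumes "sq_norm m w = 1"
  shows "integrable (P n) (\<lambda>\<omega>. (row_dot m (mat_fun m S w) (row 1 \<omega>)) ^ 4)"
    and "expectation (\<lambda>\<omega>. (row_dot m (mat_fun m S w) (row 1 \<omega>)) ^ 4) \<le> 1 + K"
proof -
  let ?f = "\<lambda>\<omega>. row_dot m (mat_fun m S w) (row 1 \<omega>)"
  have meas: "?f \<in> borel_measurable (P n)"
    by (rule measurable_compose[OF row_measurable[OF one_mem] row_dot_measurable])
  have proj: "scalar_prod (vec_of m w) (mult_mat_vec S (subvec {1..m} (design x n \<omega> 1))) = ?f \<omega>" for \<omega>
  proof -
    have "subvec {1..m} (design x n \<omega> 1) = vec_of m (design x n \<omega> 1)"
      unfolding subvec_full vec_of_def ..
    then have "scalar_prod (vec_of m w) (mult_mat_vec S (subvec {1..m} (design x n \<omega> 1))) =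
        (\<Sum>k = 1..m. w k * z 1 k \<omega>)"
      unfolding z_def by (simp only: vec_of_mat_fun[OF S_props(1), symmetric] scalar_prod_vec_of)
    also have "\<dots> = lin_comb m (\<lambda>l i. z l i \<omega>) w 1" by (simp add: lin_comb_def mult.commute)
    finally show ?thesis by (simp only: z_row_dot)
  qed
  have "(\<integral>\<^sup>+\<omega>. ennreal (\<bar>?f \<omega>\<bar> ^ (4 * h)) \<partial>P n) \<le> ennreal K"
    using moment[of "vec_of m w"] vec_of_carrier[of m w] assms unfolding proj by (simp only: sq_norm_vec_of real_sqrt_one)
  have pw: "(?f \<omega>) ^ 4 \<le> 1 + \<bar>?f \<omega>\<bar> ^ (4 * h)" for \<omega>
  proof -
    define s where "s = (?f \<omega>) ^ 4"
    have s: "0 \<le> s" by (simp add: s_def)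
    have "s \<le> 1 + s ^ h"
    proof (cases "s \<le> 1")
      case True
      then show ?thesis using s by (simp add: add_increasing2)
    next
      case False
      then have "s ^ 1 \<le> s ^ h" using h by (intro power_increasing) auto
      then show ?thesis by simp
    qed
    also have "s ^ h = \<bar>?f \<omega>\<bar> ^ (4 * h)" by (simp add: s_def power_mult power_even_abs)
    finally show ?thesis by (simp add: s_def)
  qed
  have "(\<integral>\<^sup>+\<omega>. ennreal ((?f \<omega>) ^ 4) \<partial>P n) \<le> (\<integral>\<^sup>+\<omega>. 1 + ennreal (\<bar>?f \<omega>\<bar> ^ (4 * h)) \<partial>P n)"
  proof (rule nn_integral_mono)
    fix \<omega>
    have "ennreal ((?f \<omega>) ^ 4) \<le> ennreal (1 + \<bar>?f \<omega>\<bar> ^ (4 * h))" using pw by (rule ennreal_leI)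
    also have "\<dots> = 1 + ennreal (\<bar>?f \<omega>\<bar> ^ (4 * h))" by (subst ennreal_plus) auto
    finally show "ennreal ((?f \<omega>) ^ 4) \<le> 1 + ennreal (\<bar>?f \<omega>\<bar> ^ (4 * h))" .
  qed
  also have "\<dots> = 1 + (\<integral>\<^sup>+\<omega>. ennreal (\<bar>?f \<omega>\<bar> ^ (4 * h)) \<partial>P n)"
    using meas by (subst nn_integral_add) (auto simp: emeasure_space_1)
  also have "\<dots> \<le> 1 + ennreal K"
    by (intro add_left_mono) fact
  also have "\<dots> = ennreal (1 + K)" using K by (simp add: ennreal_plus flip: ennreal_1)
  finally have nn: "(\<integral>\<^sup>+\<omega>. ennreal ((?f \<omega>) ^ 4) \<partial>P n) \<le> ennreal (1 + K)" .
  show int: "integrable (P n) (\<lambda>\<omega>. (?f \<omega>) ^ 4)"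
  proof (rule integrableI_nonneg)
    show "(\<lambda>\<omega>. (?f \<omega>) ^ 4) \<in> borel_measurable (P n)" using meas by (rule borel_measurable_power)
    show "(\<integral>\<^sup>+\<omega>. ennreal ((?f \<omega>) ^ 4) \<partial>P n) < \<infinity>" using nn by (rule order_le_less_trans) simp
  qed simp
  have "ennreal (expectation (\<lambda>\<omega>. (?f \<omega>) ^ 4)) \<le> ennreal (1 + K)"
    using nn_integral_eq_integral[OF int] nn by simp
  then show "expectation (\<lambda>\<omega>. (?f \<omega>) ^ 4) \<le> 1 + K"
    by (rule iffD1[OF ennreal_le_iff, rotated]) (use K in simp)
qed

lemma row_dot_scale: "row_dot m (mat_fun m S (\<lambda>i. c * w i)) y = c * row_dot m (mat_fun m S w) y"
  by (simp add: row_dot_def mat_fun_def sum_distrib_left mult_ac)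

lemma whitened_moment:
  shows "integrable (P n) (\<lambda>\<omega>. (row_dot m (mat_fun m S w) (row 1 \<omega>)) ^ 4)"
    and "expectation (\<lambda>\<omega>. (row_dot m (mat_fun m S w) (row 1 \<omega>)) ^ 4) \<le> (1 + K) * (sq_norm m w)\<^sup>2"
proof -
  have "integrable (P n) (\<lambda>\<omega>. (row_dot m (mat_fun m S w) (row 1 \<omega>)) ^ 4) \<and>
    expectation (\<lambda>\<omega>. (row_dot m (mat_fun m S w) (row 1 \<omega>)) ^ 4) \<le> (1 + K) * (sq_norm m w)\<^sup>2"
  proof (cases "sq_norm m w = 0")
    case True
    then have "w i = 0" if "i \<in> {1..m}" for i
      using that by (auto simp: sq_norm_def sum_nonneg_eq_0_iff)
    then have "mat_fun m S w i = 0" for i unfolding mat_fun_def by (intro sum.neutral) auto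
    then have "row_dot m (mat_fun m S w) y = 0" for y by (simp add: row_dot_def)
    then show ?thesis using True by simp
  next
    case False
    define r where "r = sqrt (sq_norm m w)"
    have r: "r \<noteq> 0" "r\<^sup>2 = sq_norm m w" using False by (auto simp: r_def sq_norm_nonneg)
    define u where "u = (\<lambda>i. 1 / r * w i)"
    have u1: "sq_norm m u = 1" unfolding u_def sq_norm_scale using r False by (simp add: power_divide)
    have w: "w = (\<lambda>i. r * u i)" using r by (auto simp: u_def)
    have eq: "(row_dot m (mat_fun m S w) y) ^ 4 = r ^ 4 * (row_dot m (mat_fun m S u) y) ^ 4" for y
      by (subst w) (simp only: row_dot_scale power_mult_distrib)
    have r4: "r ^ 4 = (sq_norm m w)\<^sup>2" using power_mult[of r 2 2] by (simp add: r(2))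
    note wm = whitened_moment_unit[OF u1]
    have "integrable (P n) (\<lambda>\<omega>. r ^ 4 * (row_dot m (mat_fun m S u) (row 1 \<omega>)) ^ 4)"
      using wm(1) by (rule integrable_mult_right)
    moreover have "expectation (\<lambda>\<omega>. r ^ 4 * (row_dot m (mat_fun m S u) (row 1 \<omega>)) ^ 4) \<le> (1 + K) * r ^ 4"
      using mult_left_mono[OF wm(2), of "r ^ 4"] by (simp add: mult.commute)
    ultimately show ?thesis unfolding eq r4 by blast
  qed
  then show "integrable (P n) (\<lambda>\<omega>. (row_dot m (mat_fun m S w) (row 1 \<omega>)) ^ 4)"
    and "expectation (\<lambda>\<omega>. (row_dot m (mat_fun m S w) (row 1 \<omega>)) ^ 4) \<le> (1 + K) * (sq_norm m w)\<^sup>2"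
    by blast+
qed

lemma eps_distributed: "l \<in> {1..n} \<Longrightarrow> distributed (P n) lborel (eps n l) (\<lambda>y. ennreal (normal_density 0 \<sigma> y))"
  using setting n1 unfolding random_design_def by blast

lemma eps_indep: "indep_vars (\<lambda>l. borel) (eps n) {1..n}"
  using setting n1 unfolding random_design_def by blast

lemma eps_measurable: "l \<in> {1..n} \<Longrightarrow> eps n l \<in> borel_measurable (P n)"
  using distributed_measurable[OF eps_distributed] by simp

lemma eps_even_moment:
  assumes "l \<in> {1..n}"
  shows "integrable (P n) (\<lambda>\<omega>. (eps n l \<omega>) ^ (2 * k))"
    and "expectation (\<lambda>\<omega>. (eps n l \<omega>) ^ (2 * k)) = fact (2 * k) / ((2 / \<sigma>\<^sup>2) ^ k * fact k)"
proof -
  have 1: "has_bochner_integral lborel (\<lambda>y. normal_density 0 \<sigma> y * y ^ (2 * k)) (fact (2 * k) / ((2 / \<sigma>\<^sup>2) ^ k * fact k))"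
    using normal_moment_even[OF sigma_pos, of 0 k] by simp
  have "integrable lborel (\<lambda>y. normal_density 0 \<sigma> y * y ^ (2 * k)) \<longleftrightarrow> integrable (P n) (\<lambda>\<omega>. (eps n l \<omega>) ^ (2 * k))"
    using assms by (intro distributed_integrable[OF eps_distributed]) auto
  then show "integrable (P n) (\<lambda>\<omega>. (eps n l \<omega>) ^ (2 * k))"
    using 1 by (auto simp: has_bochner_integral_iff)
  have "(\<integral>y. normal_density 0 \<sigma> y * y ^ (2 * k) \<partial>lborel) = expectation (\<lambda>\<omega>. (eps n l \<omega>) ^ (2 * k))"
    using assms by (intro distributed_integral[OF eps_distributed]) auto
  then show "expectation (\<lambda>\<omega>. (eps n l \<omega>) ^ (2 * k)) = fact (2 * k) / ((2 / \<sigma>\<^sup>2) ^ k * fact k)"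
    using 1 by (simp add: has_bochner_integral_iff)
qed

lemma eps_second_moment:
  assumes "l \<in> {1..n}"
  shows "integrable (P n) (\<lambda>\<omega>. (eps n l \<omega>)\<^sup>2)" "expectation (\<lambda>\<omega>. (eps n l \<omega>)\<^sup>2) = \<sigma>\<^sup>2"
  using eps_even_moment[OF assms, of 1] by (simp_all add: fact_numeral)

lemma eps_fourth_moment:
  assumes "l \<in> {1..n}"
  shows "integrable (P n) (\<lambda>\<omega>. (eps n l \<omega>) ^ 4)" "expectation (\<lambda>\<omega>. (eps n l \<omega>) ^ 4) = 3 * (\<sigma>\<^sup>2)\<^sup>2"
  using eps_even_moment[OF assms, of 2] by (simp_all add: fact_numeral power_divide)

lemma eps_mean:
  assumes "l \<in> {1..n}"
  shows "integrable (P n) (eps n l)" "expectation (eps n l) = 0"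
proof -
  have 1: "has_bochner_integral lborel (\<lambda>y. normal_density 0 \<sigma> y * y) 0"
    using normal_moment_odd[OF sigma_pos, of 0 0] by simp
  have "integrable lborel (\<lambda>y. normal_density 0 \<sigma> y * y) \<longleftrightarrow> integrable (P n) (\<lambda>\<omega>. eps n l \<omega>)"
    using assms by (intro distributed_integrable[OF eps_distributed]) auto
  then show "integrable (P n) (eps n l)" using 1 by (auto simp: has_bochner_integral_iff)
  have "(\<integral>y. normal_density 0 \<sigma> y * y \<partial>lborel) = expectation (\<lambda>\<omega>. eps n l \<omega>)"
    using assms by (intro distributed_integral[OF eps_distributed]) auto
  then show "expectation (eps n l) = 0" using 1 by (simp add: has_bochner_integral_iff)
qed

lemma eps_covariance:
  assumes lk: "l \<in> {1..n}" "k \<in> {1..n}"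
  shows "integrable (P n) (\<lambda>\<omega>. eps n l \<omega> * eps n k \<omega>)"
    and "expectation (\<lambda>\<omega>. eps n l \<omega> * eps n k \<omega>) = (if l = k then \<sigma>\<^sup>2 else 0)"
proof -
  have "integrable (P n) (\<lambda>\<omega>. eps n l \<omega> * eps n k \<omega>) \<and>
    expectation (\<lambda>\<omega>. eps n l \<omega> * eps n k \<omega>) = (if l = k then \<sigma>\<^sup>2 else 0)"
  proof (cases "l = k")
    case True
    then show ?thesis using eps_second_moment[OF lk(1)] by (simp add: power2_eq_square)
  next
    case False
    have ind: "indep_vars (\<lambda>_. borel) (eps n) {l, k}"
      by (rule indep_vars_subset[OF eps_indep]) (use lk in auto)
    have "integrable (P n) (\<lambda>\<omega>. \<Prod>i\<in>{l, k}. eps n i \<omega>)"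
      by (rule indep_vars_integrable[OF _ ind]) (use lk eps_mean in auto)
    moreover have "expectation (\<lambda>\<omega>. \<Prod>i\<in>{l, k}. eps n i \<omega>) = (\<Prod>i\<in>{l, k}. expectation (eps n i))"
      by (rule indep_vars_lebesgue_integral[OF _ ind]) (use lk eps_mean in auto)
    ultimately show ?thesis using False eps_mean[OF lk(1)] by simp
  qed
  then show "integrable (P n) (\<lambda>\<omega>. eps n l \<omega> * eps n k \<omega>)"
    and "expectation (\<lambda>\<omega>. eps n l \<omega> * eps n k \<omega>) = (if l = k then \<sigma>\<^sup>2 else 0)" by blast+
qed

text \<open>
  Both products are functions of the two independent arrays.
\<close>

lemma noise_design_indep:
  assumes lk: "l \<in> {1..n}" "k \<in> {1..n}"
  shows "indep_var borel (\<lambda>\<omega>. eps n l \<omega> * eps n k \<omega>) borel (\<lambda>\<omega>. z l i \<omega> * z k i \<omega>)"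
proof -
  let ?V = "\<lambda>\<omega>. \<lambda>l\<in>{1..n}. eps n l \<omega>"
  let ?W = "\<lambda>\<omega>. \<lambda>(l, i)\<in>{1..n} \<times> {1..m}. x n l i \<omega>"
  let ?f = "\<lambda>v :: nat \<Rightarrow> real. v l * v k"
  let ?g = "\<lambda>W :: nat \<times> nat \<Rightarrow> real. mat_fun m S (\<lambda>j. W (l, j)) i * mat_fun m S (\<lambda>j. W (k, j)) i"
  have ind: "indep_rv (P n) (PiM {1..n} (\<lambda>l. borel)) ?V (PiM ({1..n} \<times> {1..m}) (\<lambda>_. borel)) ?W"
    using setting n1 unfolding random_design_def by blast
  have f: "?f \<in> borel_measurable (PiM {1..n} (\<lambda>l. borel))"
    using lk by (intro borel_measurable_times measurable_component_singleton)
  have g: "?g \<in> borel_measurable (PiM ({1..n} \<times> {1..m}) (\<lambda>_. borel))"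
    unfolding mat_fun_def using lk
    by (intro borel_measurable_times borel_measurable_sum borel_measurable_const measurable_component_singleton) auto
  have "indep_var borel (\<lambda>\<omega>. ?f (?V \<omega>)) borel (\<lambda>\<omega>. ?g (?W \<omega>))"
    by (rule indep_rv_compose[OF prob_space_axioms ind f g])
  moreover have "?f (?V \<omega>) = eps n l \<omega> * eps n k \<omega>" for \<omega> using lk by simp
  moreover have "?g (?W \<omega>) = z l i \<omega> * z k i \<omega>" for \<omega>
    unfolding z_def mat_fun_def design_def using lk by (intro arg_cong2[where f = "(*)"] sum.cong) auto
  ultimately show ?thesis by (simp only:)
qed

lemma z_sq_integrable:
  assumes "l \<in> {1..n}" "k \<in> {1..n}"
  shows "integrable (P n) (\<lambda>\<omega>. z l i \<omega> * z k i \<omega>)"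
proof -
  have "z l i \<omega> * z k i \<omega> = (\<Sum>r = 1..m. \<Sum>s = 1..m. (S $$ (i - 1, r - 1) * S $$ (i - 1, s - 1)) * (x n l r \<omega> * x n k s \<omega>))" for \<omega>
    unfolding z_def mat_fun_def design_def sum_product by (intro sum.cong refl) (simp only: mult_ac)
  then show ?thesis
    using assms by (simp only:) (intro Bochner_Integration.integrable_sum integrable_mult_right entry_prod_integrable)
qed

lemma row_dot_sq_measurable: "(\<lambda>y. (row_dot m u y) ^ p) \<in> borel_measurable (PiM {1..m} (\<lambda>i. borel))"
  by (intro borel_measurable_power row_dot_measurable)

lemma whitened_sq:
  assumes "l \<in> {1..n}"
  shows "integrable (P n) (\<lambda>\<omega>. (lin_comb m (\<lambda>l i. z l i \<omega>) w l)\<^sup>2)"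
    and "expectation (\<lambda>\<omega>. (lin_comb m (\<lambda>l i. z l i \<omega>) w l)\<^sup>2) = sq_norm m w"
  unfolding z_row_dot row_integral_eq[OF assms row_dot_sq_measurable]
  using row_dot_sq_integrable row_dot_sq_expectation whitened_second_moment by (simp_all only:)

sublocale white_sample "P n" n m z "eps n" \<sigma> "1 + K"
proof
  show "0 < 1 + K" using K by simp
  show "indep_vars (\<lambda>_. borel) (\<lambda>l \<omega>. lin_comb m (\<lambda>l i. z l i \<omega>) w l) {1..n}" for w
    unfolding z_row_dot by (rule indep_vars_compose2[OF rows_indep_vars row_dot_measurable])
  fix w l assume l: "l \<in> {1..n}"
  show "integrable (P n) (\<lambda>\<omega>. (lin_comb m (\<lambda>l i. z l i \<omega>) w l)\<^sup>2)"
    and "expectation (\<lambda>\<omega>. (lin_comb m (\<lambda>l i. z l i \<omega>) w l)\<^sup>2) = sq_norm m w"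
    by (rule whitened_sq[OF l])+
  show "integrable (P n) (\<lambda>\<omega>. (lin_comb m (\<lambda>l i. z l i \<omega>) w l) ^ 4)"
    and "expectation (\<lambda>\<omega>. (lin_comb m (\<lambda>l i. z l i \<omega>) w l) ^ 4) \<le> (1 + K) * (sq_norm m w)\<^sup>2"
    unfolding z_row_dot row_integral_eq[OF l row_dot_sq_measurable] by (rule whitened_moment)+
next
  fix i assume i: "i \<in> {1..m}"
  let ?e = "\<lambda>k. if k = i then 1 else 0 :: real"
  have zi: "lin_comb m (\<lambda>l i. z l i \<omega>) ?e l = z l i \<omega>" for l \<omega>
    unfolding lin_comb_def using i by (subst sum.remove[of _ i]) auto
  have ei: "sq_norm m ?e = 1" unfolding sq_norm_def using i by (subst sum.remove[of _ i]) auto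
  have Ez: "expectation (\<lambda>\<omega>. z l i \<omega> * z l i \<omega>) = 1" if "l \<in> {1..n}" for l
    using whitened_sq(2)[OF that, of ?e] unfolding zi ei by (simp add: power2_eq_square)
  note sm = second_moment_of_weighted_noise[of n "eps n" "\<lambda>l. z l i", OF noise_design_indep eps_covariance(1) z_sq_integrable eps_covariance(2) Ez]
  show "integrable (P n) (\<lambda>\<omega>. (ip n (\<lambda>l. eps n l \<omega>) (\<lambda>l. z l i \<omega>))\<^sup>2)"
    by (rule sm(1))
  show "expectation (\<lambda>\<omega>. (ip n (\<lambda>l. eps n l \<omega>) (\<lambda>l. z l i \<omega>))\<^sup>2) = real n * \<sigma>\<^sup>2"
    by (rule sm(2))
qed

end

section \<open>Measurability of the selection events\<close>

lemma borel_measurable_p_value: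
  assumes "pj < pk" "pk < n" "R \<in> borel_measurable Q"
  shows "(\<lambda>\<omega>. p_value n (R \<omega>) pk pj) \<in> borel_measurable Q"
proof -
  have "mono (\<lambda>r. - p_value n r pk pj)"
    by (intro monoI) (use p_value_antimono[OF assms(1,2)] in auto)
  then have "(\<lambda>r. - p_value n r pk pj) \<in> borel_measurable borel" by (rule borel_measurable_mono)
  from borel_measurable_uminus[OF this]
  have "(\<lambda>r. p_value n r pk pj) \<in> borel_measurable borel" by simp
  then show ?thesis using assms(3) by (rule measurable_compose[rotated])
qed

text \<open>
  The event that the selection equals a given model has to be measurable for its probability to be
  meaningful. Since \<open>RSS\<close> and the p-values are measurable, this reduces to a Boolean combination of
  finitely many comparisons.
\<close>

locale measurable_data =
  fixes Q :: "'a measure" and n m :: nat and X :: "'a \<Rightarrow> nat \<Rightarrow> nat \<Rightarrow> real" and Y :: "'a \<Rightarrow> nat \<Rightarrow> real"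
  assumes X: "\<And>l i. l \<in> {1..n} \<Longrightarrow> i \<in> {1..m} \<Longrightarrow> (\<lambda>\<omega>. X \<omega> l i) \<in> borel_measurable Q"
    and Y: "\<And>l. l \<in> {1..n} \<Longrightarrow> (\<lambda>\<omega>. Y \<omega> l) \<in> borel_measurable Q"
    and mn: "m < n"
begin

lemma RSS_measurable: "j \<subseteq> {1..m} \<Longrightarrow> (\<lambda>\<omega>. RSS n (X \<omega>) (Y \<omega>) j) \<in> borel_measurable Q"
  by (intro borel_measurable_RSS X Y) (auto intro: finite_subset)

lemma R_stat_measurable:
  "j \<subseteq> {1..m} \<Longrightarrow> k \<subseteq> {1..m} \<Longrightarrow> (\<lambda>\<omega>. R_stat n (X \<omega>) (Y \<omega>) j k) \<in> borel_measurable Q"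
  unfolding R_stat_def by (intro borel_measurable_divide borel_measurable_diff RSS_measurable)

lemma PV_measurable: "i \<in> {1..m} \<Longrightarrow> (\<lambda>\<omega>. PV n m (X \<omega>) (Y \<omega>) i) \<in> borel_measurable Q"
  unfolding PV_def using mn by (intro borel_measurable_p_value R_stat_measurable) auto

lemma card_le: "j \<subseteq> {1..m} \<Longrightarrow> card j \<le> m"
  using card_mono[of "{1..m}" j] by simp

lemma mPVC_crit_measurable:
  assumes j: "j \<subseteq> {1..m}"
  shows "(\<lambda>\<omega>. mPVC_crit n a (X \<omega>) (Y \<omega>) j) \<in> borel_measurable Q"
proof (cases "j = {}")
  case False
  have "0 < card j" using False j by (auto simp: card_gt_0_iff intro: finite_subset)
  then show ?thesis
    using False card_le[OF j] mn j unfolding mPVC_crit_def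
    by (auto intro!: borel_measurable_times borel_measurable_p_value R_stat_measurable)
qed (simp add: mPVC_crit_def)

lemma MPVC_crit_measurable:
  assumes j: "j \<subseteq> {1..m}"
  shows "(\<lambda>\<omega>. MPVC_crit n m a (X \<omega>) (Y \<omega>) j) \<in> borel_measurable Q"
proof (cases "j = {1..m}")
  case False
  then have "card j < m" using j psubset_card_mono[of "{1..m}" j] by auto
  then show ?thesis
    using False mn j unfolding MPVC_crit_def
    by (auto intro!: borel_measurable_times borel_measurable_p_value R_stat_measurable)
qed (simp add: MPVC_crit_def)

definition orders :: "nat list set" where
  "orders = {is. distinct is \<and> set is = {1..m}}"

lemma finite_orders: "finite orders"
proof (rule finite_subset)
  show "orders \<subseteq> {is. set is \<subseteq> {1..m} \<and> length is = m}"
    unfolding orders_def using distinct_card by fastforce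
  show "finite {is. set is \<subseteq> {1..m} \<and> length is = m}" by (rule finite_lists_length_eq) simp
qed

lemma PV_ordering_pred:
  assumes "is \<in> orders"
  shows "Measurable.pred Q (\<lambda>\<omega>. PV_ordering n m (X \<omega>) (Y \<omega>) is)"
proof -
  have eq: "PV_ordering n m (X \<omega>) (Y \<omega>) is \<longleftrightarrow> (\<forall>j\<in>{..<length is}. \<forall>i\<in>{..j}.
      \<not> PV n m (X \<omega>) (Y \<omega>) (is ! j) < PV n m (X \<omega>) (Y \<omega>) (is ! i))" for \<omega>
    using assms by (auto simp: PV_ordering_def orders_def sorted_iff_nth_mono not_less)
  have mem: "is ! i \<in> {1..m}" if "i < length is" for i
    using assms nth_mem[OF that] by (auto simp: orders_def)
  show ?thesis
    unfolding eq
    by (intro pred_intros_finite(3) pred_intros_logic(2) borel_measurable_pred_less PV_measurable mem) auto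
qed

lemma nested_family_sub: "is \<in> orders \<Longrightarrow> j \<in> nested_family is \<Longrightarrow> j \<subseteq> {1..m}"
  by (auto simp: nested_family_def orders_def dest: in_set_takeD)

lemma finite_nested: "finite (nested_family is)"
proof -
  have "nested_family is = (\<lambda>k. set (take k is)) ` {1..length is}" by (auto simp: nested_family_def)
  then show ?thesis by simp
qed

lemma arg_min_pred:
  assumes F: "finite F" and f: "\<And>k. k \<in> F \<Longrightarrow> (\<lambda>\<omega>. f \<omega> k) \<in> borel_measurable Q"
  shows "Measurable.pred Q (\<lambda>\<omega>. is_arg_min (f \<omega> :: 'b \<Rightarrow> real) (\<lambda>k. k \<in> F) j)"
proof (cases "j \<in> F")
  case True
  have eq: "is_arg_min (f \<omega>) (\<lambda>k. k \<in> F) j \<longleftrightarrow> (\<forall>y\<in>F. \<not> f \<omega> y < f \<omega> j)" for \<omega>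
    using True by (auto simp: is_arg_min_def)
  show ?thesis unfolding eq
    by (intro pred_intros_finite(3) pred_intros_logic(2) F borel_measurable_pred_less f True)
qed (simp add: is_arg_min_def)

lemma mPVC_select_pred:
  assumes "is \<in> orders"
  shows "Measurable.pred Q (\<lambda>\<omega>. j \<in> mPVC_select n a (X \<omega>) (Y \<omega>) (nested_family is))"
proof -
  let ?F = "nested_family is"
  have F: "Measurable.pred Q (\<lambda>\<omega>. is_arg_min (mPVC_crit n a (X \<omega>) (Y \<omega>)) (\<lambda>k. k \<in> ?F) k)" for k
    by (intro arg_min_pred finite_nested mPVC_crit_measurable nested_family_sub[OF assms])
  have eq: "j \<in> mPVC_select n a (X \<omega>) (Y \<omega>) ?F \<longleftrightarrow>
      is_arg_min (mPVC_crit n a (X \<omega>) (Y \<omega>)) (\<lambda>k. k \<in> ?F) j \<and>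
      (\<forall>y\<in>?F. is_arg_min (mPVC_crit n a (X \<omega>) (Y \<omega>)) (\<lambda>k. k \<in> ?F) y \<longrightarrow> \<not> card y < card j)" for \<omega>
    unfolding mPVC_select_def is_arg_min_def[of card] by (auto simp: is_arg_min_def)
  show ?thesis unfolding eq
    by (intro pred_intros_finite(3) pred_intros_logic(2-4) finite_nested F) simp
qed

lemma MPVC_select_pred:
  assumes "is \<in> orders"
  shows "Measurable.pred Q (\<lambda>\<omega>. j \<in> MPVC_select n m a (X \<omega>) (Y \<omega>) (nested_family is))"
proof -
  let ?F = "nested_family is"
  have eq: "j \<in> MPVC_select n m a (X \<omega>) (Y \<omega>) ?F \<longleftrightarrow>
      is_arg_min (\<lambda>k. - MPVC_crit n m a (X \<omega>) (Y \<omega>) k) (\<lambda>k. k \<in> ?F) j" for \<omega>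
    by (simp add: MPVC_select_def is_arg_max_def is_arg_min_def)
  show ?thesis
    unfolding eq
  proof (rule arg_min_pred[OF finite_nested])
    fix k assume "k \<in> ?F"
    then have "(\<lambda>\<omega>. MPVC_crit n m a (X \<omega>) (Y \<omega>) k) \<in> borel_measurable Q"
      by (intro MPVC_crit_measurable nested_family_sub[OF assms])
    then show "(\<lambda>\<omega>. - MPVC_crit n m a (X \<omega>) (Y \<omega>) k) \<in> borel_measurable Q"
      by (rule borel_measurable_uminus)
  qed
qed

lemma greedy_event:
  assumes sel: "\<And>is j. is \<in> orders \<Longrightarrow> Measurable.pred Q (\<lambda>\<omega>. j \<in> sel \<omega> is)"
    and sub: "\<And>is j \<omega>. is \<in> orders \<Longrightarrow> j \<in> sel \<omega> is \<Longrightarrow> j \<subseteq> {1..m}"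
    and g: "\<And>\<omega>. greedy \<omega> = {j. \<exists>is. PV_ordering n m (X \<omega>) (Y \<omega>) is \<and> j \<in> sel \<omega> is}"
  shows "{\<omega> \<in> space Q. greedy \<omega> = {t}} \<in> sets Q"
proof -
  have ord: "is \<in> orders" if "PV_ordering n m (X \<omega>) (Y \<omega>) is" for "is" \<omega>
    using that by (auto simp: PV_ordering_def orders_def)
  have mem: "j \<in> greedy \<omega> \<longleftrightarrow> (\<exists>is\<in>orders. PV_ordering n m (X \<omega>) (Y \<omega>) is \<and> j \<in> sel \<omega> is)" for j \<omega>
    unfolding g mem_Collect_eq by (rule iffI) (use ord in \<open>metis\<close>)+
  have bound: "j \<in> Pow {1..m}" if "j \<in> greedy \<omega>" for j \<omega>
    using that sub unfolding mem by auto
  have eq: "greedy \<omega> = {t} \<longleftrightarrow> (\<forall>j\<in>insert t (Pow {1..m}).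
      (\<exists>is\<in>orders. PV_ordering n m (X \<omega>) (Y \<omega>) is \<and> j \<in> sel \<omega> is) \<longleftrightarrow> j = t)" for \<omega>
    unfolding mem[symmetric]
  proof
    assume "greedy \<omega> = {t}"
    then show "\<forall>j\<in>insert t (Pow {1..m}). (j \<in> greedy \<omega>) = (j = t)" by simp
  next
    assume r: "\<forall>j\<in>insert t (Pow {1..m}). (j \<in> greedy \<omega>) = (j = t)"
    have "t \<in> greedy \<omega>" using bspec[OF r, of t] by simp
    moreover have "j = t" if "j \<in> greedy \<omega>" for j
      using bspec[OF r, of j] bound[OF that] that by blast
    ultimately show "greedy \<omega> = {t}" by blast
  qed
  have "Measurable.pred Q (\<lambda>\<omega>. greedy \<omega> = {t})"
    unfolding eq
  proof (rule pred_intros_finite(3))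
    fix j
    have "Measurable.pred Q (\<lambda>\<omega>. \<exists>is\<in>orders. PV_ordering n m (X \<omega>) (Y \<omega>) is \<and> j \<in> sel \<omega> is)"
      by (rule pred_intros_finite(4)[OF finite_orders]) (rule pred_intros_logic(3)[OF PV_ordering_pred sel])
    then show "Measurable.pred Q (\<lambda>\<omega>. (\<exists>is\<in>orders. PV_ordering n m (X \<omega>) (Y \<omega>) is \<and> j \<in> sel \<omega> is) = (j = t))"
      by (rule pred_intros_logic(6)) simp
  qed simp
  then show ?thesis by (simp add: pred_def)
qed

lemma greedy_mPVC_event: "{\<omega> \<in> space Q. greedy_mPVC n m a (X \<omega>) (Y \<omega>) = {t}} \<in> sets Q"
proof (rule greedy_event[where sel = "\<lambda>\<omega> is. mPVC_select n a (X \<omega>) (Y \<omega>) (nested_family is)"])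
  show "j \<subseteq> {1..m}" if "is \<in> orders" "j \<in> mPVC_select n a (X \<omega>) (Y \<omega>) (nested_family is)" for "is" j \<omega>
    using that nested_family_sub[OF that(1)] by (auto simp: mPVC_select_def is_arg_min_def)
qed (auto simp: greedy_mPVC_def intro: mPVC_select_pred)

lemma greedy_MPVC_event: "{\<omega> \<in> space Q. greedy_MPVC n m a (X \<omega>) (Y \<omega>) = {t}} \<in> sets Q"
proof (rule greedy_event[where sel = "\<lambda>\<omega> is. MPVC_select n m a (X \<omega>) (Y \<omega>) (nested_family is)"])
  show "j \<subseteq> {1..m}" if "is \<in> orders" "j \<in> MPVC_select n m a (X \<omega>) (Y \<omega>) (nested_family is)" for "is" j \<omega>
    using that nested_family_sub[OF that(1)] by (auto simp: MPVC_select_def is_arg_max_def)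
qed (auto simp: greedy_MPVC_def intro: MPVC_select_pred)

end

section \<open>Probability of the gap\<close>

context design_sample
begin

lemma response_alt: "response M x eps \<beta> n \<omega> = (\<lambda>l. lin_comb m (design x n \<omega>) \<beta> l + eps n l \<omega>)"
  by (auto simp: response_def lin_comb_def design_def)

lemma eps_norm_lower_tail:
  "prob {\<omega> \<in> space (P n). ip_sq n (\<lambda>l. eps n l \<omega>) \<le> real n * \<sigma>\<^sup>2 / 2} \<le> exp (- real n / 24)"
proof -
  have "prob {\<omega> \<in> space (P n). (\<Sum>l\<in>{1..n}. (eps n l \<omega>)\<^sup>2) \<le> real (card {1..n}) * \<sigma>\<^sup>2 / 2}
      \<le> exp (- real (card {1..n}) / (8 * 3))"
    using sigma_pos eps_second_moment eps_fourth_moment by (intro sum_of_squares_lower_tail eps_indep) auto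
  then show ?thesis by (simp add: ip_def power2_eq_square)
qed

lemma eps_norm_upper_tail:
  assumes "0 < L"
  shows "prob {\<omega> \<in> space (P n). L * real n \<le> ip_sq n (\<lambda>l. eps n l \<omega>)} \<le> \<sigma>\<^sup>2 / L"
proof -
  have I: "integrable (P n) (\<lambda>\<omega>. ip_sq n (\<lambda>l. eps n l \<omega>))"
    unfolding ip_def by (intro Bochner_Integration.integrable_sum eps_covariance(1))
  have "expectation (\<lambda>\<omega>. ip_sq n (\<lambda>l. eps n l \<omega>)) = (\<Sum>l = 1..n. expectation (\<lambda>\<omega>. eps n l \<omega> * eps n l \<omega>))"
    unfolding ip_def by (rule Bochner_Integration.integral_sum) (intro eps_covariance(1))
  also have "\<dots> = real n * \<sigma>\<^sup>2" by (simp add: eps_covariance(2))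
  finally have "prob {\<omega> \<in> space (P n). L * real n \<le> ip_sq n (\<lambda>l. eps n l \<omega>)} \<le> real n * \<sigma>\<^sup>2 / (L * real n)"
    using assms n1 by (intro Markov_ge[OF I]) (auto simp: ip_self_nonneg)
  also have "\<dots> = \<sigma>\<^sup>2 / L" using n1 by simp
  finally show ?thesis .
qed

lemma signal_norm_upper_tail:
  assumes "0 < L" and b: "expectation (\<lambda>\<omega>. (row_dot m \<beta> (row 1 \<omega>))\<^sup>2) \<le> b"
  shows "prob {\<omega> \<in> space (P n). L * real n \<le> ip_sq n (lin_comb m (design x n \<omega>) \<beta>)} \<le> b / L"
    and "(\<lambda>\<omega>. ip_sq n (lin_comb m (design x n \<omega>) \<beta>)) \<in> borel_measurable (P n)"
proof -
  let ?f = "\<lambda>l \<omega>. (row_dot m \<beta> (row l \<omega>))\<^sup>2"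
  have If: "integrable (P n) (?f l)" if "l \<in> {1..n}" for l
    unfolding row_integral_eq(2)[OF that row_dot_sq_measurable] by (rule row_dot_sq_integrable)
  have eq: "ip_sq n (lin_comb m (design x n \<omega>) \<beta>) = (\<Sum>l = 1..n. ?f l \<omega>)" for \<omega>
    by (simp only: ip_def lin_comb_row_dot power2_eq_square)
  have I: "integrable (P n) (\<lambda>\<omega>. \<Sum>l = 1..n. ?f l \<omega>)" by (intro Bochner_Integration.integrable_sum If)
  have "expectation (\<lambda>\<omega>. \<Sum>l = 1..n. ?f l \<omega>) = (\<Sum>l = 1..n. expectation (?f l))"
    by (rule Bochner_Integration.integral_sum) (rule If)
  also have "\<dots> = (\<Sum>l = 1..n. expectation (?f 1))"
    by (intro sum.cong refl row_integral_eq(1) row_dot_sq_measurable)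
  also have "\<dots> \<le> real n * b" using b by (simp add: mult_left_mono)
  finally have E: "expectation (\<lambda>\<omega>. \<Sum>l = 1..n. ?f l \<omega>) \<le> real n * b" .
  have "prob {\<omega> \<in> space (P n). L * real n \<le> (\<Sum>l = 1..n. ?f l \<omega>)} \<le> real n * b / (L * real n)"
    using assms n1 by (intro Markov_ge[OF I _ E]) (auto intro!: sum_nonneg)
  also have "\<dots> = b / L" using n1 by simp
  finally show "prob {\<omega> \<in> space (P n). L * real n \<le> ip_sq n (lin_comb m (design x n \<omega>) \<beta>)} \<le> b / L"
    unfolding eq .
  show "(\<lambda>\<omega>. ip_sq n (lin_comb m (design x n \<omega>) \<beta>)) \<in> borel_measurable (P n)"
    unfolding eq using I by (rule borel_measurable_integrable)
qed

text \<open>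
  The gap holds outside four exceptional sets: those of the frame and noise bounds, of a too short or
  too long noise vector, and of a too long signal. Their probabilities are small when first \<open>L\<close> and
  then \<open>n\<close> are large.
\<close>

lemma rss_gap_event:
  assumes n: "64 \<le> n" "m \<le> n" and L: "0 < L"
    and t: "t \<subseteq> {1..m}" and \<beta>: "\<And>i. i \<in> {1..m} - t \<Longrightarrow> \<beta> i = 0"
    and g: "\<And>i. i \<in> t \<Longrightarrow> g \<le> \<kappa> / 32 * (\<beta> i)\<^sup>2" and \<theta>: "2 * \<theta> \<le> g" "4 * \<theta> \<le> \<sigma>\<^sup>2"
    and small: "512 * L * real m \<le> g * real n" "128 * L * real m \<le> \<sigma>\<^sup>2 * real n"
    and b: "expectation (\<lambda>\<omega>. (row_dot m \<beta> (row 1 \<omega>))\<^sup>2) \<le> b"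
  obtains B where "B \<in> events"
    and "prob B \<le> 1 / real n + (2 * (real n)\<^sup>2 + 1) ^ m * exp (- real n / (8 * (1 + K))) + exp (- real n / 24)
      + (2 * \<sigma>\<^sup>2 + b) / L"
    and "\<And>\<omega>. \<omega> \<in> space (P n) - B \<Longrightarrow> rss_gap n m (design x n \<omega>) (response M x eps \<beta> n \<omega>) t
      (ip_sq n (\<lambda>l. eps n l \<omega>)) (32 * L * real m) \<theta> (4 * L)"
proof -
  obtain B0 where B0: "B0 \<in> events"
    "prob B0 \<le> 1 / real n + (2 * (real n)\<^sup>2 + 1) ^ m * exp (- real n / (8 * (1 + K))) + \<sigma>\<^sup>2 / L"
    "\<And>\<omega> w. \<omega> \<in> space (P n) - B0 \<Longrightarrow> real n / 32 * sq_norm m w \<le> ip_sq n (lin_comb m (\<lambda>l i. z l i \<omega>) w)"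
    "\<And>\<omega> w. \<omega> \<in> space (P n) - B0 \<Longrightarrow> (ip n (\<lambda>l. eps n l \<omega>) (lin_comb m (\<lambda>l i. z l i \<omega>) w))\<^sup>2 \<le>
      32 * L * real m * ip_sq n (lin_comb m (\<lambda>l i. z l i \<omega>) w)"
    using frame_and_noise_event[OF n(1) m1 n(2) L] by blast
  define B1 where "B1 = {\<omega> \<in> space (P n). ip_sq n (\<lambda>l. eps n l \<omega>) \<le> real n * \<sigma>\<^sup>2 / 2}"
  define B2 where "B2 = {\<omega> \<in> space (P n). L * real n \<le> ip_sq n (\<lambda>l. eps n l \<omega>)}"
  define B3 where "B3 = {\<omega> \<in> space (P n). L * real n \<le> ip_sq n (lin_comb m (design x n \<omega>) \<beta>)}"
  have [measurable]: "(\<lambda>\<omega>. ip_sq n (\<lambda>l. eps n l \<omega>)) \<in> borel_measurable (P n)"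
    unfolding ip_def by (intro borel_measurable_sum borel_measurable_times eps_measurable)
  note signal_norm_upper_tail(2)[OF L b, measurable]
  have ev: "B1 \<in> events" "B2 \<in> events" "B3 \<in> events"
    unfolding B1_def B2_def B3_def by measurable
  have p: "prob B1 \<le> exp (- real n / 24)" "prob B2 \<le> \<sigma>\<^sup>2 / L" "prob B3 \<le> b / L"
    unfolding B1_def B2_def B3_def
    using eps_norm_lower_tail eps_norm_upper_tail[OF L] signal_norm_upper_tail(1)[OF L b] by auto
  show ?thesis
  proof (rule that[of "B0 \<union> B1 \<union> B2 \<union> B3"])
    show "B0 \<union> B1 \<union> B2 \<union> B3 \<in> events" using B0(1) ev by auto
    have "prob (B0 \<union> B1 \<union> B2 \<union> B3) \<le> prob B0 + prob B1 + prob B2 + prob B3"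
      using B0(1) ev measure_Un_le[of "B0 \<union> B1 \<union> B2" "P n" B3] measure_Un_le[of "B0 \<union> B1" "P n" B2]
        measure_Un_le[of B0 "P n" B1] by auto
    then show "prob (B0 \<union> B1 \<union> B2 \<union> B3) \<le> 1 / real n + (2 * (real n)\<^sup>2 + 1) ^ m * exp (- real n / (8 * (1 + K)))
        + exp (- real n / 24) + (2 * \<sigma>\<^sup>2 + b) / L"
      using B0(2) p by (simp add: add_divide_distrib)
    fix \<omega> assume \<omega>: "\<omega> \<in> space (P n) - (B0 \<union> B1 \<union> B2 \<union> B3)"
    let ?X = "design x n \<omega>" and ?e = "\<lambda>l. eps n l \<omega>"
    have E: "real n * \<sigma>\<^sup>2 / 2 \<le> ip_sq n ?e" "ip_sq n ?e \<le> L * real n"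
      "ip_sq n (lin_comb m ?X \<beta>) \<le> L * real n"
      using \<omega> by (auto simp: B1_def B2_def B3_def)
    have \<omega>0: "\<omega> \<in> space (P n) - B0" using \<omega> by auto
    show "rss_gap n m ?X (response M x eps \<beta> n \<omega>) t (ip_sq n ?e) (32 * L * real m) \<theta> (4 * L)"
    proof (rule rss_gap_from_geometry[OF t \<beta> response_alt, where c = "\<kappa> / 32" and g = g])
      fix v i assume i: "i \<in> {1..m}"
      obtain w where w: "\<And>X l. lin_comb m X (mat_fun m S w) l = lin_comb m X v l" "\<kappa> * sq_norm m v \<le> sq_norm m w"
        using unwhiten by blast
      have lw: "lin_comb m (\<lambda>l i. z l i \<omega>) w = lin_comb m ?X v" by (rule ext) (simp only: lin_comb_z w)
      have "(v i)\<^sup>2 \<le> sq_norm m v" unfolding sq_norm_def using i by (intro member_le_sum) auto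
      then have "\<kappa> * (v i)\<^sup>2 \<le> sq_norm m w" using w(2) \<kappa> mult_left_mono[of "(v i)\<^sup>2" "sq_norm m v" \<kappa>] by linarith
      then have "real n / 32 * (\<kappa> * (v i)\<^sup>2) \<le> real n / 32 * sq_norm m w" by (intro mult_left_mono) auto
      also have "\<dots> \<le> ip_sq n (lin_comb m ?X v)" using B0(3)[OF \<omega>0, of w] unfolding lw .
      finally show "\<kappa> / 32 * real n * (v i)\<^sup>2 \<le> ip_sq n (lin_comb m ?X v)" by (simp add: mult_ac)
    next
      fix v
      obtain w where w: "\<And>X l. lin_comb m X (mat_fun m S w) l = lin_comb m X v l" "\<kappa> * sq_norm m v \<le> sq_norm m w"
        using unwhiten by blast
      have lw: "lin_comb m (\<lambda>l i. z l i \<omega>) w = lin_comb m ?X v" by (rule ext) (simp only: lin_comb_z w)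
      show "(ip n ?e (lin_comb m ?X v))\<^sup>2 \<le> 32 * L * real m * ip_sq n (lin_comb m ?X v)"
        using B0(4)[OF \<omega>0, of w] unfolding lw .
    next
      show "ip_sq n (response M x eps \<beta> n \<omega>) \<le> 4 * L * real n"
      proof -
        have "(\<Sum>l = 1..n. (lin_comb m ?X \<beta> l + ?e l)\<^sup>2) \<le> (\<Sum>l = 1..n. 2 * (lin_comb m ?X \<beta> l)\<^sup>2 + 2 * (?e l)\<^sup>2)"
        proof (rule sum_mono)
          fix l
          have "0 \<le> (lin_comb m ?X \<beta> l - ?e l)\<^sup>2" by simp
          then show "(lin_comb m ?X \<beta> l + ?e l)\<^sup>2 \<le> 2 * (lin_comb m ?X \<beta> l)\<^sup>2 + 2 * (?e l)\<^sup>2"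
            by (simp add: power2_sum power2_diff)
        qed
        then have "ip_sq n (response M x eps \<beta> n \<omega>) \<le>
            2 * ip_sq n (lin_comb m ?X \<beta>) + 2 * ip_sq n ?e"
          unfolding response_alt ip_def by (simp add: power2_eq_square sum.distrib sum_distrib_left)
        then show ?thesis using E by linarith
      qed
      show "\<theta> * real n \<le> ip_sq n ?e - 32 * L * real m"
        using E(1) small(2) mult_right_mono[OF \<theta>(2), of "real n"] by (simp add: algebra_simps)
      show "ip_sq n ?e \<le> 4 * L * real n" using E(2) mult_pos_pos[OF L, of "real n"] n by simp
    qed (use L g \<theta> small in auto)
  qed
qed

end

text \<open>
  This uses the growth condition in full: \<open>m * ln n\<close> is dominated by \<open>n powr (1 - \<delta>) * ln n\<close>.
\<close>

lemma grid_probability_tendsto_0: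
  fixes M :: "nat \<Rightarrow> nat"
  assumes \<eta>: "0 < \<eta>" and growth: "(\<lambda>n. real (M n) powr (1 + \<eta>) / real n) \<longlonglongrightarrow> 0" and C: "0 < C"
  shows "(\<lambda>n. (2 * (real n)\<^sup>2 + 1) ^ M n * exp (- real n / C)) \<longlonglongrightarrow> 0"
proof -
  define \<delta> where "\<delta> = \<eta> / (1 + \<eta>)"
  have \<delta>: "0 < \<delta>" "1 / (1 + \<eta>) = 1 - \<delta>" using \<eta> by (auto simp: \<delta>_def field_simps)
  show ?thesis
  proof (rule tendsto_sandwich)
    show "eventually (\<lambda>n. 0 \<le> (2 * (real n)\<^sup>2 + 1) ^ M n * exp (- real n / C)) sequentially"
      by (intro always_eventually) auto
    show "eventually (\<lambda>n. (2 * (real n)\<^sup>2 + 1) ^ M n * exp (- real n / C) \<le>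
        exp (real n powr (1 - \<delta>) * ln (2 * (real n)\<^sup>2 + 1) - real n / C)) sequentially"
      using growth_imp_power_bound[OF \<eta> growth] eventually_gt_at_top[of 0]
    proof eventually_elim
      case (elim n)
      have p: "0 < 2 * (real n)\<^sup>2 + 1" by (simp add: add_nonneg_pos)
      have "(2 * (real n)\<^sup>2 + 1) ^ M n = exp (real (M n) * ln (2 * (real n)\<^sup>2 + 1))"
        using p by (simp add: exp_of_nat_mult)
      also have "\<dots> \<le> exp (real n powr (1 - \<delta>) * ln (2 * (real n)\<^sup>2 + 1))"
        using elim \<delta> by (intro iffD2[OF exp_le_cancel_iff] mult_right_mono) auto
      finally show ?case
        by (simp add: exp_diff exp_minus divide_inverse mult_right_mono)
    qed
    show "(\<lambda>n. exp (real n powr (1 - \<delta>) * ln (2 * (real n)\<^sup>2 + 1) - real n / C)) \<longlonglongrightarrow> 0"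
      using \<delta> C by real_asymp
  qed auto
qed

section \<open>Consistency\<close>

locale regression_sequence =
  fixes P :: "nat \<Rightarrow> 'a measure" and M :: "nat \<Rightarrow> nat"
    and x :: "nat \<Rightarrow> nat \<Rightarrow> nat \<Rightarrow> 'a \<Rightarrow> real" and eps :: "nat \<Rightarrow> nat \<Rightarrow> 'a \<Rightarrow> real"
    and \<sigma> :: real and \<beta> :: "nat \<Rightarrow> real" and t :: "nat set" and \<kappa> \<eta> :: real and S :: "nat \<Rightarrow> real mat"
  assumes setting: "random_design P M x eps \<sigma>"
    and t_def: "t = true_model \<beta>"
    and t_finite: "finite t"
    and t_nonempty: "t \<noteq> {}"
    and M_large: "ereal (real (Max t)) \<le> lim (\<lambda>n. ereal (real (M n)))"
    and kappa_pos: "0 < \<kappa>"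
    and min_eigenvalue: "\<And>n. 1 \<le> n \<Longrightarrow> \<kappa> < min_eigenvalue (second_moment_row P x n {1..M n})"
    and eta_pos: "0 < \<eta>"
    and M_growth: "(\<lambda>n. real (M n) powr (1 + \<eta>) / real n) \<longlonglongrightarrow> 0"
    and inv_sqrt: "\<And>n. 1 \<le> n \<Longrightarrow> is_inv_sqrt_mat (second_moment_row P x n {1..M n}) (S n)"
    and moments:
      "(SUP n\<in>{1..}. SUP d\<in>{d \<in> carrier_vec (M n). sqrt (scalar_prod d d) = 1}.
          \<integral>\<^sup>+\<omega>. ennreal (\<bar>scalar_prod d (mult_mat_vec (S n) (subvec {1..M n} (design x n \<omega> 1)))\<bar>
                         ^ (4 * nat \<lceil>2 / \<eta>\<rceil>)) \<partial>P n) < \<infinity>"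
begin

lemma M_mono: "1 \<le> n \<Longrightarrow> n \<le> k \<Longrightarrow> M n \<le> M k"
  using setting by (auto simp: random_design_def mono_on_def)

lemma t_ge_1: "i \<in> t \<Longrightarrow> 1 \<le> i"
  by (simp add: t_def true_model_def)

lemma beta_outside: "1 \<le> i \<Longrightarrow> i \<notin> t \<Longrightarrow> \<beta> i = 0"
  by (simp add: t_def true_model_def)

text \<open>
  A nondecreasing sequence below \<open>Max t\<close> has a limit of at most \<open>Max t - 1\<close>.
\<close>

lemma reaches_true_model: "\<exists>n\<ge>1. Max t \<le> M n"
proof (rule ccontr)
  assume no: "\<not> ?thesis"
  have less: "M n < Max t" if "1 \<le> n" for n using no that by (meson not_le)
  have "incseq (\<lambda>n. ereal (real (M (Suc n))))"
    by (intro monoI) (simp add: M_mono)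
  then have "(\<lambda>n. ereal (real (M (Suc n)))) \<longlonglongrightarrow> (SUP n. ereal (real (M (Suc n))))" by (rule LIMSEQ_SUP)
  then have "(\<lambda>n. ereal (real (M n))) \<longlonglongrightarrow> (SUP n. ereal (real (M (Suc n))))" by (rule LIMSEQ_imp_Suc)
  then have "lim (\<lambda>n. ereal (real (M n))) = (SUP n. ereal (real (M (Suc n))))" by (rule limI)
  also have "\<dots> \<le> ereal (real (Max t) - 1)"
  proof (rule SUP_least)
    fix n show "ereal (real (M (Suc n))) \<le> ereal (real (Max t) - 1)" using less[of "Suc n"] by simp
  qed
  also have "\<dots> < ereal (real (Max t))" by simp
  finally show False using M_large by simp
qed

definition n\<^sub>0 :: nat where "n\<^sub>0 = (SOME n. 1 \<le> n \<and> Max t \<le> M n)"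

lemma n0: "1 \<le> n\<^sub>0" "Max t \<le> M n\<^sub>0"
  using someI_ex[of "\<lambda>n. 1 \<le> n \<and> Max t \<le> M n"] reaches_true_model unfolding n\<^sub>0_def by blast+

lemma t_sub:
  assumes "n\<^sub>0 \<le> n"
  shows "t \<subseteq> {1..M n}"
proof
  fix i assume i: "i \<in> t"
  have "i \<le> Max t" using t_finite i by simp
  also have "\<dots> \<le> M n" using n0 M_mono[OF n0(1) assms] by simp
  finally show "i \<in> {1..M n}" using t_ge_1[OF i] by simp
qed

lemma M_ge_1: "n\<^sub>0 \<le> n \<Longrightarrow> 1 \<le> M n"
  using t_sub[of n] t_nonempty by fastforce

definition moment_bound :: real where
  "moment_bound = enn2real (SUP n\<in>{1..}. SUP d\<in>{d \<in> carrier_vec (M n). sqrt (scalar_prod d d) = 1}.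
          \<integral>\<^sup>+\<omega>. ennreal (\<bar>scalar_prod d (mult_mat_vec (S n) (subvec {1..M n} (design x n \<omega> 1)))\<bar>
                         ^ (4 * nat \<lceil>2 / \<eta>\<rceil>)) \<partial>P n)"

lemma moment_le:
  assumes "1 \<le> n" "d \<in> carrier_vec (M n)" "sqrt (scalar_prod d d) = 1"
  shows "(\<integral>\<^sup>+\<omega>. ennreal (\<bar>scalar_prod d (mult_mat_vec (S n) (subvec {1..M n} (design x n \<omega> 1)))\<bar>
                         ^ (4 * nat \<lceil>2 / \<eta>\<rceil>)) \<partial>P n) \<le> ennreal moment_bound"
proof -
  let ?f = "\<lambda>n d. \<integral>\<^sup>+\<omega>. ennreal (\<bar>scalar_prod d (mult_mat_vec (S n) (subvec {1..M n} (design x n \<omega> 1)))\<bar>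
                         ^ (4 * nat \<lceil>2 / \<eta>\<rceil>)) \<partial>P n"
  have "?f n d \<le> (SUP d\<in>{d \<in> carrier_vec (M n). sqrt (scalar_prod d d) = 1}. ?f n d)"
    using assms by (intro SUP_upper) auto
  also have "\<dots> \<le> (SUP n\<in>{1..}. SUP d\<in>{d \<in> carrier_vec (M n). sqrt (scalar_prod d d) = 1}. ?f n d)"
    using assms by (intro SUP_upper[where f = "\<lambda>n. SUP d\<in>{d \<in> carrier_vec (M n). sqrt (scalar_prod d d) = 1}. ?f n d"]) auto
  also have "\<dots> = ennreal moment_bound"
    unfolding moment_bound_def using moments by (intro ennreal_enn2real[symmetric]) simp
  finally show ?thesis .
qed

lemma design_sample_n:
  assumes "n\<^sub>0 \<le> n"
  shows "design_sample P M x eps \<sigma> n (S n) moment_bound \<kappa> (nat \<lceil>2 / \<eta>\<rceil>)"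
proof
  have n: "1 \<le> n" using n0 assms by simp
  show "random_design P M x eps \<sigma>" by (rule setting)
  show "1 \<le> n" by (rule n)
  show "1 \<le> M n" by (rule M_ge_1[OF assms])
  show "is_inv_sqrt_mat (second_moment_row P x n {1..M n}) (S n)" by (rule inv_sqrt[OF n])
  show "0 \<le> moment_bound" by (simp add: moment_bound_def)
  have "0 < 2 / \<eta>" using eta_pos by simp
  then show "1 \<le> nat \<lceil>2 / \<eta>\<rceil>" by linarith
  show "0 < \<kappa>" by (rule kappa_pos)
  show "\<kappa> < min_eigenvalue (second_moment_row P x n {1..M n})" by (rule min_eigenvalue[OF n])
  fix d assume "d \<in> carrier_vec (M n)" "sqrt (scalar_prod d d) = 1"
  then show "(\<integral>\<^sup>+\<omega>. ennreal (\<bar>scalar_prod d (mult_mat_vec (S n) (subvec {1..M n} (design x n \<omega> 1)))\<bar>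
                         ^ (4 * nat \<lceil>2 / \<eta>\<rceil>)) \<partial>P n) \<le> ennreal moment_bound"
    by (rule moment_le[OF n])
qed

text \<open>
  Only the coordinates in \<open>t\<close> enter, whose law is the same for all sample sizes from \<open>n\<^sub>0\<close> on.
\<close>

definition signal_power :: "nat \<Rightarrow> real" where
  "signal_power n = (\<integral>\<omega>. (\<Sum>k\<in>t. x n 1 k \<omega> * \<beta> k)\<^sup>2 \<partial>P n)"

lemma signal_row_dot:
  assumes "n\<^sub>0 \<le> n"
  shows "row_dot (M n) \<beta> (design_row x k 1 (M n) \<omega>) = (\<Sum>i\<in>t. x k 1 i \<omega> * \<beta> i)"
proof -
  have "(\<Sum>i\<in>t. x k 1 i \<omega> * \<beta> i) = (\<Sum>i = 1..M n. x k 1 i \<omega> * \<beta> i)"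
    using t_sub[OF assms] beta_outside by (intro sum.mono_neutral_left) auto
  then show ?thesis by (simp add: row_dot_def design_row_def)
qed

lemma signal_power_Suc:
  assumes n: "n\<^sub>0 \<le> n"
  shows "signal_power (Suc n) = signal_power n"
proof -
  interpret A: design_sample P M x eps \<sigma> n "S n" moment_bound \<kappa> "nat \<lceil>2 / \<eta>\<rceil>"
    by (rule design_sample_n[OF n])
  interpret B: design_sample P M x eps \<sigma> "Suc n" "S (Suc n)" moment_bound \<kappa> "nat \<lceil>2 / \<eta>\<rceil>"
    by (rule design_sample_n) (use n in simp)
  let ?N = "PiM {1..M n} (\<lambda>i. borel)"
  let ?f = "\<lambda>y. (row_dot (M n) \<beta> y)\<^sup>2"
  have f: "?f \<in> borel_measurable ?N" by (intro borel_measurable_power row_dot_measurable)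
  have le: "M n \<le> M (Suc n)" using M_mono[of n "Suc n"] n0 n by simp
  have rB: "design_row x (Suc n) 1 (M n) \<in> measurable (P (Suc n)) ?N"
    unfolding design_row_def using le by (intro measurable_restrict B.entry_measurable) auto
  have dist: "distr (P (Suc n)) ?N (design_row x (Suc n) 1 (M n)) = distr (P n) ?N (design_row x n 1 (M n))"
    using setting A.n1 unfolding random_design_def by blast
  have "signal_power (Suc n) = (\<integral>\<omega>. ?f (design_row x (Suc n) 1 (M n) \<omega>) \<partial>P (Suc n))"
    unfolding signal_power_def signal_row_dot[OF n] ..
  also have "\<dots> = (\<integral>y. ?f y \<partial>distr (P (Suc n)) ?N (design_row x (Suc n) 1 (M n)))"
    by (rule integral_distr[OF rB f, symmetric])
  also have "\<dots> = (\<integral>\<omega>. ?f (design_row x n 1 (M n) \<omega>) \<partial>P n)"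
    unfolding dist by (rule integral_distr[OF A.row_measurable[OF A.one_mem] f])
  also have "\<dots> = signal_power n"
    unfolding signal_power_def signal_row_dot[OF n] ..
  finally show ?thesis .
qed

lemma signal_power_const: "n\<^sub>0 \<le> n \<Longrightarrow> signal_power n = signal_power n\<^sub>0"
  by (induction n rule: dec_induct) (simp_all add: signal_power_Suc)

lemma signal_power_nonneg: "0 \<le> signal_power n"
  unfolding signal_power_def by (rule Bochner_Integration.integral_nonneg) simp

lemma M_o_n: "(\<lambda>n. real (M n) / real n) \<longlonglongrightarrow> 0"
  by (rule growth_imp_o_n[OF eta_pos M_growth])

lemma eventually_M_le: "0 < c \<Longrightarrow> eventually (\<lambda>n. real (M n) \<le> c * real n) sequentially"
  using M_o_n by (intro eventually_le_small) (auto intro: eventually_gt_at_top)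

text \<open>
  Any rule that returns \<open>t\<close> for large \<open>n\<close> whenever there is a gap with given constants is consistent.
  For the probability \<open>1 - \<rho>\<close> the constant \<open>L\<close> is chosen so that the Markov bounds contribute
  \<open>\<rho> / 4\<close>; the other exceptional probabilities tend to 0.
\<close>

lemma consistency_of_separated_selection:
  assumes event: "eventually (\<lambda>n. {\<omega> \<in> space (P n). sel n (design x n \<omega>) (response M x eps \<beta> n \<omega>)} \<in> sets (P n)) sequentially"
    and sel: "\<And>\<theta> \<Lambda> C. 0 < \<theta> \<Longrightarrow> 0 < \<Lambda> \<Longrightarrow> 0 < C \<Longrightarrow>
      eventually (\<lambda>n. \<forall>X Y E D. rss_gap n (M n) X Y t E D \<theta> \<Lambda> \<longrightarrow> D \<le> C * \<theta> * real (M n) \<longrightarrow> sel n X Y) sequentially"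
  shows "(\<lambda>n. measure (P n) {\<omega> \<in> space (P n). sel n (design x n \<omega>) (response M x eps \<beta> n \<omega>)}) \<longlonglongrightarrow> 1"
proof (rule order_tendstoI)
  fix c :: real assume c: "1 < c"
  show "eventually (\<lambda>n. measure (P n) {\<omega> \<in> space (P n). sel n (design x n \<omega>) (response M x eps \<beta> n \<omega>)} < c) sequentially"
    using eventually_ge_at_top[of n\<^sub>0]
  proof eventually_elim
    case (elim n)
    interpret design_sample P M x eps \<sigma> n "S n" moment_bound \<kappa> "nat \<lceil>2 / \<eta>\<rceil>"
      by (rule design_sample_n[OF elim])
    show ?case using c by (intro le_less_trans[OF prob_le_1])
  qed
next
  fix c :: real assume c: "c < 1"
  define \<rho> where "\<rho> = 1 - c"
  have \<rho>: "0 < \<rho>" using c by (simp add: \<rho>_def)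
  have \<sigma>: "0 < \<sigma>" using setting by (simp add: random_design_def)
  define b where "b = signal_power n\<^sub>0"
  have b: "0 \<le> b" unfolding b_def by (rule signal_power_nonneg)
  define L where "L = 4 * (2 * \<sigma>\<^sup>2 + b) / \<rho>"
  have num: "0 < 2 * \<sigma>\<^sup>2 + b" using \<sigma> b by (intro add_pos_nonneg) auto
  have L: "0 < L" unfolding L_def using num \<rho> by simp
  have "s / (4 * s / \<rho>) = \<rho> / 4" if "0 < s" for s using that \<rho> by simp
  then have Lb: "(2 * \<sigma>\<^sup>2 + b) / L = \<rho> / 4" unfolding L_def using num by blast
  define g where "g = \<kappa> / 32 * Min ((\<lambda>i. (\<beta> i)\<^sup>2) ` t)"
  have "0 < Min ((\<lambda>i. (\<beta> i)\<^sup>2) ` t)"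
    using t_finite t_nonempty by (subst Min_gr_iff) (auto simp: t_def true_model_def)
  then have g: "0 < g" unfolding g_def using kappa_pos by simp
  have gle: "g \<le> \<kappa> / 32 * (\<beta> i)\<^sup>2" if "i \<in> t" for i
    unfolding g_def using that t_finite kappa_pos by (intro mult_left_mono Min_le) auto
  define \<theta> where "\<theta> = min (g / 2) (\<sigma>\<^sup>2 / 4)"
  have \<theta>: "0 < \<theta>" "2 * \<theta> \<le> g" "4 * \<theta> \<le> \<sigma>\<^sup>2" unfolding \<theta>_def using g \<sigma> by auto
  (* the projection of the noise is bounded by 32 * L * M n outside the exceptional set *)
  define C where "C = 32 * L / \<theta>"
  have C: "0 < C" "C * \<theta> = 32 * L" unfolding C_def using L \<theta> by auto
  have K: "0 < 8 * (1 + moment_bound)" by (simp add: moment_bound_def add_pos_nonneg)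
  have "(\<lambda>n. 1 / real n + (2 * (real n)\<^sup>2 + 1) ^ M n * exp (- real n / (8 * (1 + moment_bound))) + exp (- real n / 24)) \<longlonglongrightarrow> 0 + 0 + 0"
    by (intro tendsto_add grid_probability_tendsto_0[OF eta_pos M_growth K] lim_1_over_n) real_asymp
  then have "eventually (\<lambda>n. 1 / real n + (2 * (real n)\<^sup>2 + 1) ^ M n * exp (- real n / (8 * (1 + moment_bound))) + exp (- real n / 24) < \<rho> / 4) sequentially"
    using \<rho> by (intro order_tendstoD(2)[where y = "0 + 0 + 0"]) auto
  moreover have "eventually (\<lambda>n. real (M n) \<le> g / (512 * L) * real n) sequentially"
    using g L by (intro eventually_M_le) simp
  moreover have "eventually (\<lambda>n. real (M n) \<le> \<sigma>\<^sup>2 / (128 * L) * real n) sequentially"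
    using \<sigma> L by (intro eventually_M_le) simp
  moreover have "eventually (\<lambda>n. real (M n) \<le> 1 * real n) sequentially" by (intro eventually_M_le) simp
  moreover have "0 < 4 * L" using L by simp
  note sel[OF \<theta>(1) this C(1)]
  ultimately show "eventually (\<lambda>n. c < measure (P n) {\<omega> \<in> space (P n). sel n (design x n \<omega>) (response M x eps \<beta> n \<omega>)}) sequentially"
    using event eventually_ge_at_top[of n\<^sub>0] eventually_ge_at_top[of 64]
  proof eventually_elim
    case (elim n)
    interpret design_sample P M x eps \<sigma> n "S n" moment_bound \<kappa> "nat \<lceil>2 / \<eta>\<rceil>"
      by (rule design_sample_n) (rule elim(7))
    let ?G = "{\<omega> \<in> space (P n). sel n (design x n \<omega>) (response M x eps \<beta> n \<omega>)}"
    have small: "512 * L * real (M n) \<le> g * real n" "128 * L * real (M n) \<le> \<sigma>\<^sup>2 * real n"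
      using elim(2,3) L by (simp_all add: field_simps)
    have sp: "expectation (\<lambda>\<omega>. (row_dot (M n) \<beta> (design_row x n 1 (M n) \<omega>))\<^sup>2) \<le> b"
      using signal_power_const[OF elim(7)] unfolding b_def signal_power_def signal_row_dot[OF elim(7)] by simp
    obtain B where B: "B \<in> events"
      "prob B \<le> 1 / real n + (2 * (real n)\<^sup>2 + 1) ^ M n * exp (- real n / (8 * (1 + moment_bound))) + exp (- real n / 24)
        + (2 * \<sigma>\<^sup>2 + b) / L"
      "\<And>\<omega>. \<omega> \<in> space (P n) - B \<Longrightarrow> rss_gap n (M n) (design x n \<omega>) (response M x eps \<beta> n \<omega>) t
        (ip_sq n (\<lambda>l. eps n l \<omega>)) (32 * L * real (M n)) \<theta> (4 * L)"
    proof (rule rss_gap_event[of L t \<beta> g \<theta> b])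
      show "M n \<le> n" using elim(4) by simp
      show "t \<subseteq> {1..M n}" by (rule t_sub[OF elim(7)])
      show "\<beta> i = 0" if "i \<in> {1..M n} - t" for i using that by (intro beta_outside) auto
    qed (use elim(8) L gle \<theta> small sp in auto)
    have "space (P n) - B \<subseteq> ?G"
    proof
      fix \<omega> assume \<omega>: "\<omega> \<in> space (P n) - B"
      have "32 * L * real (M n) \<le> C * \<theta> * real (M n)" by (simp add: C(2))
      then show "\<omega> \<in> ?G" using elim(5) B(3)[OF \<omega>] \<omega> by blast
    qed
    then have "prob (space (P n) - B) \<le> prob ?G" using elim(6) by (rule finite_measure_mono)
    moreover have "prob (space (P n) - B) = 1 - prob B" using B(1) by (rule prob_compl)
    ultimately have "1 - \<rho> / 4 - \<rho> / 4 \<le> prob ?G" using B(2) elim(1) Lb by linarith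
    moreover have "c < 1 - \<rho> / 4 - \<rho> / 4" using c by (simp add: \<rho>_def field_simps)
    ultimately show ?case by (rule less_le_trans[rotated])
  qed
qed

lemma events_measurable:
  shows "eventually (\<lambda>n. {\<omega> \<in> space (P n). greedy_mPVC n (M n) (a n) (design x n \<omega>) (response M x eps \<beta> n \<omega>) = {t}} \<in> sets (P n)) sequentially"
    and "eventually (\<lambda>n. {\<omega> \<in> space (P n). greedy_MPVC n (M n) (a n) (design x n \<omega>) (response M x eps \<beta> n \<omega>) = {t}} \<in> sets (P n)) sequentially"
proof -
  have "eventually (\<lambda>n. real (M n) \<le> 1 / 2 * real n) sequentially" by (intro eventually_M_le) simp
  then have md: "eventually (\<lambda>n. measurable_data (P n) n (M n) (design x n) (response M x eps \<beta> n)) sequentially"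
    using eventually_ge_at_top[of n\<^sub>0]
  proof eventually_elim
    case (elim n)
    interpret design_sample P M x eps \<sigma> n "S n" moment_bound \<kappa> "nat \<lceil>2 / \<eta>\<rceil>"
      by (rule design_sample_n) (rule elim(2))
    show ?case
    proof
      show dm: "(\<lambda>\<omega>. design x n \<omega> l i) \<in> borel_measurable (P n)" if "l \<in> {1..n}" "i \<in> {1..M n}" for l i
        unfolding design_def using that by (rule entry_measurable)
      show "(\<lambda>\<omega>. response M x eps \<beta> n \<omega> l) \<in> borel_measurable (P n)" if "l \<in> {1..n}" for l
        unfolding response_def using that
        by (intro borel_measurable_add borel_measurable_sum borel_measurable_times borel_measurable_const entry_measurable eps_measurable)
      show "M n < n" using elim(1) n1 by simp
    qed
  qed
  show "eventually (\<lambda>n. {\<omega> \<in> space (P n). greedy_mPVC n (M n) (a n) (design x n \<omega>) (response M x eps \<beta> n \<omega>) = {t}} \<in> sets (P n)) sequentially"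
    using md by eventually_elim (rule measurable_data.greedy_mPVC_event)
  show "eventually (\<lambda>n. {\<omega> \<in> space (P n). greedy_MPVC n (M n) (a n) (design x n \<omega>) (response M x eps \<beta> n \<omega>) = {t}} \<in> sets (P n)) sequentially"
    using md by eventually_elim (rule measurable_data.greedy_MPVC_event)
qed

lemma eventually_separated_fit:
  assumes "0 < \<theta>" "0 < \<Lambda>"
  shows "eventually (\<lambda>n. \<forall>X Y E D. rss_gap n (M n) X Y t E D \<theta> \<Lambda> \<longrightarrow> separated_fit n (M n) X Y t E D \<theta> \<Lambda>) sequentially"
proof -
  have "eventually (\<lambda>n. real (M n) \<le> 1 / 2 * real n) sequentially" by (intro eventually_M_le) simp
  then show ?thesis
    using eventually_ge_at_top[of n\<^sub>0] eventually_ge_at_top[of 4]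
  proof eventually_elim
    case (elim n)
    then have "real (M n + 2) \<le> real n" by simp
    then have "M n + 2 \<le> n" by (simp only: of_nat_le_iff)
    then show ?case using t_sub[OF elim(2)] t_nonempty assms by (auto simp: separated_fit_def)
  qed
qed

lemma greedy_mPVC_consistent:
  assumes a_nonneg: "\<And>n. 0 \<le> a n" and a_growth: "(\<lambda>n. a n / real n) \<longlonglongrightarrow> 0"
    and ratio: "(\<lambda>n. real (M n) / (a n + ln (real n))) \<longlonglongrightarrow> 0"
  shows "(\<lambda>n. measure (P n) {\<omega> \<in> space (P n).
      greedy_mPVC n (M n) (a n) (design x n \<omega>) (response M x eps \<beta> n \<omega>) = {t}}) \<longlonglongrightarrow> 1"
proof (rule consistency_of_separated_selection[OF events_measurable(1)])
  fix \<theta> \<Lambda> C :: real assume pos: "0 < \<theta>" "0 < \<Lambda>" "0 < C"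
  define \<gamma> where "\<gamma> = \<eta> / (4 * (1 + \<eta>))"
  have \<gamma>: "0 < \<gamma>" using eta_pos by (simp add: \<gamma>_def)
  define r0 where "r0 = \<theta> / (\<Lambda> + \<theta>)"
  have r0: "0 < r0" "r0 < 1" using pos by (auto simp: r0_def field_simps)
  have M1: "eventually (\<lambda>n. 1 \<le> M n) sequentially"
    using eventually_ge_at_top[of n\<^sub>0] by eventually_elim (rule M_ge_1)
  show "eventually (\<lambda>n. \<forall>X Y E D. rss_gap n (M n) X Y t E D \<theta> \<Lambda> \<longrightarrow> D \<le> C * \<theta> * real (M n) \<longrightarrow>
      greedy_mPVC n (M n) (a n) X Y = {t}) sequentially"
    using eventually_separated_fit[OF pos(1,2)] eventually_ratio[OF eta_pos M_growth \<gamma>_def]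
      eventually_overfit_small[OF a_nonneg \<gamma> less_imp_le[OF pos(3)] r0 ratio M1]
      eventually_underfit_mPVC[OF a_growth pos(1,2) r0(1), of "card t"]
  proof eventually_elim
    case (elim n)
    show ?case
    proof (intro allI impI)
      fix X Y E D assume gap: "rss_gap n (M n) X Y t E D \<theta> \<Lambda>" and D: "D \<le> C * \<theta> * real (M n)"
      interpret separated_fit n "M n" X Y t E D \<theta> \<Lambda> using elim(1) gap by blast
      show "greedy_mPVC n (M n) (a n) X Y = {t}"
        using a_nonneg less_imp_le[OF \<gamma>] D r0_def elim(2-4) by (rule greedy_mPVC_eq)
    qed
  qed
qed

lemma greedy_MPVC_consistent:
  assumes a_nonneg: "\<And>n. 0 \<le> a n" and a_growth: "(\<lambda>n. a n / real n) \<longlonglongrightarrow> 0"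
    and a_inf: "filterlim a at_top sequentially" and ratio: "(\<lambda>n. real (M n) / a n) \<longlonglongrightarrow> 0"
  shows "(\<lambda>n. measure (P n) {\<omega> \<in> space (P n).
      greedy_MPVC n (M n) (a n) (design x n \<omega>) (response M x eps \<beta> n \<omega>) = {t}}) \<longlonglongrightarrow> 1"
proof (rule consistency_of_separated_selection[OF events_measurable(2)])
  fix \<theta> \<Lambda> C :: real assume pos: "0 < \<theta>" "0 < \<Lambda>" "0 < C"
  define r0 where "r0 = \<theta> / (\<Lambda> + \<theta>)"
  have r0: "0 < r0" "r0 < 1" using pos by (auto simp: r0_def field_simps)
  have "eventually (\<lambda>n. real (M n) \<le> 1 / (8 * C) * real n) sequentially"
    using pos by (intro eventually_M_le) simp
  then have small: "eventually (\<lambda>n. C * real (M n) / real n \<le> 1 / 8) sequentially"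
    using eventually_gt_at_top[of 0]
  proof eventually_elim
    case (elim n)
    then show ?case using pos by (simp add: field_simps)
  qed
  show "eventually (\<lambda>n. \<forall>X Y E D. rss_gap n (M n) X Y t E D \<theta> \<Lambda> \<longrightarrow> D \<le> C * \<theta> * real (M n) \<longrightarrow>
      greedy_MPVC n (M n) (a n) X Y = {t}) sequentially"
    using eventually_separated_fit[OF pos(1,2)] small eventually_MPVC_small[OF a_inf ratio pos(3)]
      eventually_underfit_MPVC[OF a_growth M_o_n r0, of "card t"]
  proof eventually_elim
    case (elim n)
    show ?case
    proof (intro allI impI)
      fix X Y E D assume gap: "rss_gap n (M n) X Y t E D \<theta> \<Lambda>" and D: "D \<le> C * \<theta> * real (M n)"
      interpret separated_fit n "M n" X Y t E D \<theta> \<Lambda> using elim(1) gap by blast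
      show "greedy_MPVC n (M n) (a n) X Y = {t}"
        using a_nonneg D r0_def elim(2-4) by (rule greedy_MPVC_eq)
    qed
  qed
qed

end

theorem corollary1:
  fixes P :: "nat \<Rightarrow> 'a measure"
    and M :: "nat \<Rightarrow> nat"
    and x :: "nat \<Rightarrow> nat \<Rightarrow> nat \<Rightarrow> 'a \<Rightarrow> real"
    and eps :: "nat \<Rightarrow> nat \<Rightarrow> 'a \<Rightarrow> real"
    and \<sigma> :: real
    and \<beta> :: "nat \<Rightarrow> real"
    and t :: "nat set"
    and a :: "nat \<Rightarrow> real"
    and \<kappa> \<eta> :: real
    and S :: "nat \<Rightarrow> real mat"
  assumes setting: "random_design P M x eps \<sigma>"
    and t_def: "t = true_model \<beta>"
    and t_finite: "finite t"
    and t_nonempty: "t \<noteq> {}"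
    and a_nonneg: "\<And>n. 0 \<le> a n"
    and pos_def_t: "\<And>n. 1 \<le> n \<Longrightarrow> t \<subseteq> {1..M n} \<Longrightarrow> pos_def_mat (second_moment_row P x n t)"
    and M_large: "ereal (real (Max t)) \<le> lim (\<lambda>n. ereal (real (M n)))"
    and kappa_pos: "0 < \<kappa>"
    and min_eigenvalue: "\<And>n. 1 \<le> n \<Longrightarrow> \<kappa> < min_eigenvalue (second_moment_row P x n {1..M n})"
    and eta_pos: "0 < \<eta>"
    and M_growth: "(\<lambda>n. real (M n) powr (1 + \<eta>) / real n) \<longlonglongrightarrow> 0"
    and inv_sqrt: "\<And>n. 1 \<le> n \<Longrightarrow> is_inv_sqrt_mat (second_moment_row P x n {1..M n}) (S n)"
    and moments:
      "(SUP n\<in>{1..}. SUP d\<in>{d \<in> carrier_vec (M n). sqrt (scalar_prod d d) = 1}.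
          \<integral>\<^sup>+\<omega>. ennreal (\<bar>scalar_prod d (mult_mat_vec (S n) (subvec {1..M n} (design x n \<omega> 1)))\<bar>
                         ^ (4 * nat \<lceil>2 / \<eta>\<rceil>)) \<partial>P n) < \<infinity>"
    and a_growth: "(\<lambda>n. a n / real n) \<longlonglongrightarrow> 0"
  shows "((\<lambda>n. real (M n) / (a n + ln (real n))) \<longlonglongrightarrow> 0 \<longrightarrow>
            (\<lambda>n. measure (P n) {\<omega> \<in> space (P n).
               greedy_mPVC n (M n) (a n) (design x n \<omega>) (response M x eps \<beta> n \<omega>) = {t}})
            \<longlonglongrightarrow> 1)
       \<and> (filterlim a at_top sequentially \<and> (\<lambda>n. real (M n) / a n) \<longlonglongrightarrow> 0 \<longrightarrow>
            (\<lambda>n. measure (P n) {\<omega> \<in> space (P n).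
               greedy_MPVC n (M n) (a n) (design x n \<omega>) (response M x eps \<beta> n \<omega>) = {t}})
            \<longlonglongrightarrow> 1)"
proof -
  interpret regression_sequence P M x eps \<sigma> \<beta> t \<kappa> \<eta> S
    by (rule regression_sequence.intro[OF setting t_def t_finite t_nonempty M_large kappa_pos
        min_eigenvalue eta_pos M_growth inv_sqrt moments])
  show ?thesis
    using greedy_mPVC_consistent[OF a_nonneg a_growth] greedy_MPVC_consistent[OF a_nonneg a_growth]
    by blast
qed

end
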